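(* Let $\Pi$ be a $1$-periodic domain with periodic cell $\varpi$ as in the context. The Bergman projection $P_\Pi$ (the orthogonal projection from $L^2(\Pi)$ onto $A^2(\Pi)$) equals $\mathsf F^{-1}\mathcal P\,\mathsf F$; that is, for every $f\in L^2(\Pi)$ and a.e. $z\in\Pi$, $$P_\Pi f(z)=\mathsf F^{-1}\mathcal P\,\mathsf Ff(z)=\frac1{\sqrt{2\pi}}\int_{-\pi}^{\pi}e^{i[\mathrm{Re}\,z]\eta}\big(P_\eta\widehat f(\cdot,\eta)\big)(z-[\mathrm{Re}\,z])\,d\eta$$ $$=\frac1{2\pi}\int_\Pi\int_{-\pi}^{\pi}e^{i\eta([\mathrm{Re}\,z]-[\mathrm{Re}\,w])}K_\eta\big(z-[\mathrm{Re}\,z],\,w-[\mathrm{Re}\,w]\big)f(w)\,d\eta\,dA(w),$$ where $\widehat f=\mathsf Ff$.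
   Context: Geometry. Identify $\mathbb C\cong\mathbb R^2$. Let $M>0$, $a<b$ be real and let $\varpi\subset\,]0,1[\,\times\,]-M,M[$ be a domain (the periodic cell) whose closure meets the lines $\mathrm{Re}\,z=0$ and $\mathrm{Re}\,z=1$ exactly in $\{0\}\times[a,b]$ and $\{1\}\times[a,b]$. For $m\in\mathbb Z$ let $\varpi_m=\varpi+m$, and let the periodic domain $\Pi$ be the interior of $\bigcup_{m\in\mathbb Z}\mathrm{cl}(\varpi_m)$. It is assumed that $\varpi$ and $\Pi$ are Lipschitz domains with piecewise smooth boundaries ($\partial\varpi$ consists of finitely many curves $\gamma:[0,1]\to\mathbb C$ continuously differentiable on $[0,1]$). ($\Pi$ need not be simply connected.) $L^2(\Omega)$ is taken with respect to area measure $dA$, and $A^2(\Omega)$ is its closed subspace of analytic functions. $[x]$ is the largest integer $\le x$. Floquet transform: for $f\in L^2(\Pi)$, $$\mathsf Ff(z,\eta)=\widehat f(z,\eta)=\frac1{\sqrt{2\pi}}\sum_{m\in\mathbb Z}e^{-i\eta m}f(z+m),\qquad z\in\varpi,\ \eta\in[-\pi,\pi],$$ converging in the Bochner space $L^2(-\pi,\pi;L^2(\varpi))$; $\mathsf F$ is an isometric isomorphism of $L^2(\Pi)$ onto $L^2(-\pi,\pi;L^2(\varpi))$ with inverse $\mathsf F^{-1}g(z)=\frac1{\sqrt{2\pi}}\int_{-\pi}^{\pi}e^{i[\mathrm{Re}\,z]\eta}g(z-[\mathrm{Re}\,z],\eta)\,d\eta$. Spaces and projections: for $\eta\in[-\pi,\pi]$,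 $A^2_{\eta,\mathrm{ext}}(\varpi)$ is the subspace of $A^2(\varpi)$ consisting of functions $f$ which extend analytically to a neighborhood in $\Pi$ of $\mathrm{cl}(\varpi)\cap\Pi$ and satisfy $f(1+iy)=e^{i\eta}f(iy)$ for all $a<y<b$; $A^2_\eta(\varpi)$ is its closure in $A^2(\varpi)$. $P_\eta$ is the orthogonal projection from $L^2(\varpi)$ onto $A^2_\eta(\varpi)$, and $K_\eta:\varpi\times\varpi\to\mathbb C$ is its integral kernel: $P_\eta f(z)=\int_\varpi K_\eta(z,w)f(w)\,dA(w)$, with $K_\eta(z,\cdot)\in L^2(\varpi)$ for all $z\in\varpi$. The operator $\mathcal P$ on $L^2(-\pi,\pi;L^2(\varpi))$ is $\mathcal Pf(z,\eta)=\big(P_\eta f(\cdot,\eta)\big)(z)$. *)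

theory Defs
  imports "HOL-Analysis.Analysis"
begin

subsection \<open>Geometry\<close>

definition periodic_domain :: "complex set \<Rightarrow> complex set" where
  "periodic_domain cell =
     interior (\<Union>m::int. closure ((\<lambda>z. z + of_int m) ` cell))"

text \<open>A domain which, near each boundary point and after a rigid motion, is the set of points
  above the graph of a Lipschitz function. (Since \<open>p\<close> is a boundary point, \<open>\<phi> 0 = 0\<close>
  is automatic.)\<close>

definition lipschitz_domain :: "complex set \<Rightarrow> bool" where
  "lipschitz_domain \<Omega> \<longleftrightarrow>
     open \<Omega> \<and> connected \<Omega> \<and> \<Omega> \<noteq> {} \<and>
     (\<forall>p\<in>frontier \<Omega>. \<exists>r>0. \<exists>u::complex. \<exists>\<phi>::real \<Rightarrow> real. \<exists>L.
        norm u = 1 \<and> L-lipschitz_on UNIV \<phi> \<and>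
        (\<forall>\<zeta>. norm \<zeta> < r \<longrightarrow> (p + u * \<zeta> \<in> \<Omega> \<longleftrightarrow> \<phi> (Re \<zeta>) < Im \<zeta>)))"

text \<open>The family of curves is locally finite, so that the notion makes sense for the unbounded
  periodic domain; for a bounded \<open>\<Omega>\<close>, whose boundary is compact, it is finite.\<close>

definition piecewise_smooth_boundary :: "complex set \<Rightarrow> bool" where
  "piecewise_smooth_boundary \<Omega> \<longleftrightarrow>
     (\<exists>\<Gamma>::(real \<Rightarrow> complex) set.
        (\<forall>\<gamma>\<in>\<Gamma>. \<gamma> C1_differentiable_on {0..1}) \<and>
        (\<forall>K. compact K \<longrightarrow> finite {\<gamma>\<in>\<Gamma>. \<gamma> ` {0..1} \<inter> K \<noteq> {}}) \<and>
        frontier \<Omega> = (\<Union>\<gamma>\<in>\<Gamma>. \<gamma> ` {0..1}))"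


subsection \<open>Square-integrable functions and Bergman spaces\<close>

text \<open>An element of an \<open>L\<^sup>2\<close>-space is represented by a function; equality in the space is
  equality almost everywhere. The operators below whose values are classes of functions return
  some representative. Using the complete measure \<open>lebesgue\<close>, integrals over \<open>\<Omega>\<close> do not
  depend on values on null sets.\<close>

definition L2 :: "complex set \<Rightarrow> (complex \<Rightarrow> complex) set" where
  "L2 \<Omega> = {f. f \<in> borel_measurable (lebesgue_on \<Omega>) \<and>
               integrable (lebesgue_on \<Omega>) (\<lambda>z. (norm (f z))\<^sup>2)}"

definition L2_inner :: "complex set \<Rightarrow> (complex \<Rightarrow> complex) \<Rightarrow> (complex \<Rightarrow> complex) \<Rightarrow> complex" where
  "L2_inner \<Omega> f g = (LINT z|lebesgue_on \<Omega>. f z * cnj (g z))"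

definition L2_norm :: "complex set \<Rightarrow> (complex \<Rightarrow> complex) \<Rightarrow> real" where
  "L2_norm \<Omega> f = sqrt (LINT z|lebesgue_on \<Omega>. (norm (f z))\<^sup>2)"

definition A2 :: "complex set \<Rightarrow> (complex \<Rightarrow> complex) set" where
  "A2 \<Omega> = {f \<in> L2 \<Omega>. f analytic_on \<Omega>}"

text \<open>Orthogonal projection of \<open>L2 \<Omega>\<close> onto a closed subspace \<open>V\<close>. When \<open>V\<close> consists of analytic
  functions the representative is the analytic one, so its values at points of \<open>\<Omega>\<close> are
  determined.\<close>

definition orth_proj ::
    "complex set \<Rightarrow> (complex \<Rightarrow> complex) set \<Rightarrow> (complex \<Rightarrow> complex) \<Rightarrow> complex \<Rightarrow> complex" where
  "orth_proj \<Omega> V f = (SOME g. g \<in> V \<and> (\<forall>h\<in>V. L2_inner \<Omega> (\<lambda>z. f z - g z) h = 0))"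

definition bergman_proj :: "complex set \<Rightarrow> (complex \<Rightarrow> complex) \<Rightarrow> complex \<Rightarrow> complex" where
  "bergman_proj \<Omega> = orth_proj \<Omega> (A2 \<Omega>)"


subsection \<open>Quasi-periodic Bergman spaces on the cell\<close>

definition A2_ext :: "real \<Rightarrow> real \<Rightarrow> complex set \<Rightarrow> real \<Rightarrow> (complex \<Rightarrow> complex) set" where
  "A2_ext a b cell \<eta> =
     {f \<in> A2 cell. \<exists>U F. open U \<and> closure cell \<inter> periodic_domain cell \<subseteq> U \<and>
        U \<subseteq> periodic_domain cell \<and> F analytic_on U \<and> (\<forall>z\<in>cell. F z = f z) \<and>
        (\<forall>y. a < y \<and> y < b \<longrightarrow> F (Complex 1 y) = exp (\<i> * \<eta>) * F (Complex 0 y))}"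

definition A2_quasi :: "real \<Rightarrow> real \<Rightarrow> complex set \<Rightarrow> real \<Rightarrow> (complex \<Rightarrow> complex) set" where
  "A2_quasi a b cell \<eta> =
     {f \<in> A2 cell. \<forall>\<epsilon>>0. \<exists>g\<in>A2_ext a b cell \<eta>. L2_norm cell (\<lambda>z. f z - g z) < \<epsilon>}"

definition quasi_proj ::
    "real \<Rightarrow> real \<Rightarrow> complex set \<Rightarrow> real \<Rightarrow> (complex \<Rightarrow> complex) \<Rightarrow> complex \<Rightarrow> complex" where
  "quasi_proj a b cell \<eta> = orth_proj cell (A2_quasi a b cell \<eta>)"

text \<open>The integral kernel of \<open>quasi_proj\<close>. The integral formula determines \<open>k z\<close> only up to a null
  set; as usual for Bergman kernels we take the representative that is anti-analytic in the
  second variable. Without such a choice, integrating \<open>k z w\<close> over \<open>\<eta>\<close> for fixed \<open>z\<close>, \<open>w\<close>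
  would be meaningless.\<close>

definition quasi_kernel ::
    "real \<Rightarrow> real \<Rightarrow> complex set \<Rightarrow> real \<Rightarrow> complex \<Rightarrow> complex \<Rightarrow> complex" where
  "quasi_kernel a b cell \<eta> =
     (SOME k. \<forall>z\<in>cell. k z \<in> L2 cell \<and> (\<lambda>w. cnj (k z w)) analytic_on cell \<and>
        (\<forall>f\<in>L2 cell. quasi_proj a b cell \<eta> f z = (LINT w|lebesgue_on cell. k z w * f w)))"


subsection \<open>The Bochner space and the Floquet transform\<close>

text \<open>\<open>L\<^sup>2(-\<pi>,\<pi>; L\<^sup>2(cell))\<close>: a function \<open>(z, \<eta>) \<mapsto> g(z, \<eta>)\<close> is written \<open>g \<eta> z\<close>. The second
  condition is strong (Bochner) measurability.\<close>

definition bochner_L2 :: "complex set \<Rightarrow> (real \<Rightarrow> complex \<Rightarrow> complex) set" where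
  "bochner_L2 cell =
     {g. (\<forall>\<eta>\<in>{-pi..pi}. g \<eta> \<in> L2 cell) \<and>
         (\<exists>s::nat \<Rightarrow> real \<Rightarrow> complex \<Rightarrow> complex.
            (\<forall>n. simple_function (lebesgue_on {-pi..pi}) (s n) \<and>
                 (\<forall>\<eta>\<in>{-pi..pi}. s n \<eta> \<in> L2 cell)) \<and>
            (AE \<eta> in lebesgue_on {-pi..pi}.
               (\<lambda>n. L2_norm cell (\<lambda>z. s n \<eta> z - g \<eta> z)) \<longlonglongrightarrow> 0)) \<and>
         integrable (lebesgue_on {-pi..pi}) (\<lambda>\<eta>. (L2_norm cell (g \<eta>))\<^sup>2)}"

definition bochner_L2_norm :: "complex set \<Rightarrow> (real \<Rightarrow> complex \<Rightarrow> complex) \<Rightarrow> real" where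
  "bochner_L2_norm cell g = sqrt (LINT \<eta>|lebesgue_on {-pi..pi}. (L2_norm cell (g \<eta>))\<^sup>2)"

text \<open>The sum of the series in \<open>bochner_L2\<close>, in the sense of the convergence of the net of finite
  partial sums.\<close>

definition floquet :: "complex set \<Rightarrow> (complex \<Rightarrow> complex) \<Rightarrow> real \<Rightarrow> complex \<Rightarrow> complex" where
  "floquet cell f =
     (SOME g. g \<in> bochner_L2 cell \<and>
        ((\<lambda>S. bochner_L2_norm cell (\<lambda>\<eta> z.
             1 / sqrt (2 * pi) * (\<Sum>m\<in>S. exp (- \<i> * \<eta> * of_int m) * f (z + of_int m)) - g \<eta> z))
          \<longlongrightarrow> 0) (finite_subsets_at_top (UNIV :: int set)))"

definition floquet_inv :: "complex set \<Rightarrow> (real \<Rightarrow> complex \<Rightarrow> complex) \<Rightarrow> complex \<Rightarrow> complex" where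
  "floquet_inv cell g =
     (SOME f. f \<in> L2 (periodic_domain cell) \<and>
        (AE \<eta> in lebesgue_on {-pi..pi}. AE z in lebesgue_on cell. floquet cell f \<eta> z = g \<eta> z))"

definition fiber_proj ::
    "real \<Rightarrow> real \<Rightarrow> complex set \<Rightarrow> (real \<Rightarrow> complex \<Rightarrow> complex) \<Rightarrow> real \<Rightarrow> complex \<Rightarrow> complex" where
  "fiber_proj a b cell g \<eta> = quasi_proj a b cell \<eta> (g \<eta>)"

end

(*
  The Floquet transform turns the Bergman projection into a direct integral of the projections
  P_eta. Two facts carry the proof.

  (1) For h in A2(Pi) the partial sums of the Floquet series converge, along a subsequence and
  for almost every eta, locally uniformly on a neighbourhood of the closed cell in Pi (by the
  Bergman inequality). Hence the transform of h at eta lies in A2_ext eta.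

  (2) Conversely, multiplication by exp(i eta z) carries periodic Bergman functions to
  eta-quasi-periodic ones. If H is the periodic extension to Pi of some h in A2_ext 0, then
  H(z) * (integral of exp(i eta z) over -pi < eta < c) belongs to A2(Pi), and pairing it with u
  gives the integral over -pi < eta < c of the inner product of the transform of u with
  exp(i eta z) h. Letting c vary, u orthogonal to A2(Pi) forces its transform to be orthogonal to
  A2_quasi eta for almost every eta; a countable family of h suffices for all eta at once.

  Applied to u = f - P f this identifies P_eta with the fibre of P; applied to the reproducing
  kernel of A2(Pi) at a point it identifies the fibre kernels K_eta.
*)

theory Submission
  imports Defs "HOL-Complex_Analysis.Complex_Analysis"
begin

section \<open>Square-integrable functions\<close>

text \<open>The vertical sides of the cell lie on its boundary, where the Bergman inequality on the
  cell says nothing. Hence the enlargement \<open>cell3\<close>, the part of \<Pi> with real part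
  between -1 and 2: the parts of the sides in \<Pi> are interior to it, and the translates of a
  function stay square-summable over it because a point has at most three integer translates there.
  Quasi-periodicity of the limit holds up to the two end terms of a partial sum, which die out.
  Conversely, a quasi-periodic function has the same size on every cell and cannot be paired with
  elements of \<open>L2 \<Pi>\<close>. Averaging exp(i \<eta> z) over \<eta> produces decay of order
  1/|z|, just enough for square integrability, and the upper limit c acts as an indicator function
  in \<eta>. Nothing is known beforehand about how P_\<eta> or K_\<eta> varies with \<eta>, and the
  transforms are mere choices of representatives. Measurability in \<eta> is therefore obtained from
  almost everywhere limits of finite trigonometric sums, and pointwise statements from analytic
  representatives.\<close>

lemma fatou_integral_bound:
  fixes u :: "nat \<Rightarrow> 'a \<Rightarrow> real"
  assumes u: "\<And>n. integrable M (u n)" "\<And>n x. x \<in> space M \<Longrightarrow> 0 \<le> u n x"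
    and v: "v \<in> borel_measurable M" "\<And>x. x \<in> space M \<Longrightarrow> 0 \<le> v x"
    and lim: "AE x in M. (\<lambda>n. u n x) \<longlonglongrightarrow> v x"
    and B: "\<forall>\<^sub>F n in sequentially. (LINT x|M. u n x) \<le> B"
  shows "integrable M v" "(LINT x|M. v x) \<le> B"
proof -
  have B0: "0 \<le> B"
  proof -
    obtain n where "(LINT x|M. u n x) \<le> B" using B by (meson eventually_happens sequentially_bot)
    moreover have "0 \<le> (LINT x|M. u n x)" using u by (intro integral_nonneg_AE) auto
    ultimately show ?thesis by simp
  qed
  have "(\<integral>\<^sup>+x. ennreal (v x) \<partial>M) = (\<integral>\<^sup>+x. liminf (\<lambda>n. ennreal (u n x)) \<partial>M)"
  proof (rule nn_integral_cong_AE, use lim in eventually_elim)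
    case (elim x)
    then have "(\<lambda>n. ennreal (u n x)) \<longlonglongrightarrow> ennreal (v x)" by (rule tendsto_ennrealI)
    then show ?case by (metis lim_imp_Liminf sequentially_bot)
  qed
  also have "\<dots> \<le> liminf (\<lambda>n. \<integral>\<^sup>+x. ennreal (u n x) \<partial>M)"
    using u by (intro nn_integral_liminf) auto
  also have "\<dots> = liminf (\<lambda>n. ennreal (LINT x|M. u n x))"
    using u by (subst nn_integral_eq_integral) auto
  also have "\<dots> \<le> ennreal B"
  proof (rule order_trans[OF Liminf_le_Limsup])
    show "limsup (\<lambda>n. ennreal (LINT x|M. u n x)) \<le> ennreal B"
      by (rule Limsup_bounded) (use B in eventually_elim, simp add: ennreal_leI)
  qed simp
  finally have le: "(\<integral>\<^sup>+x. ennreal (v x) \<partial>M) \<le> ennreal B" .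
  show I: "integrable M v"
    using v le by (intro integrableI_nonneg) (auto intro: le_less_trans)
  show "(LINT x|M. v x) \<le> B"
    using le v B0 by (subst (asm) nn_integral_eq_integral[OF I]) auto
qed

text \<open>The rate 1/8 leaves room for the weight 2^k: the weighted squares have integrals at most
  (1/4)^k, so their sum is finite almost everywhere. Expanding 2^k (2^-k - |d|)^2 >= 0 then bounds
  2|d| by 2^-k + 2^k d^2. It serves for subsequences of functions in \<open>L2_complete\<close> and
  for norms of fibres in \<open>trig_series_bochner_limit\<close>.\<close>

lemma AE_summable_of_square_integrals:
  fixes d :: "nat \<Rightarrow> 'a \<Rightarrow> real"
  assumes d: "\<And>k. d k \<in> borel_measurable M" "\<And>k. integrable M (\<lambda>x. (d k x)\<^sup>2)"
    and le: "\<And>k. (LINT x|M. (d k x)\<^sup>2) \<le> (1/8) ^ k"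
  shows "AE x in M. summable (\<lambda>k. \<bar>d k x\<bar>)"
proof -
  have "(\<integral>\<^sup>+x. (\<Sum>k. ennreal (2 ^ k * (d k x)\<^sup>2)) \<partial>M) = (\<Sum>k. \<integral>\<^sup>+x. ennreal (2 ^ k * (d k x)\<^sup>2) \<partial>M)"
    using d by (intro nn_integral_suminf) auto
  also have "\<dots> = (\<Sum>k. ennreal (LINT x|M. 2 ^ k * (d k x)\<^sup>2))"
    using d by (subst nn_integral_eq_integral) auto
  also have "\<dots> \<le> (\<Sum>k. ennreal ((1/4) ^ k))"
  proof (intro suminf_le ennreal_leI)
    fix k
    have "(LINT x|M. 2 ^ k * (d k x)\<^sup>2) \<le> 2 ^ k * (1/8) ^ k" using le[of k] by simp
    also have "\<dots> = (1/4::real) ^ k" by (simp flip: power_mult_distrib)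
    finally show "(LINT x|M. 2 ^ k * (d k x)\<^sup>2) \<le> (1/4) ^ k" .
  qed auto
  also have "\<dots> < \<infinity>"
    by (subst suminf_ennreal2) (auto simp: summable_geometric)
  finally have "AE x in M. (\<Sum>k. ennreal (2 ^ k * (d k x)\<^sup>2)) \<noteq> \<infinity>"
    using d by (intro nn_integral_PInf_AE) auto
  then show ?thesis
  proof eventually_elim
    case (elim x)
    then have s: "summable (\<lambda>k. 2 ^ k * (d k x)\<^sup>2)"
      using summable_suminf_not_top[of "\<lambda>k. 2 ^ k * (d k x)\<^sup>2"] by auto
    have "summable (\<lambda>k. (1/2) ^ k + 2 ^ k * (d k x)\<^sup>2)"
      by (intro summable_add s) (simp add: summable_geometric)
    then show ?case
    proof (rule summable_comparison_test')
      fix k :: nat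
      have "2 * \<bar>d k x\<bar> \<le> (1/2) ^ k + 2 ^ k * (d k x)\<^sup>2"
      proof -
        have "0 \<le> 2 ^ k * ((1/2)^k - \<bar>d k x\<bar>)\<^sup>2" by simp
        also have "\<dots> = (2 ^ k * (1/2)^k) * (1/2) ^ k + 2 ^ k * (d k x)\<^sup>2 - 2 * (2 ^ k * (1/2)^k) * \<bar>d k x\<bar>"
          by (simp add: power2_eq_square algebra_simps del: power_one_over)
        also have "(2::real) ^ k * (1/2)^k = 1" by (simp add: power_one_over)
        finally show ?thesis by simp
      qed
      then show "norm \<bar>d k x\<bar> \<le> (1/2) ^ k + 2 ^ k * (d k x)\<^sup>2" by simp
    qed
  qed
qed

section \<open>Norm and inner product on \<open>L2\<close>\<close>

lemma L2_measurable: "f \<in> L2 \<Omega> \<Longrightarrow> f \<in> borel_measurable (lebesgue_on \<Omega>)"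
  by (simp add: L2_def)

lemma L2_square_integrable: "f \<in> L2 \<Omega> \<Longrightarrow> integrable (lebesgue_on \<Omega>) (\<lambda>z. (norm (f z))\<^sup>2)"
  by (simp add: L2_def)

lemma L2_norm_nonneg: "0 \<le> L2_norm \<Omega> f"
  by (auto simp: L2_norm_def intro!: integral_nonneg_AE)

lemma L2_norm_power2: "(L2_norm \<Omega> f)\<^sup>2 = (LINT z|lebesgue_on \<Omega>. (norm (f z))\<^sup>2)"
  unfolding L2_norm_def by (subst real_sqrt_pow2) (auto intro!: integral_nonneg_AE)

lemma L2_dominated:
  assumes "f \<in> L2 \<Omega>" "g \<in> borel_measurable (lebesgue_on \<Omega>)"
    and "\<And>z. z \<in> \<Omega> \<Longrightarrow> norm (g z) \<le> B * norm (f z)"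
  shows "g \<in> L2 \<Omega>" "0 \<le> B \<Longrightarrow> L2_norm \<Omega> g \<le> B * L2_norm \<Omega> f"
proof -
  have le: "(norm (g z))\<^sup>2 \<le> B\<^sup>2 * (norm (f z))\<^sup>2" if "z \<in> \<Omega>" for z
    using power_mono[OF assms(3)[OF that] norm_ge_zero, of 2] by (simp add: power_mult_distrib)
  have int: "integrable (lebesgue_on \<Omega>) (\<lambda>z. B\<^sup>2 * (norm (f z))\<^sup>2)"
    using L2_square_integrable[OF assms(1)] by simp
  have gi: "integrable (lebesgue_on \<Omega>) (\<lambda>z. (norm (g z))\<^sup>2)"
    using int by (rule Bochner_Integration.integrable_bound) (use assms(2) le in auto)
  then show "g \<in> L2 \<Omega>" using assms(2) by (simp add: L2_def)
  assume B: "0 \<le> B"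
  have "(L2_norm \<Omega> g)\<^sup>2 \<le> (LINT z|lebesgue_on \<Omega>. B\<^sup>2 * (norm (f z))\<^sup>2)"
    unfolding L2_norm_power2 by (rule integral_mono[OF gi int]) (use le in auto)
  also have "\<dots> = (B * L2_norm \<Omega> f)\<^sup>2" by (simp add: L2_norm_power2 power_mult_distrib)
  finally show "L2_norm \<Omega> g \<le> B * L2_norm \<Omega> f"
    using B L2_norm_nonneg by (meson mult_nonneg_nonneg power2_le_imp_le)
qed

lemma L2_bounded_mult:
  assumes "f \<in> L2 \<Omega>" "g \<in> borel_measurable (lebesgue_on \<Omega>)"
    and "\<And>z. z \<in> \<Omega> \<Longrightarrow> norm (g z) \<le> B" "0 \<le> B"
  shows "(\<lambda>z. g z * f z) \<in> L2 \<Omega>" "L2_norm \<Omega> (\<lambda>z. g z * f z) \<le> B * L2_norm \<Omega> f"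
proof -
  have "(\<lambda>z. g z * f z) \<in> borel_measurable (lebesgue_on \<Omega>)"
    using assms(2) L2_measurable[OF assms(1)] by simp
  moreover have "norm (g z * f z) \<le> B * norm (f z)" if "z \<in> \<Omega>" for z
    using assms(3)[OF that] by (simp add: norm_mult mult_right_mono)
  ultimately show "(\<lambda>z. g z * f z) \<in> L2 \<Omega>" "L2_norm \<Omega> (\<lambda>z. g z * f z) \<le> B * L2_norm \<Omega> f"
    using L2_dominated[OF assms(1)] assms(4) by blast+
qed

lemma L2_zero: "(\<lambda>z. 0) \<in> L2 \<Omega>"
  by (simp add: L2_def)

lemma L2_cmult: "f \<in> L2 \<Omega> \<Longrightarrow> (\<lambda>z. c * f z) \<in> L2 \<Omega>"
  by (rule L2_bounded_mult(1)[of _ _ _ "norm c"]) auto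

lemma L2_norm_cmult: "L2_norm \<Omega> (\<lambda>z. c * f z) = norm c * L2_norm \<Omega> f"
  by (simp add: L2_norm_def norm_mult power_mult_distrib real_sqrt_mult)

lemma L2_uminus: "f \<in> L2 \<Omega> \<Longrightarrow> (\<lambda>z. - f z) \<in> L2 \<Omega>"
  using L2_cmult[of f \<Omega> "-1"] by simp

lemma L2_norm_uminus: "L2_norm \<Omega> (\<lambda>z. - f z) = L2_norm \<Omega> f"
  by (simp add: L2_norm_def)

lemma L2_norm_minus_commute: "L2_norm \<Omega> (\<lambda>z. f z - g z) = L2_norm \<Omega> (\<lambda>z. g z - f z)"
  by (simp add: L2_norm_def norm_minus_commute)

lemma L2_norm_zero: "L2_norm \<Omega> (\<lambda>z. 0) = 0"
  by (simp add: L2_norm_def)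

lemma L2_mult_integrable:
  assumes "f \<in> L2 \<Omega>" "g \<in> L2 \<Omega>"
  shows "integrable (lebesgue_on \<Omega>) (\<lambda>z. f z * g z)"
proof (rule Bochner_Integration.integrable_bound)
  show "integrable (lebesgue_on \<Omega>) (\<lambda>z. (norm (f z))\<^sup>2 + (norm (g z))\<^sup>2)"
    using assms by (auto simp: L2_def)
  show "(\<lambda>z. f z * g z) \<in> borel_measurable (lebesgue_on \<Omega>)"
    using assms[THEN L2_measurable] by simp
  have "norm (f z) * norm (g z) \<le> (norm (f z))\<^sup>2 + (norm (g z))\<^sup>2" for z
  proof -
    have "0 \<le> norm (f z) * norm (g z)" by simp
    then show ?thesis using sum_squares_bound[of "norm (f z)" "norm (g z)"] by linarith
  qed
  then show "AE z in lebesgue_on \<Omega>. norm (f z * g z) \<le> norm ((norm (f z))\<^sup>2 + (norm (g z))\<^sup>2)"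
    by (simp add: norm_mult)
qed

lemma L2_cnj: "f \<in> L2 \<Omega> \<Longrightarrow> (\<lambda>z. cnj (f z)) \<in> L2 \<Omega>"
  using borel_measurable_continuous_on[OF continuous_on_cnj[OF continuous_on_id], of f]
  by (auto simp: L2_def)

lemma L2_inner_integrable:
  "f \<in> L2 \<Omega> \<Longrightarrow> g \<in> L2 \<Omega> \<Longrightarrow> integrable (lebesgue_on \<Omega>) (\<lambda>z. f z * cnj (g z))"
  by (intro L2_mult_integrable L2_cnj)

lemma L2_add:
  assumes "f \<in> L2 \<Omega>" "g \<in> L2 \<Omega>"
  shows "(\<lambda>z. f z + g z) \<in> L2 \<Omega>"
proof -
  have int: "integrable (lebesgue_on \<Omega>) (\<lambda>z. 2 * (norm (f z))\<^sup>2 + 2 * (norm (g z))\<^sup>2)"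
    using assms by (auto simp: L2_def)
  have le: "(norm (f z + g z))\<^sup>2 \<le> 2 * (norm (f z))\<^sup>2 + 2 * (norm (g z))\<^sup>2" for z
  proof -
    have "(norm (f z + g z))\<^sup>2 \<le> (norm (f z) + norm (g z))\<^sup>2"
      by (intro power_mono norm_triangle_ineq) auto
    also have "\<dots> \<le> 2 * (norm (f z))\<^sup>2 + 2 * (norm (g z))\<^sup>2"
      using sum_squares_bound[of "norm (f z)" "norm (g z)"] by (simp add: power2_sum)
    finally show ?thesis .
  qed
  have "integrable (lebesgue_on \<Omega>) (\<lambda>z. (norm (f z + g z))\<^sup>2)"
    using int by (rule Bochner_Integration.integrable_bound)
      (use assms[THEN L2_measurable] le in \<open>auto intro!: AE_I2 simp: order_trans[OF _ abs_ge_self]\<close>)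
  then show ?thesis using assms[THEN L2_measurable] by (simp add: L2_def)
qed

lemma L2_diff: "f \<in> L2 \<Omega> \<Longrightarrow> g \<in> L2 \<Omega> \<Longrightarrow> (\<lambda>z. f z - g z) \<in> L2 \<Omega>"
  using L2_add[OF _ L2_uminus] by fastforce

lemma L2_sum: "(\<And>i. i \<in> I \<Longrightarrow> f i \<in> L2 \<Omega>) \<Longrightarrow> (\<lambda>z. \<Sum>i\<in>I. f i z) \<in> L2 \<Omega>"
  by (induction I rule: infinite_finite_induct) (auto simp: L2_zero L2_add)

lemma L2_inner_add_left:
  "f \<in> L2 \<Omega> \<Longrightarrow> g \<in> L2 \<Omega> \<Longrightarrow> h \<in> L2 \<Omega> \<Longrightarrow>
    L2_inner \<Omega> (\<lambda>z. f z + g z) h = L2_inner \<Omega> f h + L2_inner \<Omega> g h"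
  by (simp add: L2_inner_def algebra_simps L2_inner_integrable)

lemma L2_inner_diff_left:
  "f \<in> L2 \<Omega> \<Longrightarrow> g \<in> L2 \<Omega> \<Longrightarrow> h \<in> L2 \<Omega> \<Longrightarrow>
    L2_inner \<Omega> (\<lambda>z. f z - g z) h = L2_inner \<Omega> f h - L2_inner \<Omega> g h"
  by (simp add: L2_inner_def algebra_simps L2_inner_integrable)

lemma L2_inner_cmult_left: "L2_inner \<Omega> (\<lambda>z. c * f z) h = c * L2_inner \<Omega> f h"
  by (simp add: L2_inner_def mult.assoc)

lemma L2_inner_commute: "L2_inner \<Omega> f g = cnj (L2_inner \<Omega> g f)"
proof -
  have "cnj (L2_inner \<Omega> g f) = (LINT z|lebesgue_on \<Omega>. cnj (g z * cnj (f z)))"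
    unfolding L2_inner_def by (simp del: complex_cnj_mult)
  also have "\<dots> = L2_inner \<Omega> f g" unfolding L2_inner_def by (simp add: mult.commute)
  finally show ?thesis by simp
qed

lemma L2_inner_diff_right:
  "f \<in> L2 \<Omega> \<Longrightarrow> g \<in> L2 \<Omega> \<Longrightarrow> h \<in> L2 \<Omega> \<Longrightarrow>
    L2_inner \<Omega> h (\<lambda>z. f z - g z) = L2_inner \<Omega> h f - L2_inner \<Omega> h g"
  by (simp add: L2_inner_def algebra_simps L2_inner_integrable)

lemma L2_inner_add_right:
  "f \<in> L2 \<Omega> \<Longrightarrow> g \<in> L2 \<Omega> \<Longrightarrow> h \<in> L2 \<Omega> \<Longrightarrow>
    L2_inner \<Omega> h (\<lambda>z. f z + g z) = L2_inner \<Omega> h f + L2_inner \<Omega> h g"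
  by (simp add: L2_inner_def algebra_simps L2_inner_integrable)

lemma L2_inner_cmult_right: "L2_inner \<Omega> h (\<lambda>z. c * f z) = cnj c * L2_inner \<Omega> h f"
  by (simp add: L2_inner_def mult.left_commute)

lemma L2_inner_self: "L2_inner \<Omega> f f = of_real ((L2_norm \<Omega> f)\<^sup>2)"
  unfolding L2_norm_power2 L2_inner_def complex_norm_square[symmetric] of_real_power[symmetric]
  by (rule integral_complex_of_real)

lemma L2_norm_add_power2:
  assumes "f \<in> L2 \<Omega>" "g \<in> L2 \<Omega>"
  shows "(L2_norm \<Omega> (\<lambda>z. f z + g z))\<^sup>2 = (L2_norm \<Omega> f)\<^sup>2 + 2 * Re (L2_inner \<Omega> f g) + (L2_norm \<Omega> g)\<^sup>2"
proof -
  have "complex_of_real ((L2_norm \<Omega> (\<lambda>z. f z + g z))\<^sup>2)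
      = L2_inner \<Omega> f f + L2_inner \<Omega> f g + cnj (L2_inner \<Omega> f g) + L2_inner \<Omega> g g"
    unfolding L2_inner_self[symmetric]
    using assms L2_inner_commute[of \<Omega> g f]
    by (simp add: L2_inner_add_left L2_inner_add_right L2_add)
  also have "\<dots> = complex_of_real ((L2_norm \<Omega> f)\<^sup>2 + 2 * Re (L2_inner \<Omega> f g) + (L2_norm \<Omega> g)\<^sup>2)"
    by (simp add: L2_inner_self complex_eq_iff)
  finally show ?thesis by (simp only: of_real_eq_iff)
qed

lemma L2_norm_diff_power2:
  assumes "f \<in> L2 \<Omega>" "g \<in> L2 \<Omega>"
  shows "(L2_norm \<Omega> (\<lambda>z. f z - g z))\<^sup>2 = (L2_norm \<Omega> f)\<^sup>2 - 2 * Re (L2_inner \<Omega> f g) + (L2_norm \<Omega> g)\<^sup>2"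
proof -
  have "L2_inner \<Omega> f (\<lambda>z. - g z) = - L2_inner \<Omega> f g" by (simp add: L2_inner_def)
  then show ?thesis
    using L2_norm_add_power2[OF assms(1) L2_uminus[OF assms(2)]] L2_norm_uminus[of \<Omega> g] by simp
qed

lemma L2_norm_eq_0_iff:
  assumes "f \<in> L2 \<Omega>"
  shows "L2_norm \<Omega> f = 0 \<longleftrightarrow> (AE z in lebesgue_on \<Omega>. f z = 0)"
proof -
  have "L2_norm \<Omega> f = 0 \<longleftrightarrow> (LINT z|lebesgue_on \<Omega>. (norm (f z))\<^sup>2) = 0"
    by (simp add: L2_norm_def)
  also have "\<dots> \<longleftrightarrow> (AE z in lebesgue_on \<Omega>. (norm (f z))\<^sup>2 = 0)"
    by (rule integral_nonneg_eq_0_iff_AE) (use L2_square_integrable[OF assms] in auto)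
  finally show ?thesis by simp
qed

lemma L2_norm_cong_AE:
  assumes "f \<in> L2 \<Omega>" "g \<in> L2 \<Omega>" "AE z in lebesgue_on \<Omega>. f z = g z"
  shows "L2_norm \<Omega> f = L2_norm \<Omega> g"
proof -
  have "(LINT z|lebesgue_on \<Omega>. (norm (f z))\<^sup>2) = (LINT z|lebesgue_on \<Omega>. (norm (g z))\<^sup>2)"
    by (rule integral_cong_AE) (use assms in \<open>auto simp: L2_def\<close>)
  then show ?thesis by (simp add: L2_norm_def)
qed

lemma L2_inner_cong_AE:
  assumes "f \<in> L2 \<Omega>" "g \<in> L2 \<Omega>" "h \<in> L2 \<Omega>" "AE z in lebesgue_on \<Omega>. f z = g z"
  shows "L2_inner \<Omega> f h = L2_inner \<Omega> g h"
proof -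
  have "(\<lambda>z. cnj (h z)) \<in> borel_measurable (lebesgue_on \<Omega>)"
    using L2_cnj[OF assms(3)] by (rule L2_measurable)
  then show ?thesis
    unfolding L2_inner_def
    by (intro integral_cong_AE) (use assms in \<open>auto simp: L2_def\<close>)
qed

lemma L2_Cauchy_Schwarz:
  assumes "f \<in> L2 \<Omega>" "g \<in> L2 \<Omega>"
  shows "norm (L2_inner \<Omega> f g) \<le> L2_norm \<Omega> f * L2_norm \<Omega> g"
proof (cases "L2_norm \<Omega> g = 0")
  case True
  then have "AE z in lebesgue_on \<Omega>. g z = 0" using L2_norm_eq_0_iff assms by blast
  then have "L2_inner \<Omega> g f = L2_inner \<Omega> (\<lambda>z. 0) f"
    by (intro L2_inner_cong_AE assms L2_zero)
  then have "L2_inner \<Omega> f g = 0" using L2_inner_commute[of \<Omega> f g] by (simp add: L2_inner_def)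
  then show ?thesis by (simp add: L2_norm_nonneg)
next
  case False
  define w where "w = L2_inner \<Omega> f g"
  define G where "G = (L2_norm \<Omega> g)\<^sup>2"
  have G: "G > 0" using False by (simp add: G_def)
  \<comment> \<open>The coefficient of the projection of \<open>f\<close> onto the line of
    \<open>g\<close>; it makes the square below as small as possible.\<close>
  define c where "c = w / of_real G"
  have "0 \<le> (L2_norm \<Omega> (\<lambda>z. f z - c * g z))\<^sup>2" by simp
  also have "\<dots> = (L2_norm \<Omega> f)\<^sup>2 - 2 * Re (cnj c * w) + (norm c * L2_norm \<Omega> g)\<^sup>2"
    by (simp add: L2_norm_diff_power2 assms L2_cmult L2_inner_cmult_right L2_norm_cmult w_def)
  also have "Re (cnj c * w) = (norm w)\<^sup>2 / G"
    by (simp add: c_def cmod_power2 power2_eq_square[of "Re w"] power2_eq_square[of "Im w"] add_divide_distrib)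
  also have "(norm c * L2_norm \<Omega> g)\<^sup>2 = (norm w)\<^sup>2 / G"
    unfolding power_mult_distrib G_def[symmetric]
    using G by (simp add: c_def norm_divide power2_eq_square)
  finally have "(norm w)\<^sup>2 \<le> (L2_norm \<Omega> f * L2_norm \<Omega> g)\<^sup>2"
    using G by (simp add: field_simps power_mult_distrib flip: G_def)
  then show ?thesis
    unfolding w_def by (rule power2_le_imp_le) (simp add: L2_norm_nonneg)
qed

lemma L2_norm_triangle:
  assumes "f \<in> L2 \<Omega>" "g \<in> L2 \<Omega>"
  shows "L2_norm \<Omega> (\<lambda>z. f z + g z) \<le> L2_norm \<Omega> f + L2_norm \<Omega> g"
proof (rule power2_le_imp_le)
  have "Re (L2_inner \<Omega> f g) \<le> L2_norm \<Omega> f * L2_norm \<Omega> g"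
    using L2_Cauchy_Schwarz[OF assms] complex_Re_le_cmod order_trans by blast
  then show "(L2_norm \<Omega> (\<lambda>z. f z + g z))\<^sup>2 \<le> (L2_norm \<Omega> f + L2_norm \<Omega> g)\<^sup>2"
    using L2_norm_add_power2[OF assms] by (simp add: power2_sum)
qed (simp add: L2_norm_nonneg)

lemma L2_norm_diff_triangle:
  assumes "f \<in> L2 \<Omega>" "g \<in> L2 \<Omega>" "h \<in> L2 \<Omega>"
  shows "L2_norm \<Omega> (\<lambda>z. f z - h z) \<le> L2_norm \<Omega> (\<lambda>z. f z - g z) + L2_norm \<Omega> (\<lambda>z. g z - h z)"
  using L2_norm_triangle[of "\<lambda>z. f z - g z" \<Omega> "\<lambda>z. g z - h z"] assms by (simp add: L2_diff)

lemma L2_norm_sum: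
  assumes "\<And>i. i \<in> I \<Longrightarrow> f i \<in> L2 \<Omega>"
  shows "L2_norm \<Omega> (\<lambda>z. \<Sum>i\<in>I. f i z) \<le> (\<Sum>i\<in>I. L2_norm \<Omega> (f i))"
  using assms
proof (induction I rule: infinite_finite_induct)
  case (insert i I)
  have "L2_norm \<Omega> (\<lambda>z. f i z + (\<Sum>i\<in>I. f i z)) \<le> L2_norm \<Omega> (f i) + L2_norm \<Omega> (\<lambda>z. \<Sum>i\<in>I. f i z)"
    by (intro L2_norm_triangle L2_sum) (use insert in auto)
  also have "\<dots> \<le> L2_norm \<Omega> (f i) + (\<Sum>i\<in>I. L2_norm \<Omega> (f i))"
    using insert by (intro add_left_mono) auto
  finally show ?case using insert by simp
qed (auto simp: L2_norm_zero)

lemma L2_subset: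
  assumes "f \<in> L2 \<Omega>" "\<Omega>' \<subseteq> \<Omega>" "\<Omega> \<in> sets lebesgue" "\<Omega>' \<in> sets lebesgue"
  shows "f \<in> L2 \<Omega>'" "L2_norm \<Omega>' f \<le> L2_norm \<Omega> f"
proof -
  have m: "f \<in> borel_measurable (lebesgue_on \<Omega>')"
    using measurable_restrict_mono L2_measurable[OF assms(1)] assms(2) by blast
  have i: "integrable (lebesgue_on \<Omega>') (\<lambda>z. (norm (f z))\<^sup>2)"
  proof -
    have "integrable lebesgue (\<lambda>z. if z \<in> \<Omega> then (norm (f z))\<^sup>2 else 0)"
      using L2_square_integrable[OF assms(1)] assms(3) by (simp only: Lebesgue_Measure.integrable_restrict_UNIV)
    then have "integrable lebesgue (\<lambda>z. indicator \<Omega>' z *\<^sub>R (if z \<in> \<Omega> then (norm (f z))\<^sup>2 else 0))"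
      using assms(4) by (intro integrable_mult_indicator) auto
    also have "(\<lambda>z. indicator \<Omega>' z *\<^sub>R (if z \<in> \<Omega> then (norm (f z))\<^sup>2 else 0))
        = (\<lambda>z. if z \<in> \<Omega>' then (norm (f z))\<^sup>2 else 0)"
      using assms(2) by (auto simp: indicator_def fun_eq_iff)
    finally show ?thesis using assms(4) by (simp only: Lebesgue_Measure.integrable_restrict_UNIV)
  qed
  show "f \<in> L2 \<Omega>'" using m i by (simp add: L2_def)
  have "(LINT z|lebesgue_on \<Omega>'. (norm (f z))\<^sup>2) \<le> (LINT z|lebesgue_on \<Omega>. (norm (f z))\<^sup>2)"
    by (rule integral_mono_lebesgue_on_AE[OF L2_square_integrable[OF assms(1)]]) (use assms in auto)
  then show "L2_norm \<Omega>' f \<le> L2_norm \<Omega> f" by (simp add: L2_norm_def)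
qed

section \<open>Limits and completeness in \<open>L2\<close>\<close>

lemma L2_inner_tendsto:
  assumes "\<And>n. f n \<in> L2 \<Omega>" "g \<in> L2 \<Omega>" "h \<in> L2 \<Omega>"
    and "((\<lambda>n. L2_norm \<Omega> (\<lambda>z. f n z - g z)) \<longlongrightarrow> 0) F"
  shows "((\<lambda>n. L2_inner \<Omega> (f n) h) \<longlongrightarrow> L2_inner \<Omega> g h) F"
proof -
  have "((\<lambda>n. L2_inner \<Omega> (f n) h - L2_inner \<Omega> g h) \<longlongrightarrow> 0) F"
  proof (rule Lim_null_comparison)
    show "\<forall>\<^sub>F n in F. norm (L2_inner \<Omega> (f n) h - L2_inner \<Omega> g h) \<le> L2_norm \<Omega> (\<lambda>z. f n z - g z) * L2_norm \<Omega> h"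
    proof (intro always_eventually allI)
      fix n
      show "norm (L2_inner \<Omega> (f n) h - L2_inner \<Omega> g h) \<le> L2_norm \<Omega> (\<lambda>z. f n z - g z) * L2_norm \<Omega> h"
        using L2_Cauchy_Schwarz[of "\<lambda>z. f n z - g z" \<Omega> h] assms by (simp add: L2_diff L2_inner_diff_left)
    qed
    show "((\<lambda>n. L2_norm \<Omega> (\<lambda>z. f n z - g z) * L2_norm \<Omega> h) \<longlongrightarrow> 0) F"
      using tendsto_mult_right[OF assms(4), of "L2_norm \<Omega> h"] by simp
  qed
  then show ?thesis by (simp add: LIM_zero_iff)
qed

text \<open>\<open>D\<close> is an arbitrary double sequence and not a distance, because it is used
  both for norms of differences and for sums over the difference of two index intervals, which is
  not symmetric.\<close>

lemma Cauchy_fast_subsequence: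
  fixes D :: "nat \<Rightarrow> nat \<Rightarrow> real"
  assumes "\<And>e. e > 0 \<Longrightarrow> \<exists>N. \<forall>m\<ge>N. \<forall>n\<ge>N. D m n < e" "\<And>k. 0 < \<epsilon> k"
  obtains r :: "nat \<Rightarrow> nat" where "strict_mono r" "\<And>k m n. m \<ge> r k \<Longrightarrow> n \<ge> r k \<Longrightarrow> D m n < \<epsilon> k"
proof -
  obtain N where N: "\<And>k m n. m \<ge> N k \<Longrightarrow> n \<ge> N k \<Longrightarrow> D m n < \<epsilon> k"
  proof -
    have "\<forall>k. \<exists>N. \<forall>m n. m \<ge> N \<longrightarrow> n \<ge> N \<longrightarrow> D m n < \<epsilon> k"
      using assms by meson
    then show ?thesis using that by metis
  qed
  define r where "r = rec_nat (N 0) (\<lambda>k x. max (Suc x) (N (Suc k)))"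
  have "strict_mono r" unfolding strict_mono_Suc_iff
    by (simp add: r_def less_max_iff_disj)
  moreover have "N k \<le> r k" for k by (cases k) (auto simp: r_def)
  ultimately show ?thesis using that N by (meson order_trans)
qed

text \<open>Riesz-Fischer. A subsequence with fast steps converges almost everywhere to the
  candidate limit. The subsequence is part of the conclusion because \<open>A2_limit\<close> has to
  compare an almost everywhere limit with a pointwise one.\<close>

lemma L2_complete:
  assumes f: "\<And>n. f n \<in> L2 \<Omega>"
    and C: "\<And>e. e > 0 \<Longrightarrow> \<exists>N. \<forall>m\<ge>N. \<forall>n\<ge>N. L2_norm \<Omega> (\<lambda>z. f m z - f n z) < e"
  obtains g r where "g \<in> L2 \<Omega>" "(\<lambda>n. L2_norm \<Omega> (\<lambda>z. f n z - g z)) \<longlonglongrightarrow> 0" "strict_mono r"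
    "AE z in lebesgue_on \<Omega>. (\<lambda>k. f (r k) z) \<longlonglongrightarrow> g z"
proof -
  obtain r where r: "strict_mono r"
    and D: "\<And>k m n. m \<ge> r k \<Longrightarrow> n \<ge> r k \<Longrightarrow> L2_norm \<Omega> (\<lambda>z. f m z - f n z) < sqrt ((1/8)^k)"
    using Cauchy_fast_subsequence[OF C, of "\<lambda>k. sqrt ((1/8)^k)"] by auto
  note [measurable] = L2_measurable[OF f]
  let ?d = "\<lambda>k z. norm (f (r (Suc k)) z - f (r k) z)"
  have "AE z in lebesgue_on \<Omega>. summable (\<lambda>k. \<bar>?d k z\<bar>)"
  proof (rule AE_summable_of_square_integrals)
    fix k
    show "integrable (lebesgue_on \<Omega>) (\<lambda>z. (?d k z)\<^sup>2)"
      using L2_square_integrable[OF L2_diff[OF f f]] .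
    have "L2_norm \<Omega> (\<lambda>z. f (r (Suc k)) z - f (r k) z) < sqrt ((1/8)^k)"
      using r by (intro D) (auto simp: strict_mono_less_eq)
    then have "(L2_norm \<Omega> (\<lambda>z. f (r (Suc k)) z - f (r k) z))\<^sup>2 \<le> (sqrt ((1/8)^k))\<^sup>2"
      using L2_norm_nonneg less_imp_le by (intro power_mono) auto
    then show "(LINT z|lebesgue_on \<Omega>. (?d k z)\<^sup>2) \<le> (1/8) ^ k"
      unfolding L2_norm_power2 by (simp del: power_one_over)
  qed simp
  then have conv: "AE z in lebesgue_on \<Omega>. convergent (\<lambda>k. f (r k) z)"
  proof eventually_elim
    case (elim z)
    then have "summable (\<lambda>k. f (r (Suc k)) z - f (r k) z)"
      using summable_norm_cancel by auto
    from summable_LIMSEQ[OF this] have "convergent (\<lambda>n. f (r n) z - f (r 0) z)"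
      unfolding sum_lessThan_telescope[of "\<lambda>n. f (r n) z"] by (rule convergentI)
    from convergent_add[OF this convergent_const[of "f (r 0) z"]] show ?case by simp
  qed
  define g where "g = (\<lambda>z. lim (\<lambda>k. f (r k) z))"
  have [measurable]: "g \<in> borel_measurable (lebesgue_on \<Omega>)"
    unfolding g_def by measurable
  have lim: "AE z in lebesgue_on \<Omega>. (\<lambda>k. f (r k) z) \<longlonglongrightarrow> g z"
    using conv by eventually_elim (simp add: g_def convergent_LIMSEQ_iff)
  \<comment> \<open>Fatou with \<open>n\<close> fixed and \<open>k\<close> growing carries the
    Cauchy bound from \<open>f n - f (r k)\<close> to \<open>f n - g\<close>.\<close>
  have bound: "integrable (lebesgue_on \<Omega>) (\<lambda>z. (norm (f n z - g z))\<^sup>2) \<and>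
       (LINT z|lebesgue_on \<Omega>. (norm (f n z - g z))\<^sup>2) \<le> e\<^sup>2"
    if "e > 0" "\<forall>m\<ge>N. \<forall>n\<ge>N. L2_norm \<Omega> (\<lambda>z. f m z - f n z) < e" "n \<ge> N" for n N e
  proof -
    let ?u = "\<lambda>k z. (norm (f n z - f (r k) z))\<^sup>2"
    have 1: "\<And>k. integrable (lebesgue_on \<Omega>) (?u k)" using L2_square_integrable[OF L2_diff[OF f f]] .
    have 2: "AE z in lebesgue_on \<Omega>. (\<lambda>k. ?u k z) \<longlonglongrightarrow> (norm (f n z - g z))\<^sup>2"
      using lim by eventually_elim (intro tendsto_intros)
    have 3: "\<forall>\<^sub>F k in sequentially. (LINT z|lebesgue_on \<Omega>. ?u k z) \<le> e\<^sup>2"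
    proof (rule eventually_sequentiallyI[of N])
      fix k assume "k \<ge> N"
      then have "r k \<ge> N" using r seq_suble le_trans by blast
      then have "L2_norm \<Omega> (\<lambda>z. f n z - f (r k) z) < e" using that by auto
      then have "(L2_norm \<Omega> (\<lambda>z. f n z - f (r k) z))\<^sup>2 \<le> e\<^sup>2"
        using L2_norm_nonneg less_imp_le by (intro power_mono) auto
      then show "(LINT z|lebesgue_on \<Omega>. ?u k z) \<le> e\<^sup>2" by (simp add: L2_norm_power2)
    qed
    show ?thesis
      using fatou_integral_bound[OF 1 _ _ _ 2 3] by simp
  qed
  have fg: "(\<lambda>z. f n z - g z) \<in> L2 \<Omega> \<and> L2_norm \<Omega> (\<lambda>z. f n z - g z) \<le> e"
    if "e > 0" "\<forall>m\<ge>N. \<forall>n\<ge>N. L2_norm \<Omega> (\<lambda>z. f m z - f n z) < e" "n \<ge> N" for n N e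
    using bound[OF that] that(1) by (auto simp: L2_def L2_norm_def real_le_lsqrt)
  have gL2: "g \<in> L2 \<Omega>"
  proof -
    obtain N where "\<forall>m\<ge>N. \<forall>n\<ge>N. L2_norm \<Omega> (\<lambda>z. f m z - f n z) < 1" using C[of 1] by auto
    then have "(\<lambda>z. f N z - g z) \<in> L2 \<Omega>" using fg[of 1 N N] by simp
    from L2_diff[OF f[of N] this] show ?thesis by simp
  qed
  have "(\<lambda>n. L2_norm \<Omega> (\<lambda>z. f n z - g z)) \<longlonglongrightarrow> 0"
  proof (rule LIMSEQ_I)
    fix e :: real assume "e > 0"
    then obtain N where "\<forall>m\<ge>N. \<forall>n\<ge>N. L2_norm \<Omega> (\<lambda>z. f m z - f n z) < e/2" using C[of "e/2"] by auto
    then have "\<forall>n\<ge>N. norm (L2_norm \<Omega> (\<lambda>z. f n z - g z) - 0) < e"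
      using fg[of "e/2" N] \<open>e > 0\<close> by (force simp: L2_norm_nonneg)
    then show "\<exists>N. \<forall>n\<ge>N. norm (L2_norm \<Omega> (\<lambda>z. f n z - g z) - 0) < e" ..
  qed
  with gL2 r lim that show ?thesis by blast
qed

section \<open>Pointwise bounds for Bergman functions\<close>

abbreviation (input) vec_to_complex :: "real^2 \<Rightarrow> complex" where
  "vec_to_complex v \<equiv> Complex (v$1) (v$2)"

lemma borel_measurable_vec_to_complex: "vec_to_complex \<in> borel_measurable borel"
  by (intro borel_measurable_continuous_onI continuous_intros)

text \<open>The real and imaginary parts are orthonormal coordinates, so boxes correspond to boxes
  of the same volume. This carries invariance under orthogonal transformations from
  \<open>real^2\<close> to \<open>complex\<close>.\<close>

lemma lborel_complex_eq_distr: "lborel = distr lborel borel vec_to_complex"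
proof (rule lborel_eqI)
  fix l u :: complex assume le: "\<And>b. b \<in> Basis \<Longrightarrow> l \<bullet> b \<le> u \<bullet> b"
  have lu: "Re l \<le> Re u" "Im l \<le> Im u" using le[of 1] le[of \<i>] by (auto simp: Basis_complex_def)
  let ?l = "vector [Re l, Im l] :: real^2" and ?u = "vector [Re u, Im u] :: real^2"
  have "vec_to_complex -` box l u = box ?l ?u"
    by (auto simp: mem_box_cart forall_2 box_complex_eq in_box_complex_iff)
  then have "emeasure (distr lborel borel vec_to_complex) (box l u) = emeasure lborel (box ?l ?u)"
    using borel_measurable_vec_to_complex by (subst emeasure_distr) auto
  also have "\<dots> = ennreal (\<Prod>b\<in>Basis. (?u - ?l) \<bullet> b)"
  proof (rule emeasure_lborel_box)
    have "?l $ i \<le> ?u $ i" for i using lu exhaust_2[of i] by auto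
    then show "\<And>b. b \<in> Basis \<Longrightarrow> ?l \<bullet> b \<le> ?u \<bullet> b" by (auto simp: Basis_vec_def inner_axis)
  qed
  also have "(\<Prod>b\<in>Basis. (?u - ?l) \<bullet> b) = (\<Prod>i\<in>UNIV. (?u - ?l) $ i)"
    by (simp add: Basis_vec_def cart_eq_inner_axis axis_eq_axis prod.UNION_disjoint)
  also have "\<dots> = (\<Prod>b\<in>Basis. (u - l) \<bullet> b)"
    by (simp add: UNIV_2 Basis_complex_def)
  finally show "emeasure (distr lborel borel vec_to_complex) (box l u) = (\<Prod>b\<in>Basis. (u - l) \<bullet> b)" .
qed simp

lemma emeasure_lborel_complex:
  assumes "A \<in> sets borel"
  shows "emeasure lborel A = emeasure lborel (vec_to_complex -` A)"
proof -
  have "emeasure lborel A = emeasure (distr lborel borel vec_to_complex) A"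
    by (simp only: lborel_complex_eq_distr[symmetric])
  also have "\<dots> = emeasure lborel (vec_to_complex -` A)"
    using borel_measurable_vec_to_complex assms by (subst emeasure_distr) auto
  finally show ?thesis .
qed

text \<open>The preimage of a box under multiplication by c is the image of that box under an
  orthogonal map, which preserves measure, and Lebesgue measure is determined by its values on
  boxes.\<close>

lemma lborel_distr_rotation:
  fixes c :: complex
  assumes c: "norm c = 1"
  shows "distr lborel borel ((*) c) = lborel"
proof (rule sym, rule lborel_eqI)
  fix l u :: complex assume le: "\<And>b. b \<in> Basis \<Longrightarrow> l \<bullet> b \<le> u \<bullet> b"
  \<comment> \<open>Multiplication by \<open>cnj c\<close>, the inverse of multiplication by
    \<open>c\<close>, in real coordinates.\<close>
  define R :: "real^2 \<Rightarrow> real^2" where "R = (\<lambda>v. vector [Re c * v$1 + Im c * v$2, Re c * v$2 - Im c * v$1])"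
  have cc: "Re c * Re c + Im c * Im c = 1"
    using c cmod_power2[of c] by (simp add: power2_eq_square)
  have R: "c * vec_to_complex (R v) = vec_to_complex v" for v
  proof -
    have "Re c * (Re c * v$1 + Im c * v$2) - Im c * (Re c * v$2 - Im c * v$1) = (Re c * Re c + Im c * Im c) * v$1"
      "Re c * (Re c * v$2 - Im c * v$1) + Im c * (Re c * v$1 + Im c * v$2) = (Re c * Re c + Im c * Im c) * v$2"
      by (auto simp: algebra_simps)
    then show ?thesis unfolding cc by (simp add: R_def complex_eq_iff)
  qed
  have R': "R w = v" if "c * vec_to_complex v = vec_to_complex w" for v w
  proof -
    have "vec_to_complex v = vec_to_complex (R w)"
      using that R[of w] c by (metis mult_left_cancel norm_zero zero_neq_one)
    then show ?thesis by (auto simp: vec_eq_iff forall_2)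
  qed
  have lin: "linear R"
    by (rule linearI) (auto simp: R_def vec_eq_iff forall_2 algebra_simps)
  have orth: "orthogonal_transformation R"
    unfolding orthogonal_transformation_def
  proof (intro conjI lin allI)
    fix v w :: "real^2"
    have "R v \<bullet> R w = (Re c * Re c + Im c * Im c) * (v \<bullet> w)"
      by (simp add: R_def inner_vec_def UNIV_2 algebra_simps)
    then show "R v \<bullet> R w = v \<bullet> w" by (simp add: cc)
  qed
  let ?B = "vec_to_complex -` box l u"
  have Bs: "?B \<in> sets borel"
    using measurable_sets[OF borel_measurable_vec_to_complex, of "box l u"] by simp
  have eB: "emeasure lborel ?B = emeasure lborel (box l u)"
    using emeasure_lborel_complex[of "box l u"] by simp
  have fin: "emeasure lborel ?B < \<infinity>" unfolding eB using le by simp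
  have lm: "?B \<in> lmeasurable" using Bs fin by (simp add: fmeasurable_def)
  have "(\<lambda>z. c * z) -` box l u \<in> sets borel"
    using measurable_sets[of "(*) c" borel borel "box l u"] by simp
  then have "emeasure (distr lborel borel ((*) c)) (box l u) = emeasure lborel (vec_to_complex -` ((\<lambda>z. c * z) -` box l u))"
    using emeasure_lborel_complex[of "(\<lambda>z. c * z) -` box l u"] by (simp add: emeasure_distr)
  also have RB: "vec_to_complex -` ((\<lambda>z. c * z) -` box l u) = R ` ?B"
  proof (intro equalityI subsetI)
    fix v assume v: "v \<in> vec_to_complex -` ((\<lambda>z. c * z) -` box l u)"
    let ?w = "vector [Re (c * vec_to_complex v), Im (c * vec_to_complex v)] :: real^2"
    have "c * vec_to_complex v = vec_to_complex ?w" by (simp add: complex_eq_iff)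
    with R'[OF this] v show "v \<in> R ` ?B" by (intro image_eqI[of _ _ ?w]) auto
  qed (auto simp: R)
  also have "emeasure lborel (R ` ?B) = emeasure lebesgue (R ` ?B)"
  proof -
    have "R ` ?B \<in> sets borel" unfolding RB[symmetric]
      using measurable_sets[OF borel_measurable_vec_to_complex \<open>(\<lambda>z. c * z) -` box l u \<in> sets borel\<close>] by simp
    then show ?thesis by simp
  qed
  also have "\<dots> = emeasure lebesgue ?B"
    unfolding emeasure_eq_measure2[OF measurable_orthogonal_image[OF orth lm]] emeasure_eq_measure2[OF lm]
      measure_orthogonal_image[OF orth lm] ..
  also have "\<dots> = emeasure lborel (box l u)" using Bs eB by simp
  also have "\<dots> = (\<Prod>b\<in>Basis. (u - l) \<bullet> b)" using le by simp
  finally show "emeasure (distr lborel borel ((*) c)) (box l u) = (\<Prod>b\<in>Basis. (u - l) \<bullet> b)" .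
qed simp

text \<open>A rotation by an n-th root of -1 preserves the disc and the area but turns z^n into
  -z^n, so the integral equals its own negative.\<close>

lemma integral_power_ball_0:
  assumes "n > 0"
  shows "(LINT z|lborel. indicator (ball 0 \<rho>) z *\<^sub>R (z ^ n :: complex)) = 0"
proof -
  define c where "c = cis (pi / n)"
  have c1: "norm c = 1" by (simp add: c_def)
  have cn: "c ^ n = -1" using assms by (simp add: c_def Complex.DeMoivre complex_eq_iff)
  let ?J = "LINT z|lborel. indicator (ball 0 \<rho>) z *\<^sub>R (z ^ n :: complex)"
  have "?J = (LINT z|distr lborel borel ((*) c). indicator (ball 0 \<rho>) z *\<^sub>R (z ^ n))"
    unfolding lborel_distr_rotation[OF c1] ..
  also have "\<dots> = (LINT z|lborel. indicator (ball 0 \<rho>) (c * z) *\<^sub>R (c * z) ^ n)"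
    by (subst integral_distr) (auto intro!: borel_measurable_scaleR borel_measurable_indicator borel_measurable_power)
  also have "\<dots> = (LINT z|lborel. - (indicator (ball 0 \<rho>) z *\<^sub>R z ^ n))"
    by (intro Bochner_Integration.integral_cong refl)
      (auto simp: power_mult_distrib cn indicator_def norm_mult c1)
  finally have "?J = - ?J" by simp
  then show ?thesis by simp
qed

text \<open>The power series is integrated term by term, and every nonconstant power contributes
  zero by rotation.\<close>

lemma holomorphic_ball_mean:
  assumes f: "f holomorphic_on ball 0 R" and \<rho>: "0 < \<rho>" "\<rho> < R"
  shows "(LINT z|lborel. indicator (ball 0 \<rho>) z *\<^sub>R f z) = measure lborel (ball (0::complex) \<rho>) *\<^sub>R f 0"
proof -
  define a where "a = (\<lambda>n. (deriv ^^ n) f 0 / fact n)"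
  have s: "(\<lambda>n. a n * z ^ n) sums f z" if "norm z < R" for z
    using holomorphic_power_series[OF f, of z] that by (simp add: a_def)
  \<comment> \<open>A radius strictly between: convergence at \<open>\<sigma>\<close> gives absolute
    convergence at \<open>\<rho>\<close>, which dominates the exchange of sum and integral.\<close>
  define \<sigma> where "\<sigma> = (\<rho> + R) / 2"
  have "summable (\<lambda>n. a n * (of_real \<sigma>) ^ n)"
  proof -
    have "norm (complex_of_real \<sigma>) < R" unfolding norm_of_real using \<rho> by (simp add: \<sigma>_def)
    from s[OF this] show ?thesis by (simp add: sums_iff)
  qed
  then have "summable (\<lambda>n. norm (a n * (of_real \<rho>) ^ n))"
    by (rule powser_insidea) (unfold norm_of_real, use \<rho> in \<open>auto simp: \<sigma>_def\<close>)
  then have sm: "summable (\<lambda>n. norm (a n) * \<rho> ^ n)"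
    using \<rho> by (simp add: norm_mult norm_power)
  let ?g = "\<lambda>n z. indicator (ball 0 \<rho>) z *\<^sub>R (a n * z ^ n)"
  have bnd: "norm (?g n z) \<le> indicator (ball 0 \<rho>) z * (norm (a n) * \<rho> ^ n)" for n z
    using \<rho> by (auto simp: indicator_def norm_mult norm_power intro!: mult_left_mono power_mono)
  have Ib: "integrable lborel (\<lambda>z::complex. indicator (ball 0 \<rho>) z * (norm (a n) * \<rho> ^ n))" for n
    by (intro integrable_mult_left integrable_real_indicator) (use emeasure_lborel_ball_finite[of "0::complex" \<rho>] in auto)
  have Ig: "integrable lborel (?g n)" for n
  proof (rule Bochner_Integration.integrable_bound[OF Ib[of n]])
    show "AE z in lborel. norm (?g n z) \<le> norm (indicator (ball 0 \<rho>) z * (norm (a n) * \<rho> ^ n))"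
      using bnd \<rho> by auto
  qed (auto intro!: borel_measurable_scaleR borel_measurable_indicator borel_measurable_power borel_measurable_times)
  have gle: "(LINT z|lborel. norm (?g n z)) \<le> measure lborel (ball (0::complex) \<rho>) * (norm (a n) * \<rho> ^ n)" for n
  proof -
    have "(LINT z|lborel. norm (?g n z)) \<le> (LINT z|lborel. indicator (ball (0::complex) \<rho>) z * (norm (a n) * \<rho> ^ n))"
      by (rule integral_mono[OF integrable_norm[OF Ig] Ib]) (rule bnd)
    then show ?thesis by simp
  qed
  have "(LINT z|lborel. indicator (ball 0 \<rho>) z *\<^sub>R f z) = (LINT z|lborel. (\<Sum>n. ?g n z))"
  proof (intro Bochner_Integration.integral_cong refl)
    fix z :: complex
    show "indicator (ball 0 \<rho>) z *\<^sub>R f z = (\<Sum>n. ?g n z)"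
      using s[of z] \<rho> by (auto simp: indicator_def sums_iff)
  qed
  also have "\<dots> = (\<Sum>n. LINT z|lborel. ?g n z)"
  proof (rule integral_suminf)
    show "AE z in lborel. summable (\<lambda>n. norm (?g n z))"
    proof (intro AE_I2)
      fix z :: complex
      show "summable (\<lambda>n. norm (?g n z))"
        by (rule summable_comparison_test'[OF sm]) (use \<rho> in \<open>auto simp: indicator_def norm_mult norm_power intro!: mult_left_mono power_mono\<close>)
    qed
    show "summable (\<lambda>n. LINT z|lborel. norm (?g n z))"
      by (rule summable_comparison_test'[OF summable_mult[OF sm, of "measure lborel (ball (0::complex) \<rho>)"]])
        (use gle in \<open>auto simp: mult.assoc\<close>)
  qed (rule Ig)
  also have "\<dots> = (\<Sum>n. if n = 0 then measure lborel (ball (0::complex) \<rho>) *\<^sub>R a 0 else 0)"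
  proof (intro suminf_cong)
    fix n
    have "(LINT z|lborel. ?g n z) = (LINT z|lborel. a n * (indicator (ball 0 \<rho>) z *\<^sub>R z ^ n))"
      by (simp add: mult.left_commute)
    also have "\<dots> = a n * (LINT z|lborel. indicator (ball 0 \<rho>) z *\<^sub>R z ^ n)" by (rule integral_mult_right_zero)
    finally show "(LINT z|lborel. ?g n z) = (if n = 0 then measure lborel (ball (0::complex) \<rho>) *\<^sub>R a 0 else 0)"
      using integral_power_ball_0[of n \<rho>] by (auto simp: scaleR_conv_of_real)
  qed
  also have "\<dots> = measure lborel (ball (0::complex) \<rho>) *\<^sub>R a 0"
    by (subst suminf_finite[of "{0}"]) auto
  also have "a 0 = f 0" by (simp add: a_def)
  finally show ?thesis .
qed

lemma holomorphic_ball_mean_lebesgue: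
  assumes f: "f holomorphic_on ball w R" and \<rho>: "0 < \<rho>" "\<rho> < R"
  shows "(LINT z|lebesgue_on (ball w \<rho>). f z) = measure lborel (ball (0::complex) \<rho>) *\<^sub>R f w"
proof -
  have cont: "continuous_on (ball w \<rho>) f"
    using f \<rho> by (meson holomorphic_on_imp_continuous_on continuous_on_subset subset_ball less_imp_le)
  have meas: "(\<lambda>z. indicator (ball w \<rho>) z *\<^sub>R f z) \<in> borel_measurable borel"
    using cont by (intro borel_measurable_continuous_on_indicator) auto
  have "(LINT z|lebesgue_on (ball w \<rho>). f z) = (LINT z|lebesgue. indicator (ball w \<rho>) z *\<^sub>R f z)"
    by (rule integral_restrict_space) auto
  also have "\<dots> = (LINT z|lborel. indicator (ball w \<rho>) z *\<^sub>R f z)"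
    using meas by (intro integral_completion) simp
  also have "\<dots> = (LINT z|distr lborel borel ((+) w). indicator (ball w \<rho>) z *\<^sub>R f z)"
    unfolding lborel_distr_plus ..
  also have "\<dots> = (LINT z|lborel. indicator (ball w \<rho>) (w + z) *\<^sub>R f (w + z))"
    using meas by (intro integral_distr) auto
  also have "\<dots> = (LINT z|lborel. indicator (ball 0 \<rho>) z *\<^sub>R (f \<circ> (+) w) z)"
    by (intro Bochner_Integration.integral_cong refl) (auto simp: indicator_def dist_norm)
  also have "\<dots> = measure lborel (ball (0::complex) \<rho>) *\<^sub>R (f \<circ> (+) w) 0"
  proof (rule holomorphic_ball_mean[OF _ \<rho>], rule holomorphic_on_compose)
    have "(+) w ` ball 0 R = ball w R" by (simp add: image_add_ball)
    then show "f holomorphic_on (+) w ` ball 0 R" using f by simp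
  qed (intro holomorphic_intros)
  finally show ?thesis by simp
qed

section \<open>Bergman functions: closure properties, pointwise bounds, limits\<close>

lemma A2_L2: "f \<in> A2 \<Omega> \<Longrightarrow> f \<in> L2 \<Omega>"
  by (simp add: A2_def)

lemma A2_analytic: "f \<in> A2 \<Omega> \<Longrightarrow> f analytic_on \<Omega>"
  by (simp add: A2_def)

lemma A2_zero: "(\<lambda>z. 0) \<in> A2 \<Omega>"
  by (simp add: A2_def L2_zero)

lemma A2_add: "f \<in> A2 \<Omega> \<Longrightarrow> g \<in> A2 \<Omega> \<Longrightarrow> (\<lambda>z. f z + g z) \<in> A2 \<Omega>"
  by (simp add: A2_def L2_add analytic_on_add)

lemma A2_diff: "f \<in> A2 \<Omega> \<Longrightarrow> g \<in> A2 \<Omega> \<Longrightarrow> (\<lambda>z. f z - g z) \<in> A2 \<Omega>"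
  by (simp add: A2_def L2_diff analytic_on_diff)

lemma A2_cmult: "f \<in> A2 \<Omega> \<Longrightarrow> (\<lambda>z. c * f z) \<in> A2 \<Omega>"
  by (simp add: A2_def L2_cmult analytic_on_mult)

lemma A2_sum: "(\<And>i. i \<in> I \<Longrightarrow> f i \<in> A2 \<Omega>) \<Longrightarrow> (\<lambda>z. \<Sum>i\<in>I. f i z) \<in> A2 \<Omega>"
  by (simp add: A2_def L2_sum analytic_on_sum)

text \<open>The Bergman inequality. The mean value over a disc of radius r is an inner product with
  1, so Cauchy-Schwarz gives the constant \<mu>^(-1/2), where \<mu> is the area of the disc. One
  constant serves a whole neighbourhood of z, which turns norm convergence into locally uniform
  convergence.\<close>

lemma A2_pointwise_bound:
  assumes "open \<Omega>" "z \<in> \<Omega>"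
  obtains r C where "r > 0" "C \<ge> 0" "cball z r \<subseteq> \<Omega>"
    "\<And>f w. f \<in> A2 \<Omega> \<Longrightarrow> w \<in> cball z r \<Longrightarrow> norm (f w) \<le> C * L2_norm \<Omega> f"
proof -
  obtain \<epsilon> where \<epsilon>: "\<epsilon> > 0" "cball z \<epsilon> \<subseteq> \<Omega>" using assms open_contains_cball by blast
  \<comment> \<open>For w within r of z the disc of radius 2r about w stays within 3r of z; the mean
    value over radius r asks for holomorphy on a strictly larger disc.\<close>
  define r where "r = \<epsilon> / 3"
  have r: "r > 0" using \<epsilon> by (simp add: r_def)
  define \<mu> where "\<mu> = measure lborel (ball (0::complex) r)"
  have \<mu>: "\<mu> > 0" unfolding \<mu>_def using r by (rule content_ball_pos)
  have "norm (f w) \<le> (sqrt \<mu> / \<mu>) * L2_norm \<Omega> f" if f: "f \<in> A2 \<Omega>" and w: "w \<in> cball z r" for f w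
  proof -
    let ?B = "ball w r"
    have sub2: "ball w (2 * r) \<subseteq> \<Omega>"
    proof
      fix x assume "x \<in> ball w (2 * r)"
      then have "dist z x < r + 2 * r" using w dist_triangle[of z x w] by (simp add: dist_commute)
      then show "x \<in> \<Omega>" using \<epsilon>(2) by (auto simp: r_def)
    qed
    then have sub: "?B \<subseteq> \<Omega>" using r subset_ball[of r "2 * r" w] by simp
    have mean: "h holomorphic_on ball w (2 * r) \<Longrightarrow> (LINT z|lebesgue_on ?B. h z) = \<mu> *\<^sub>R h w" for h
      unfolding \<mu>_def using r by (intro holomorphic_ball_mean_lebesgue) auto
    have "f holomorphic_on ball w (2 * r)"
      using A2_analytic[OF f] analytic_imp_holomorphic holomorphic_on_subset sub2 by blast
    then have fw: "(LINT z|lebesgue_on ?B. f z) = \<mu> *\<^sub>R f w" by (rule mean)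
    have fB: "f \<in> L2 ?B" "L2_norm ?B f \<le> L2_norm \<Omega> f"
      using L2_subset[OF A2_L2[OF f] sub] assms by auto
    have one: "(\<lambda>z. 1) \<in> L2 ?B"
      by (simp add: L2_def finite_measure.integrable_const[OF finite_measure_lebesgue_on])
    have "complex_of_real ((L2_norm ?B (\<lambda>z. 1))\<^sup>2) = of_real \<mu>"
      unfolding L2_inner_self[symmetric] L2_inner_def
      using mean[of "\<lambda>z. 1"] by (simp add: scaleR_conv_of_real)
    then have "(L2_norm ?B (\<lambda>z. 1))\<^sup>2 = \<mu>" by (simp only: of_real_eq_iff)
    then have n1: "L2_norm ?B (\<lambda>z. 1) = sqrt \<mu>" using L2_norm_nonneg by (metis real_sqrt_unique)
    have "norm (\<mu> *\<^sub>R f w) = norm (L2_inner ?B f (\<lambda>z. 1))" using fw by (simp add: L2_inner_def)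
    also have "\<dots> \<le> L2_norm ?B f * sqrt \<mu>" using L2_Cauchy_Schwarz[OF fB(1) one] n1 by simp
    also have "\<dots> \<le> L2_norm \<Omega> f * sqrt \<mu>" using fB(2) \<mu> by (intro mult_right_mono) auto
    finally show ?thesis using \<mu> by (simp add: field_simps)
  qed
  moreover have "cball z r \<subseteq> \<Omega>" using \<epsilon> by (force simp: r_def)
  ultimately show ?thesis using that[of r "sqrt \<mu> / \<mu>"] r \<mu> by simp
qed

lemma analytic_on_open_measurable:
  assumes "open \<Omega>" "f analytic_on \<Omega>"
  shows "f \<in> borel_measurable (lebesgue_on \<Omega>)"
  using assms by (intro continuous_imp_measurable_on_sets_lebesgue holomorphic_on_imp_continuous_on analytic_imp_holomorphic) auto

lemma continuous_eq_if_AE_eq: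
  fixes f g :: "complex \<Rightarrow> complex"
  assumes "open \<Omega>" "continuous_on \<Omega> f" "continuous_on \<Omega> g" "AE z in lebesgue_on \<Omega>. f z = g z" "z \<in> \<Omega>"
  shows "f z = g z"
proof (rule ccontr)
  assume "f z \<noteq> g z"
  define N where "N = {z \<in> \<Omega>. f z - g z \<in> - {0}}"
  have "open N" unfolding N_def
    using assms by (intro continuous_open_preimage[unfolded vimage_def Int_def mem_Collect_eq] continuous_intros) auto
  moreover have "N \<noteq> {}" using assms(5) \<open>f z \<noteq> g z\<close> by (auto simp: N_def)
  moreover have "negligible N"
  proof -
    have "AE z in lebesgue. z \<in> \<Omega> \<longrightarrow> f z = g z"
      using assms(1,4) by (subst (asm) AE_restrict_space_iff) auto
    then have "AE z in lebesgue. z \<notin> N" by eventually_elim (auto simp: N_def)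
    then have "N \<in> null_sets lebesgue"
      using \<open>open N\<close> AE_iff_null_sets[of N lebesgue] by simp
    then show ?thesis by (simp add: negligible_iff_null_sets)
  qed
  ultimately show False using open_not_negligible by blast
qed

text \<open>This fixes the value of a projection onto analytic functions at each point of \<Omega>,
  although the projection is chosen only by conditions on integrals.\<close>

lemma analytic_eq_if_AE_eq:
  assumes "open \<Omega>" "f analytic_on \<Omega>" "g analytic_on \<Omega>" "AE z in lebesgue_on \<Omega>. f z = g z" "z \<in> \<Omega>"
  shows "f z = g z"
  using assms analytic_imp_holomorphic holomorphic_on_imp_continuous_on continuous_eq_if_AE_eq by metis

lemma L2_memI_AE:
  assumes "f \<in> L2 \<Omega>" "g \<in> borel_measurable (lebesgue_on \<Omega>)" "AE z in lebesgue_on \<Omega>. f z = g z"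
  shows "g \<in> L2 \<Omega>"
proof -
  have "integrable (lebesgue_on \<Omega>) (\<lambda>z. (norm (f z))\<^sup>2) \<longleftrightarrow> integrable (lebesgue_on \<Omega>) (\<lambda>z. (norm (g z))\<^sup>2)"
    using assms L2_measurable[OF assms(1)] by (intro integrable_cong_AE) auto
  then show ?thesis using assms by (simp add: L2_def)
qed

text \<open>By the Bergman inequality a norm limit of analytic functions is a locally uniform limit,
  hence analytic. Convergence at every point of \<Omega> is recorded because the quasi-periodic
  boundary relation is later read off at single points.\<close>

lemma A2_limit:
  assumes \<Omega>: "open \<Omega>" and f: "\<And>n::nat. f n \<in> A2 \<Omega>" and g: "g \<in> L2 \<Omega>"
    and lim: "(\<lambda>n. L2_norm \<Omega> (\<lambda>z. f n z - g z)) \<longlonglongrightarrow> 0"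
  obtains G where "G \<in> A2 \<Omega>" "AE z in lebesgue_on \<Omega>. G z = g z" "\<And>z. z \<in> \<Omega> \<Longrightarrow> (\<lambda>n. f n z) \<longlonglongrightarrow> G z"
proof -
  let ?e = "\<lambda>n. L2_norm \<Omega> (\<lambda>z. f n z - g z)"
  have tri: "L2_norm \<Omega> (\<lambda>z. f m z - f n z) \<le> ?e m + ?e n" for m n
    using L2_norm_diff_triangle[OF A2_L2[OF f[of m]] g A2_L2[OF f[of n]]] L2_norm_minus_commute[of \<Omega> g "f n"] by simp
  define G where "G = (\<lambda>z. lim (\<lambda>n. f n z))"
  have local: "\<exists>r>0. cball z r \<subseteq> \<Omega> \<and> uniform_limit (cball z r) f G sequentially" if z: "z \<in> \<Omega>" for z
  proof -
    obtain r C where rC: "r > 0" "C \<ge> 0" "cball z r \<subseteq> \<Omega>"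
      "\<And>f w. f \<in> A2 \<Omega> \<Longrightarrow> w \<in> cball z r \<Longrightarrow> norm (f w) \<le> C * L2_norm \<Omega> f"
      using A2_pointwise_bound[OF \<Omega> z] by blast
    have d: "norm (f m w - f n w) \<le> C * (?e m + ?e n)" if "w \<in> cball z r" for m n w
      using rC(4)[OF A2_diff[OF f f] that, of m n] mult_left_mono[OF tri rC(2), of m n] by linarith
    have "uniformly_Cauchy_on (cball z r) f"
    proof (rule uniformly_Cauchy_onI)
      fix e :: real assume "e > 0"
      define K where "K = C + 1"
      have K: "K > 0" "C \<le> K" using rC(2) by (auto simp: K_def)
      define e' where "e' = e / (2 * K)"
      have e': "e' > 0" "K * (e' + e') = e" using K \<open>e > 0\<close> by (auto simp: e'_def)
      obtain N where N: "\<And>n. n \<ge> N \<Longrightarrow> ?e n < e'"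
        using LIMSEQ_D[OF lim e'(1)] by (metis L2_norm_nonneg diff_zero real_norm_def abs_of_nonneg)
      have "dist (f m w) (f n w) < e" if "w \<in> cball z r" "m \<ge> N" "n \<ge> N" for w m n
      proof -
        have "norm (f m w - f n w) \<le> C * (?e m + ?e n)" by (rule d[OF that(1)])
        also have "\<dots> \<le> K * (?e m + ?e n)"
          using L2_norm_nonneg K by (intro mult_right_mono) (auto intro: add_nonneg_nonneg)
        also have "\<dots> < K * (e' + e')"
          using N[OF that(2)] N[OF that(3)] K by (intro mult_strict_left_mono add_strict_mono) auto
        finally show ?thesis unfolding e'(2) by (simp add: dist_norm)
      qed
      then show "\<exists>N. \<forall>w\<in>cball z r. \<forall>m\<ge>N. \<forall>n\<ge>N. dist (f m w) (f n w) < e" by blast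
    qed
    then have uc: "uniformly_convergent_on (cball z r) f" by (rule Cauchy_uniformly_convergent)
    then have "uniform_limit (cball z r) f G sequentially"
      unfolding G_def by (simp add: uniformly_convergent_uniform_limit_iff)
    with rC show ?thesis by blast
  qed
  have ptw: "(\<lambda>n. f n z) \<longlonglongrightarrow> G z" if "z \<in> \<Omega>" for z
    using local[OF that] by (metis centre_in_cball less_imp_le tendsto_uniform_limitI)
  have "G holomorphic_on \<Omega>"
    using analytic_imp_holomorphic[OF A2_analytic[OF f]] local
    by (rule holomorphic_uniform_sequence[OF \<Omega>])
  then have Ga: "G analytic_on \<Omega>" using \<Omega> by (simp add: analytic_on_open)
  \<comment> \<open>\<open>h\<close> is the limit obtained together with an almost everywhere
    convergent subsequence; it links the pointwise limit \<open>G\<close> to \<open>g\<close>, which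
    is known only as a limit in norm.\<close>
  obtain h r where h: "h \<in> L2 \<Omega>" "(\<lambda>n. L2_norm \<Omega> (\<lambda>z. f n z - h z)) \<longlonglongrightarrow> 0" "strict_mono r"
    "AE z in lebesgue_on \<Omega>. (\<lambda>k. f (r k) z) \<longlonglongrightarrow> h z"
  proof (rule L2_complete[of f \<Omega>])
    fix e :: real assume "e > 0"
    then obtain N where N: "\<And>n. n \<ge> N \<Longrightarrow> ?e n < e / 2"
      using LIMSEQ_D[OF lim, of "e/2"] by (metis L2_norm_nonneg diff_zero half_gt_zero real_norm_def abs_of_nonneg)
    have "L2_norm \<Omega> (\<lambda>z. f m z - f n z) < e" if "m \<ge> N" "n \<ge> N" for m n
      using tri[of m n] N[OF that(1)] N[OF that(2)] by linarith
    then show "\<exists>N. \<forall>m\<ge>N. \<forall>n\<ge>N. L2_norm \<Omega> (\<lambda>z. f m z - f n z) < e" by blast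
  qed (use f A2_L2 in auto)
  have "AE z in lebesgue_on \<Omega>. h z - g z = 0"
  proof -
    have "(\<lambda>n. L2_norm \<Omega> (\<lambda>z. f n z - h z) + ?e n) \<longlonglongrightarrow> 0 + 0" by (intro tendsto_add h lim)
    moreover have "L2_norm \<Omega> (\<lambda>z. h z - g z) \<le> L2_norm \<Omega> (\<lambda>z. f n z - h z) + ?e n" for n
      using L2_norm_diff_triangle[OF h(1) A2_L2[OF f[of n]] g] L2_norm_minus_commute[of \<Omega> h "f n"] by simp
    ultimately have "L2_norm \<Omega> (\<lambda>z. h z - g z) \<le> 0 + 0" by (intro tendsto_lowerbound[of _ _ sequentially]) auto
    then have "L2_norm \<Omega> (\<lambda>z. h z - g z) = 0" using L2_norm_nonneg by (simp add: antisym)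
    then show ?thesis using L2_norm_eq_0_iff[OF L2_diff[OF h(1) g]] by simp
  qed
  moreover have "AE z in lebesgue_on \<Omega>. z \<in> \<Omega>" by (intro AE_I2) simp
  ultimately have eq: "AE z in lebesgue_on \<Omega>. G z = g z" using h(4)
  proof eventually_elim
    case (elim z)
    have "(\<lambda>k. f (r k) z) \<longlonglongrightarrow> G z" using LIMSEQ_subseq_LIMSEQ[OF ptw[OF elim(2)] h(3)] by (simp add: o_def)
    then show ?case using elim LIMSEQ_unique by fastforce
  qed
  then have "G \<in> L2 \<Omega>"
    using L2_memI_AE[OF g analytic_on_open_measurable[OF \<Omega> Ga]] by (simp add: eq_commute)
  with Ga eq ptw that show ?thesis by (simp add: A2_def)
qed

section \<open>Orthogonal projections and reproducing kernels\<close>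

text \<open>Elements are functions and not classes, and closedness is tested only against members of
  \<open>A2 \<Omega>\<close>. For open \<Omega> this is genuine closedness, since by
  \<open>A2_limit\<close> every norm limit has an analytic representative.\<close>

definition A2_closed_subspace :: "complex set \<Rightarrow> (complex \<Rightarrow> complex) set \<Rightarrow> bool" where
  "A2_closed_subspace \<Omega> V \<longleftrightarrow> V \<subseteq> A2 \<Omega> \<and> (\<lambda>z. 0) \<in> V \<and>
     (\<forall>f\<in>V. \<forall>g\<in>V. (\<lambda>z. f z + g z) \<in> V) \<and> (\<forall>c. \<forall>f\<in>V. (\<lambda>z. c * f z) \<in> V) \<and>
     (\<forall>f\<in>A2 \<Omega>. (\<forall>\<epsilon>>0. \<exists>g\<in>V. L2_norm \<Omega> (\<lambda>z. f z - g z) < \<epsilon>) \<longrightarrow> f \<in> V)"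

lemma A2_closed_subspaceD:
  assumes "A2_closed_subspace \<Omega> V"
  shows "f \<in> V \<Longrightarrow> f \<in> A2 \<Omega>" "f \<in> V \<Longrightarrow> f \<in> L2 \<Omega>" "(\<lambda>z. 0) \<in> V"
    "f \<in> V \<Longrightarrow> g \<in> V \<Longrightarrow> (\<lambda>z. f z + g z) \<in> V" "f \<in> V \<Longrightarrow> (\<lambda>z. c * f z) \<in> V"
    "f \<in> V \<Longrightarrow> g \<in> V \<Longrightarrow> (\<lambda>z. f z - g z) \<in> V"
    "f \<in> A2 \<Omega> \<Longrightarrow> (\<And>\<epsilon>. \<epsilon> > 0 \<Longrightarrow> \<exists>g\<in>V. L2_norm \<Omega> (\<lambda>z. f z - g z) < \<epsilon>) \<Longrightarrow> f \<in> V"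
proof -
  note * = assms[unfolded A2_closed_subspace_def]
  show "f \<in> V \<Longrightarrow> f \<in> A2 \<Omega>" "f \<in> V \<Longrightarrow> f \<in> L2 \<Omega>" "(\<lambda>z. 0) \<in> V"
    "f \<in> V \<Longrightarrow> g \<in> V \<Longrightarrow> (\<lambda>z. f z + g z) \<in> V" "f \<in> V \<Longrightarrow> (\<lambda>z. c * f z) \<in> V"
    "f \<in> A2 \<Omega> \<Longrightarrow> (\<And>\<epsilon>. \<epsilon> > 0 \<Longrightarrow> \<exists>g\<in>V. L2_norm \<Omega> (\<lambda>z. f z - g z) < \<epsilon>) \<Longrightarrow> f \<in> V"
    using * A2_L2 by blast+
  show "(\<lambda>z. f z - g z) \<in> V" if "f \<in> V" "g \<in> V"
  proof -
    from * have add: "\<And>f g. f \<in> V \<Longrightarrow> g \<in> V \<Longrightarrow> (\<lambda>z. f z + g z) \<in> V"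
      and cmult: "\<And>c f. f \<in> V \<Longrightarrow> (\<lambda>z. c * f z) \<in> V" by simp_all
    from add[OF that(1) cmult[OF that(2), of "-1"]] show ?thesis by simp
  qed
qed

lemma A2_closed_subspace_A2: "A2_closed_subspace \<Omega> (A2 \<Omega>)"
  by (simp add: A2_closed_subspace_def A2_zero A2_add A2_cmult)

section \<open>The projection theorem\<close>

lemma L2_parallelogram_midpoint:
  assumes f: "f \<in> L2 \<Omega>" and g: "g \<in> L2 \<Omega>" and h: "h \<in> L2 \<Omega>"
  shows "(L2_norm \<Omega> (\<lambda>z. g z - h z))\<^sup>2 = 2 * (L2_norm \<Omega> (\<lambda>z. f z - g z))\<^sup>2 + 2 * (L2_norm \<Omega> (\<lambda>z. f z - h z))\<^sup>2
    - 4 * (L2_norm \<Omega> (\<lambda>z. f z - 1/2 * (g z + h z)))\<^sup>2"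
proof -
  let ?a = "\<lambda>z. f z - g z" and ?b = "\<lambda>z. f z - h z"
  have a: "?a \<in> L2 \<Omega>" and b: "?b \<in> L2 \<Omega>" using assms by (auto intro: L2_diff)
  have "(L2_norm \<Omega> (\<lambda>z. ?a z + ?b z))\<^sup>2 + (L2_norm \<Omega> (\<lambda>z. ?a z - ?b z))\<^sup>2
      = 2 * (L2_norm \<Omega> ?a)\<^sup>2 + 2 * (L2_norm \<Omega> ?b)\<^sup>2"
    unfolding L2_norm_add_power2[OF a b] L2_norm_diff_power2[OF a b] by simp
  moreover have "(\<lambda>z. ?a z + ?b z) = (\<lambda>z. 2 * (f z - 1/2 * (g z + h z)))" by (auto simp: algebra_simps)
  then have "(L2_norm \<Omega> (\<lambda>z. ?a z + ?b z))\<^sup>2 = 4 * (L2_norm \<Omega> (\<lambda>z. f z - 1/2 * (g z + h z)))\<^sup>2"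
    using L2_norm_cmult[of \<Omega> 2 "\<lambda>z. f z - 1/2 * (g z + h z)"] by (simp add: power_mult_distrib)
  moreover have "L2_norm \<Omega> (\<lambda>z. ?a z - ?b z) = L2_norm \<Omega> (\<lambda>z. g z - h z)"
    using L2_norm_minus_commute[of \<Omega> h g] by simp
  ultimately show ?thesis by simp
qed

text \<open>Move from f in the direction of h by t times the inner product w: the gain is linear in
  t and the cost quadratic, so a small t > 0 would lower the norm unless w = 0.\<close>

lemma L2_minimizer_orthogonal:
  assumes f: "f \<in> L2 \<Omega>" and h: "h \<in> L2 \<Omega>"
    and min: "\<And>c. (L2_norm \<Omega> f)\<^sup>2 \<le> (L2_norm \<Omega> (\<lambda>z. f z - c * h z))\<^sup>2"
  shows "L2_inner \<Omega> f h = 0"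
proof -
  define w where "w = L2_inner \<Omega> f h"
  define H where "H = (L2_norm \<Omega> h)\<^sup>2"
  have H: "H \<ge> 0" by (simp add: H_def)
  have *: "2 * t * (norm w)\<^sup>2 \<le> t\<^sup>2 * (norm w)\<^sup>2 * H" for t :: real
  proof -
    let ?c = "of_real t * w"
    have "(L2_norm \<Omega> (\<lambda>z. f z - ?c * h z))\<^sup>2 = (L2_norm \<Omega> f)\<^sup>2 - 2 * Re (cnj ?c * w) + (norm ?c * L2_norm \<Omega> h)\<^sup>2"
      using L2_norm_diff_power2[OF f L2_cmult[OF h, of ?c]]
      unfolding L2_inner_cmult_right L2_norm_cmult w_def .
    also have "Re (cnj ?c * w) = t * (norm w)\<^sup>2"
      by (simp add: cmod_power2 power2_eq_square[of "Re w"] power2_eq_square[of "Im w"] algebra_simps)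
    also have "(norm ?c * L2_norm \<Omega> h)\<^sup>2 = t\<^sup>2 * (norm w)\<^sup>2 * H"
      by (simp add: norm_mult power_mult_distrib H_def)
    finally show ?thesis using min[of ?c] by simp
  qed
  \<comment> \<open>Makes t * H at most 1, so the cost is at most half the gain; the added 1 covers
    H = 0.\<close>
  define t where "t = 1 / (H + 1)"
  have t: "t > 0" "t * H \<le> 1" using H by (auto simp: t_def divide_simps)
  have "t\<^sup>2 * (norm w)\<^sup>2 * H = t * (norm w)\<^sup>2 * (t * H)" by (simp add: power2_eq_square)
  also have "\<dots> \<le> t * (norm w)\<^sup>2 * 1" using t by (intro mult_left_mono) auto
  finally have "t * (norm w)\<^sup>2 \<le> 0" using *[of t] by simp
  then have "(norm w)\<^sup>2 \<le> 0" using t(1) by (simp add: mult_le_0_iff)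
  then show ?thesis by (simp add: w_def)
qed

text \<open>A minimizing sequence is Cauchy by the parallelogram law. Its limit is an arbitrary
  representative, so it is replaced by the analytic \<open>G\<close>, which can belong to
  \<open>V\<close>.\<close>

lemma orth_proj_exists:
  assumes \<Omega>: "open \<Omega>" and V: "A2_closed_subspace \<Omega> V" and f: "f \<in> L2 \<Omega>"
  shows "\<exists>g. g \<in> V \<and> (\<forall>h\<in>V. L2_inner \<Omega> (\<lambda>z. f z - g z) h = 0)"
proof -
  note V = A2_closed_subspaceD[OF V]
  let ?n = "\<lambda>g. (L2_norm \<Omega> (\<lambda>z. f z - g z))\<^sup>2"
  define d where "d = (INF g\<in>V. ?n g)"
  have bdd: "bdd_below (?n ` V)" by (intro bdd_belowI[of _ 0]) auto
  have d: "d \<le> ?n g" if "g \<in> V" for g unfolding d_def using bdd that by (rule cINF_lower)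
  have "\<exists>g\<in>V. ?n g < d + 1 / real (Suc n)" for n
  proof -
    have "(INF g\<in>V. ?n g) < d + 1 / real (Suc n)" by (simp add: d_def)
    then show ?thesis using cINF_less_iff[OF _ bdd] V(3) by blast
  qed
  then obtain g where g: "\<And>n. g n \<in> V" "\<And>n. ?n (g n) < d + 1 / real (Suc n)" by metis
  \<comment> \<open>The midpoint lies in \<open>V\<close>, so its squared distance to
    \<open>f\<close> is at least \<open>d\<close>; the terms 2d + 2d - 4d cancel and only the two
    errors remain.\<close>
  have dist: "(L2_norm \<Omega> (\<lambda>z. g m z - g n z))\<^sup>2 < 2 / real (Suc m) + 2 / real (Suc n)" for m n
  proof -
    have "(\<lambda>z. 1/2 * (g m z + g n z)) \<in> V" using V(4)[OF g(1) g(1)] by (rule V(5))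
    then have "d \<le> ?n (\<lambda>z. 1/2 * (g m z + g n z))" by (rule d)
    then show ?thesis
      using L2_parallelogram_midpoint[OF f V(2)[OF g(1)] V(2)[OF g(1)], of m n] g(2)[of m] g(2)[of n]
      by simp
  qed
  obtain h r where h: "h \<in> L2 \<Omega>" "(\<lambda>n. L2_norm \<Omega> (\<lambda>z. g n z - h z)) \<longlonglongrightarrow> 0"
  proof (rule L2_complete[of g \<Omega>])
    fix e :: real assume e: "e > 0"
    obtain N where N: "4 / e\<^sup>2 < real N" using reals_Archimedean2 by blast
    have "L2_norm \<Omega> (\<lambda>z. g m z - g n z) < e" if "m \<ge> N" "n \<ge> N" for m n
    proof (rule power2_less_imp_less)
      have "0 < 4 / e\<^sup>2" using e by simp
      then have N0: "0 < real N" using N by linarith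
      have "2 / real (Suc k) \<le> 2 / real N" if "k \<ge> N" for k
        using that N0 by (intro divide_left_mono) auto
      from this[OF that(1)] this[OF that(2)]
      have "(L2_norm \<Omega> (\<lambda>z. g m z - g n z))\<^sup>2 < 2 / real N + 2 / real N"
        using dist[of m n] by linarith
      also have "\<dots> = 4 / real N" by simp
      also have "\<dots> < e\<^sup>2" using N N0 e by (simp add: field_simps)
      finally show "(L2_norm \<Omega> (\<lambda>z. g m z - g n z))\<^sup>2 < e\<^sup>2" .
    qed (use e in simp)
    then show "\<exists>N. \<forall>m\<ge>N. \<forall>n\<ge>N. L2_norm \<Omega> (\<lambda>z. g m z - g n z) < e" by blast
  qed (use g V in blast)+
  obtain G where G: "G \<in> A2 \<Omega>" "AE z in lebesgue_on \<Omega>. G z = h z"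
    using A2_limit[OF \<Omega> V(1)[OF g(1)] h] by metis
  have lim: "(\<lambda>n. L2_norm \<Omega> (\<lambda>z. G z - g n z)) \<longlonglongrightarrow> 0"
  proof -
    have "L2_norm \<Omega> (\<lambda>z. g n z - h z) = L2_norm \<Omega> (\<lambda>z. G z - g n z)" for n
      unfolding L2_norm_minus_commute[of \<Omega> G "g n"]
      by (rule L2_norm_cong_AE) (use G h V(2) g A2_L2 in \<open>auto intro!: L2_diff\<close>)
    then show ?thesis using h(2) by simp
  qed
  have GV: "G \<in> V"
  proof (rule V(7)[OF G(1)])
    fix e :: real assume "e > 0"
    then obtain n where "L2_norm \<Omega> (\<lambda>z. G z - g n z) < e"
      using order_tendstoD(2)[OF lim] by (meson eventually_happens sequentially_bot)
    then show "\<exists>g\<in>V. L2_norm \<Omega> (\<lambda>z. G z - g z) < e" using g by blast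
  qed
  have min: "?n G \<le> d"
  proof -
    let ?u = "\<lambda>n. sqrt (d + 1 / real (Suc n)) + L2_norm \<Omega> (\<lambda>z. G z - g n z)"
    have le: "L2_norm \<Omega> (\<lambda>z. f z - G z) \<le> ?u n" for n
    proof -
      have "L2_norm \<Omega> (\<lambda>z. f z - g n z) \<le> sqrt (d + 1 / real (Suc n))"
        using g(2)[of n] by (intro real_le_rsqrt) simp
      then show ?thesis
        using L2_norm_diff_triangle[OF f V(2)[OF g(1)] A2_L2[OF G(1)], of n]
          L2_norm_minus_commute[of \<Omega> G "g n"] by simp
    qed
    have "(\<lambda>n. d + 1 / real (Suc n)) \<longlonglongrightarrow> d + 0" by (intro tendsto_add tendsto_const LIMSEQ_Suc[OF lim_1_over_n])
    then have "?u \<longlonglongrightarrow> sqrt (d + 0) + 0" by (rule tendsto_add[OF tendsto_real_sqrt lim])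
    then have "L2_norm \<Omega> (\<lambda>z. f z - G z) \<le> sqrt (d + 0) + 0"
      by (rule tendsto_lowerbound) (use le in auto)
    moreover have "d \<ge> 0" unfolding d_def using V(3) by (intro cINF_greatest) auto
    ultimately show ?thesis
      using L2_norm_nonneg[of \<Omega> "\<lambda>z. f z - G z"] power_mono[of "L2_norm \<Omega> (\<lambda>z. f z - G z)" "sqrt d" 2] by simp
  qed
  have "L2_inner \<Omega> (\<lambda>z. f z - G z) k = 0" if k: "k \<in> V" for k
  proof (rule L2_minimizer_orthogonal)
    fix c
    have "(\<lambda>z. G z + c * k z) \<in> V" using V(4)[OF GV V(5)[OF k]] .
    from min d[OF this] show "?n G \<le> (L2_norm \<Omega> (\<lambda>z. (f z - G z) - c * k z))\<^sup>2"
      by (simp add: diff_diff_eq)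
  qed (use f G A2_L2 V(2) k in \<open>auto intro: L2_diff\<close>)
  with GV show ?thesis by blast
qed

lemma orth_proj:
  assumes "open \<Omega>" "A2_closed_subspace \<Omega> V" "f \<in> L2 \<Omega>"
  shows orth_proj_in: "orth_proj \<Omega> V f \<in> V"
    and orth_proj_orthogonal: "h \<in> V \<Longrightarrow> L2_inner \<Omega> (\<lambda>z. f z - orth_proj \<Omega> V f z) h = 0"
  using someI_ex[OF orth_proj_exists[OF assms]] unfolding orth_proj_def by blast+

text \<open>Two candidates differ by an element of \<open>V\<close> orthogonal to itself, hence zero
  almost everywhere, hence zero at every point of \<Omega> by analyticity.\<close>

lemma orth_proj_eqI:
  assumes \<Omega>: "open \<Omega>" and V: "A2_closed_subspace \<Omega> V" and f: "f \<in> L2 \<Omega>"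
    and g: "g \<in> V" "\<And>h. h \<in> V \<Longrightarrow> L2_inner \<Omega> (\<lambda>z. f z - g z) h = 0" and z: "z \<in> \<Omega>"
  shows "orth_proj \<Omega> V f z = g z"
proof -
  note D = A2_closed_subspaceD[OF V]
  let ?p = "orth_proj \<Omega> V f"
  note p = orth_proj_in[OF \<Omega> V f] orth_proj_orthogonal[OF \<Omega> V f]
  let ?d = "\<lambda>z. ?p z - g z"
  have d: "?d \<in> V" by (rule D(6)[OF p(1) g(1)])
  have "L2_inner \<Omega> ?d ?d = L2_inner \<Omega> (\<lambda>z. (f z - g z) - (f z - ?p z)) ?d" by simp
  also have "\<dots> = 0" using D(2) p g d f by (subst L2_inner_diff_left) (auto intro!: L2_diff)
  finally have "L2_norm \<Omega> ?d = 0" by (simp add: L2_inner_self)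
  then have "AE z in lebesgue_on \<Omega>. ?p z = g z" using L2_norm_eq_0_iff[OF D(2)[OF d]] by simp
  then show ?thesis
    by (intro analytic_eq_if_AE_eq[OF \<Omega>] z) (use D(1) p g A2_analytic in auto)
qed

lemma L2_inner_orth_proj:
  assumes "open \<Omega>" "A2_closed_subspace \<Omega> V" "f \<in> L2 \<Omega>" "h \<in> V"
  shows "L2_inner \<Omega> (orth_proj \<Omega> V f) h = L2_inner \<Omega> f h"
proof -
  note D = A2_closed_subspaceD[OF assms(2)]
  show ?thesis
    using orth_proj_orthogonal[OF assms] assms D(2) orth_proj_in[OF assms(1-3)]
    by (simp add: L2_inner_diff_left)
qed

text \<open>Riesz representation of evaluation at z. The functions vanishing at z form a closed
  subspace by the Bergman inequality, and what is left of one nonvanishing function after projecting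
  to it spans the complement in \<open>V\<close>.\<close>

lemma reproducing_kernel_exists:
  assumes \<Omega>: "open \<Omega>" and V: "A2_closed_subspace \<Omega> V" and z: "z \<in> \<Omega>"
  obtains k where "k \<in> V" "\<And>f. f \<in> V \<Longrightarrow> f z = L2_inner \<Omega> f k"
proof (cases "\<forall>f\<in>V. f z = 0")
  case True
  then show ?thesis using that[of "\<lambda>z. 0"] A2_closed_subspaceD(3)[OF V] by (simp add: L2_inner_def)
next
  case False
  note D = A2_closed_subspaceD[OF V]
  define V0 where "V0 = {f \<in> V. f z = 0}"
  obtain r C where rC: "r > 0" "C \<ge> 0" "\<And>f w. f \<in> A2 \<Omega> \<Longrightarrow> w \<in> cball z r \<Longrightarrow> norm (f w) \<le> C * L2_norm \<Omega> f"
    using A2_pointwise_bound[OF \<Omega> z] by metis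
  have bound: "norm (f z) \<le> C * L2_norm \<Omega> f" if "f \<in> A2 \<Omega>" for f
    using rC(1) rC(3)[OF that, of z] by simp
  have "f \<in> V0" if f: "f \<in> A2 \<Omega>" and app: "\<And>\<epsilon>. \<epsilon> > 0 \<Longrightarrow> \<exists>g\<in>V0. L2_norm \<Omega> (\<lambda>z. f z - g z) < \<epsilon>" for f
  proof -
    have "f \<in> V" using D(7)[OF f] app unfolding V0_def by blast
    moreover have "norm (f z) \<le> 0 + e" if "e > 0" for e
    proof -
      have "e / (C + 1) > 0" using that rC by simp
      then obtain g where g: "g \<in> V0" "L2_norm \<Omega> (\<lambda>z. f z - g z) < e / (C + 1)" using app by blast
      have "norm (f z) = norm (f z - g z)" using g by (simp add: V0_def)
      also have "\<dots> \<le> C * L2_norm \<Omega> (\<lambda>z. f z - g z)"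
      proof (rule bound)
        show "(\<lambda>z. f z - g z) \<in> A2 \<Omega>" using g(1) by (intro A2_diff f D(1)) (simp add: V0_def)
      qed
      also have "\<dots> \<le> (C + 1) * (e / (C + 1))"
        using g rC L2_norm_nonneg by (intro mult_mono) auto
      also have "\<dots> = e" using rC by simp
      finally show ?thesis by simp
    qed
    then have "norm (f z) \<le> 0" by (rule field_le_epsilon)
    ultimately show ?thesis by (simp add: V0_def)
  qed
  then have V0: "A2_closed_subspace \<Omega> V0"
    unfolding A2_closed_subspace_def
  proof (intro conjI ballI allI impI)
    show "V0 \<subseteq> A2 \<Omega>" using D(1) by (auto simp: V0_def)
    show "(\<lambda>z. 0) \<in> V0" using D(3) by (simp add: V0_def)
    show "(\<lambda>z. f z + g z) \<in> V0" if "f \<in> V0" "g \<in> V0" for f g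
      using D(4)[of f g] that by (simp add: V0_def)
    show "(\<lambda>z. c * f z) \<in> V0" if "f \<in> V0" for f c
      using D(5)[of f c] that by (simp add: V0_def)
  qed simp
  obtain f1 where f1: "f1 \<in> V" "f1 z \<noteq> 0" using False by blast
  define e where "e = (\<lambda>w. f1 w - orth_proj \<Omega> V0 f1 w)"
  have pV0: "orth_proj \<Omega> V0 f1 \<in> V0" by (rule orth_proj_in[OF \<Omega> V0 D(2)[OF f1(1)]])
  have eV: "e \<in> V" unfolding e_def using pV0 by (intro D(6) f1) (simp add: V0_def)
  have ez: "e z \<noteq> 0" using pV0 f1 by (simp add: e_def V0_def)
  have orth: "L2_inner \<Omega> e h = 0" if "h \<in> V0" for h
    unfolding e_def by (rule orth_proj_orthogonal[OF \<Omega> V0 D(2)[OF f1(1)] that])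
  have en: "L2_norm \<Omega> e \<noteq> 0" using bound[OF D(1)[OF eV]] ez by auto
  \<comment> \<open>Normalised so that the inner product of \<open>e\<close> with
    \<open>c * e\<close> is \<open>e z\<close>.\<close>
  define c where "c = cnj (e z) / of_real ((L2_norm \<Omega> e)\<^sup>2)"
  show ?thesis
  proof (rule that)
    show "(\<lambda>w. c * e w) \<in> V" using D(5) eV .
    fix f assume f: "f \<in> V"
    let ?g = "\<lambda>w. f w - (f z / e z) * e w"
    have g: "?g \<in> V0" using D(6)[OF f D(5)[OF eV], of "f z / e z"] ez unfolding V0_def by simp
    have "L2_inner \<Omega> ?g e = 0" using orth[OF g] L2_inner_commute[of \<Omega> ?g e] by simp
    then have "L2_inner \<Omega> f e = (f z / e z) * of_real ((L2_norm \<Omega> e)\<^sup>2)"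
      unfolding L2_inner_diff_left[OF D(2)[OF f] L2_cmult[OF D(2)[OF eV]] D(2)[OF eV], of "f z / e z"]
        L2_inner_cmult_left L2_inner_self by simp
    then show "f z = L2_inner \<Omega> f (\<lambda>w. c * e w)"
      unfolding L2_inner_cmult_right using ez en by (simp add: c_def)
  qed
qed

text \<open>The reproducing kernels at a countable dense set of points determine \<open>V\<close>: a
  vector orthogonal to them has a projection vanishing on a dense set, hence everywhere.
  Approximating each kernel by members of \<open>W\<close> keeps the family inside \<open>W\<close>.
  Countability allows almost everywhere statements about single functions to be combined.\<close>

lemma countable_determining_set:
  assumes \<Omega>: "open \<Omega>" and V: "A2_closed_subspace \<Omega> V" and W: "W \<subseteq> V"
    and dense: "\<And>f \<epsilon>. f \<in> V \<Longrightarrow> \<epsilon> > 0 \<Longrightarrow> \<exists>g\<in>W. L2_norm \<Omega> (\<lambda>z. f z - g z) < \<epsilon>"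
  obtains D where "countable D" "D \<subseteq> W"
    "\<And>v h. v \<in> L2 \<Omega> \<Longrightarrow> (\<And>g. g \<in> D \<Longrightarrow> L2_inner \<Omega> v g = 0) \<Longrightarrow> h \<in> V \<Longrightarrow> L2_inner \<Omega> v h = 0"
proof -
  note D = A2_closed_subspaceD[OF V]
  obtain T where T: "countable T" "T \<subseteq> \<Omega>" "\<Omega> \<subseteq> closure T" using separable[of \<Omega>] by blast
  have "\<forall>w\<in>\<Omega>. \<exists>k. k \<in> V \<and> (\<forall>f\<in>V. f w = L2_inner \<Omega> f k)"
    using reproducing_kernel_exists[OF \<Omega> V] by metis
  then obtain k where k: "\<And>w. w \<in> \<Omega> \<Longrightarrow> k w \<in> V" "\<And>w f. w \<in> \<Omega> \<Longrightarrow> f \<in> V \<Longrightarrow> f w = L2_inner \<Omega> f (k w)"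
    by metis
  have "\<forall>w\<in>\<Omega>. \<forall>n::nat. \<exists>g\<in>W. L2_norm \<Omega> (\<lambda>z. k w z - g z) < 1 / real (Suc n)"
    using dense k(1) by simp
  then obtain g where g: "\<And>w n. w \<in> \<Omega> \<Longrightarrow> g w n \<in> W"
    "\<And>w n. w \<in> \<Omega> \<Longrightarrow> L2_norm \<Omega> (\<lambda>z. k w z - g w n z) < 1 / real (Suc n)" by metis
  define S where "S = (\<lambda>(w, n). g w n) ` (T \<times> (UNIV :: nat set))"
  show ?thesis
  proof (rule that[of S])
    show "countable S" unfolding S_def using T(1) by (intro countable_image countable_SIGMA) auto
    show "S \<subseteq> W" using T(2) g(1) by (auto simp: S_def)
    fix v h assume v: "v \<in> L2 \<Omega>" and vS: "\<And>g. g \<in> S \<Longrightarrow> L2_inner \<Omega> v g = 0" and h: "h \<in> V"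
    let ?p = "orth_proj \<Omega> V v"
    note p = orth_proj_in[OF \<Omega> V v]
    have pw: "?p w = 0" if w: "w \<in> T" for w
    proof -
      have w\<Omega>: "w \<in> \<Omega>" using w T by blast
      have "(\<lambda>n. L2_inner \<Omega> (g w n) v) \<longlonglongrightarrow> L2_inner \<Omega> (k w) v"
      proof (rule L2_inner_tendsto)
        show "(\<lambda>n. L2_norm \<Omega> (\<lambda>z. g w n z - k w z)) \<longlonglongrightarrow> 0"
        proof (rule tendsto_sandwich[OF _ _ tendsto_const LIMSEQ_Suc[OF lim_1_over_n]])
          show "\<forall>\<^sub>F n in sequentially. L2_norm \<Omega> (\<lambda>z. g w n z - k w z) \<le> 1 / real (Suc n)"
            using g(2)[OF w\<Omega>] L2_norm_minus_commute[of \<Omega> "k w"] by (simp add: less_imp_le)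
        qed (simp add: L2_norm_nonneg)
      qed (use g(1)[OF w\<Omega>] W D(2) k(1)[OF w\<Omega>] v in auto)
      moreover have "L2_inner \<Omega> (g w n) v = 0" for n
        using vS[of "g w n"] w L2_inner_commute[of \<Omega> "g w n" v] by (auto simp: S_def)
      ultimately have "L2_inner \<Omega> (k w) v = 0" by (simp add: LIMSEQ_const_iff)
      then have "L2_inner \<Omega> v (k w) = 0" using L2_inner_commute[of \<Omega> v "k w"] by simp
      then show ?thesis
        using k(2)[OF w\<Omega> p] L2_inner_orth_proj[OF \<Omega> V v k(1)[OF w\<Omega>]] by simp
    qed
    have cont: "continuous_on \<Omega> ?p"
      using A2_analytic[OF D(1)[OF p]] by (simp add: analytic_imp_holomorphic holomorphic_on_imp_continuous_on)
    have p0: "?p z = 0" if z: "z \<in> \<Omega>" for z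
    proof -
      obtain x where x: "\<And>n. x n \<in> T" "x \<longlonglongrightarrow> z" using subsetD[OF T(3) z] unfolding closure_sequential by blast
      have "(\<lambda>n. ?p (x n)) \<longlonglongrightarrow> ?p z"
        using x(1) T(2) by (intro continuous_on_tendsto_compose[OF cont x(2) z] always_eventually allI) blast
      then show ?thesis using pw[OF x(1)] by (simp add: LIMSEQ_const_iff)
    qed
    have "L2_inner \<Omega> v h = L2_inner \<Omega> ?p h" using L2_inner_orth_proj[OF \<Omega> V v h] by simp
    also have "\<dots> = 0" unfolding L2_inner_def
      by (rule integral_eq_zero_AE) (use p0 in \<open>auto intro!: AE_I2\<close>)
    finally show "L2_inner \<Omega> v h = 0" .
  qed
qed

section \<open>Trigonometric sums with square-integrable coefficients\<close>

text \<open>Lebesgue measure is complete, so a change on a null set keeps measurability. This covers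
  functions of \<eta> or of w that are identified only almost everywhere.\<close>

lemma borel_measurable_lebesgue_on_cong_AE:
  fixes f g :: "'a::euclidean_space \<Rightarrow> 'b::topological_space"
  assumes A: "A \<in> sets lebesgue" and f: "f \<in> borel_measurable (lebesgue_on A)"
    and ae: "AE x in lebesgue_on A. f x = g x"
  shows "g \<in> borel_measurable (lebesgue_on A)"
proof (rule measurableI)
  obtain N where N: "N \<in> null_sets (lebesgue_on A)" "{x \<in> space (lebesgue_on A). f x \<noteq> g x} \<subseteq> N"
    using ae by (auto simp: eventually_ae_filter)
  have Nl: "N \<in> null_sets lebesgue" using N(1) A by (simp add: null_sets_restrict_space)
  fix B :: "'b set" assume B: "B \<in> sets borel"
  have "g -` B \<inter> N \<in> null_sets lebesgue" using Nl by (rule completion.complete2[rotated]) simp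
  then have 1: "g -` B \<inter> N \<inter> A \<in> sets lebesgue" using A by auto
  have "f -` B \<inter> A \<in> sets (lebesgue_on A)" using measurable_sets[OF f B] by simp
  then have 2: "f -` B \<inter> A \<in> sets lebesgue" using A by (simp add: sets_restrict_space_iff)
  have "g -` B \<inter> A = (f -` B \<inter> A - N) \<union> (g -` B \<inter> N \<inter> A)" using N(2) by auto
  also have "\<dots> \<in> sets lebesgue" using 1 2 Nl by auto
  finally show "g -` B \<inter> space (lebesgue_on A) \<in> sets (lebesgue_on A)"
    using A by (simp add: sets_restrict_space_iff)
qed simp

lemma borel_measurable_AE_LIMSEQ:
  fixes u :: "nat \<Rightarrow> 'a::euclidean_space \<Rightarrow> 'b::{banach, second_countable_topology}"
  assumes A: "A \<in> sets lebesgue" and u: "\<And>n. u n \<in> borel_measurable (lebesgue_on A)"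
    and lim: "AE x in lebesgue_on A. (\<lambda>n. u n x) \<longlonglongrightarrow> v x"
  shows "v \<in> borel_measurable (lebesgue_on A)"
proof (rule borel_measurable_lebesgue_on_cong_AE[OF A])
  show "(\<lambda>x. lim (\<lambda>n. u n x)) \<in> borel_measurable (lebesgue_on A)"
    using u by (intro borel_measurable_lim_metric)
  show "AE x in lebesgue_on A. lim (\<lambda>n. u n x) = v x"
    using lim by eventually_elim (rule limI)
qed

text \<open>Cauchy-Schwarz against the constant 1, from the nonnegative integral of (\<mu> x - I)^2.
  Expanding it involves no division, so the null measure is split off only at the end.\<close>

lemma integral_le_sqrt_integral_power2:
  fixes x :: "'a \<Rightarrow> real"
  assumes "finite_measure M" "integrable M x" "integrable M (\<lambda>t. (x t)\<^sup>2)"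
  shows "(LINT t|M. x t)\<^sup>2 \<le> measure M (space M) * (LINT t|M. (x t)\<^sup>2)"
proof -
  interpret finite_measure M by fact
  define \<mu> where "\<mu> = measure M (space M)"
  define I where "I = (LINT t|M. x t)"
  define J where "J = (LINT t|M. (x t)\<^sup>2)"
  have "0 \<le> (LINT t|M. (\<mu> * x t - I)\<^sup>2)" by (intro integral_nonneg_AE) auto
  also have "\<dots> = (LINT t|M. \<mu>\<^sup>2 * (x t)\<^sup>2 - 2 * \<mu> * I * x t + I\<^sup>2)"
    by (simp add: power2_diff power_mult_distrib algebra_simps)
  also have "\<dots> = \<mu>\<^sup>2 * J - 2 * \<mu> * I * I + I\<^sup>2 * \<mu>"
    using assms(2,3) by (simp add: I_def J_def \<mu>_def mult.commute)
  finally have *: "\<mu> * I\<^sup>2 \<le> \<mu> * (\<mu> * J)" by (simp add: power2_eq_square algebra_simps)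
  show ?thesis
  proof (cases "\<mu> = 0")
    case True
    then have "emeasure M (space M) = 0" by (simp add: \<mu>_def emeasure_eq_measure)
    then have "AE t in M. x t = 0" by (intro AE_I[of _ _ "space M"]) auto
    then have "I = 0" unfolding I_def by (rule integral_eq_zero_AE)
    with True show ?thesis by (simp add: I_def \<mu>_def)
  next
    case False
    then have "\<mu> > 0" using measure_nonneg[of M "space M"] by (simp add: \<mu>_def less_le)
    with * show ?thesis by (simp add: I_def J_def \<mu>_def)
  qed
qed

lemma integral_tendsto_0_of_square:
  fixes x :: "'b \<Rightarrow> 'a \<Rightarrow> real"
  assumes "finite_measure M" "\<And>n. integrable M (x n)" "\<And>n. integrable M (\<lambda>t. (x n t)\<^sup>2)"
    and lim: "((\<lambda>n. LINT t|M. (x n t)\<^sup>2) \<longlongrightarrow> 0) F"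
  shows "((\<lambda>n. LINT t|M. x n t) \<longlongrightarrow> 0) F"
proof -
  have "((\<lambda>n. sqrt (measure M (space M) * (LINT t|M. (x n t)\<^sup>2))) \<longlongrightarrow> sqrt (measure M (space M) * 0)) F"
    by (intro tendsto_real_sqrt tendsto_mult_left lim)
  then have "((\<lambda>n. sqrt (measure M (space M) * (LINT t|M. (x n t)\<^sup>2))) \<longlongrightarrow> 0) F" by simp
  then show ?thesis
  proof (rule Lim_null_comparison[rotated], intro always_eventually allI)
    fix n
    show "norm (LINT t|M. x n t) \<le> sqrt (measure M (space M) * (LINT t|M. (x n t)\<^sup>2))"
      using integral_le_sqrt_integral_power2[OF assms(1-3), of n] by (simp add: real_le_rsqrt)
  qed
qed

text \<open>\<open>F0\<close> almost attains the supremum of the finite sums, so a finite set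
  disjoint from it can add little. The unordered form matches the net of finite partial sums in
  \<open>floquet\<close>.\<close>

lemma small_tail_sum:
  fixes a :: "'a \<Rightarrow> real"
  assumes "\<And>m. 0 \<le> a m" "\<And>F. finite F \<Longrightarrow> sum a F \<le> B" "\<epsilon> > 0"
  obtains F0 where "finite F0" "\<And>F. finite F \<Longrightarrow> F \<inter> F0 = {} \<Longrightarrow> sum a F < \<epsilon>"
proof -
  define s where "s = (SUP F\<in>Collect finite. sum a F)"
  have bdd: "bdd_above (sum a ` Collect finite)" using assms(2) by (intro bdd_aboveI[of _ B]) auto
  have up: "sum a F \<le> s" if "finite F" for F unfolding s_def using that bdd by (intro cSUP_upper) auto
  have "s - \<epsilon> < s" using assms(3) by simp
  then obtain F0 where F0: "finite F0" "s - \<epsilon> < sum a F0"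
    unfolding s_def using less_cSUP_iff[OF _ bdd] by blast
  have "sum a F < \<epsilon>" if "finite F" "F \<inter> F0 = {}" for F
    using up[of "F \<union> F0"] sum.union_disjoint[OF that(1) F0(1) that(2), of a] F0 that by simp
  then show ?thesis using that F0 by blast
qed

lemma norm_exp_i_diff_le: "norm (exp (\<i> * of_real a) - exp (\<i> * of_real b)) \<le> \<bar>a - b\<bar>"
proof -
  have "exp (\<i> * of_real a) - exp (\<i> * of_real b) = exp (\<i> * of_real b) * (exp (\<i> * of_real (a - b)) - 1)"
    by (simp add: algebra_simps flip: exp_add)
  then have "norm (exp (\<i> * of_real a) - exp (\<i> * of_real b)) = norm (exp (\<i> * of_real (a - b)) - 1)"
    by (simp add: norm_mult)
  also have "\<dots> = 2 * \<bar>sin ((a - b) / 2)\<bar>" by (rule dist_exp_i_1)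
  also have "\<dots> \<le> 2 * \<bar>(a - b) / 2\<bar>" by (intro mult_left_mono abs_sin_x_le_abs_x) auto
  finally show ?thesis by simp
qed

lemma finite_measure_lebesgue_on_Icc: "finite_measure (lebesgue_on {a..b::real})"
  by (rule finite_measure_lebesgue_on) simp

lemma continuous_integrable_lebesgue_on:
  fixes f :: "real \<Rightarrow> 'b::{banach, second_countable_topology}"
  assumes "continuous_on {a..b} f"
  shows "integrable (lebesgue_on {a..b}) f"
proof -
  interpret finite_measure "lebesgue_on {a..b}" by (rule finite_measure_lebesgue_on_Icc)
  have "bounded (f ` {a..b})" using assms by (intro compact_imp_bounded compact_continuous_image) auto
  then obtain B where "\<And>x. x \<in> {a..b} \<Longrightarrow> norm (f x) \<le> B" unfolding bounded_iff by blast
  then show ?thesis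
    using continuous_imp_measurable_on_sets_lebesgue[OF assms]
    by (intro integrable_const_bound[where B = B]) auto
qed

lemma integral_exp_interval:
  fixes z :: complex
  assumes "z \<noteq> 0" "a \<le> b"
  shows "(LINT \<eta>|lebesgue_on {a..b}. exp (\<i> * of_real \<eta> * z)) = (exp (\<i> * of_real b * z) - exp (\<i> * of_real a * z)) / (\<i> * z)"
proof -
  let ?F = "\<lambda>w. exp (\<i> * w * z) / (\<i> * z)"
  have "((\<lambda>\<eta>. ?F (of_real \<eta>)) has_vector_derivative exp (\<i> * of_real \<eta> * z)) (at \<eta> within {a..b})" for \<eta>
    by (rule has_vector_derivative_real_field) (use assms in \<open>auto intro!: derivative_eq_intros simp: field_simps\<close>)
  then have "((\<lambda>\<eta>. exp (\<i> * of_real \<eta> * z)) has_integral (?F (of_real b) - ?F (of_real a))) {a..b}"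
    using assms by (intro fundamental_theorem_of_calculus) auto
  moreover have "integrable (lebesgue_on {a..b}) (\<lambda>\<eta>. exp (\<i> * of_real \<eta> * z))"
    by (intro continuous_integrable_lebesgue_on continuous_intros)
  ultimately show ?thesis
    using lebesgue_integral_eq_integral[of "{a..b}" "\<lambda>\<eta>. exp (\<i> * of_real \<eta> * z)"]
    by (simp add: integral_unique diff_divide_distrib)
qed

lemma integral_exp_int:
  fixes k :: int
  shows "(LINT \<eta>|lebesgue_on {-pi..pi}. exp (\<i> * of_real \<eta> * of_int k)) = (if k = 0 then 2 * of_real pi else 0)"
proof (cases "k = 0")
  case True
  then show ?thesis by (simp add: measure_restrict_space scaleR_conv_of_real)
next
  case False
  have *: "exp (\<i> * of_real pi * of_int k) = exp (\<i> * of_real (- pi) * of_int k)"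
    unfolding exp_eq by (intro exI[of _ k]) (simp add: algebra_simps)
  have "(LINT \<eta>|lebesgue_on {-pi..pi}. exp (\<i> * of_real \<eta> * of_int k))
     = (exp (\<i> * of_real pi * of_int k) - exp (\<i> * of_real (- pi) * of_int k)) / (\<i> * of_int k)"
    using False by (intro integral_exp_interval) auto
  also have "\<dots> = 0" unfolding * by simp
  finally show ?thesis using False by simp
qed

text \<open>For \<phi> m z = f (z + m) this is the partial sum in \<open>floquet\<close>.
  Coefficients and domain stay abstract because the same series is summed on \<open>cell\<close> and
  on a larger set.\<close>

definition trig_sum :: "(int \<Rightarrow> complex \<Rightarrow> complex) \<Rightarrow> int set \<Rightarrow> real \<Rightarrow> complex \<Rightarrow> complex" where
  "trig_sum \<phi> S \<eta> z = 1 / sqrt (2 * pi) * (\<Sum>m\<in>S. exp (- \<i> * \<eta> * of_int m) * \<phi> m z)"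

lemma trig_sum_L2: "(\<And>m. \<phi> m \<in> L2 \<Omega>) \<Longrightarrow> trig_sum \<phi> S \<eta> \<in> L2 \<Omega>"
  unfolding trig_sum_def[abs_def] by (intro L2_cmult L2_sum)

lemma trig_sum_A2: "(\<And>m. \<phi> m \<in> A2 \<Omega>) \<Longrightarrow> trig_sum \<phi> S \<eta> \<in> A2 \<Omega>"
  unfolding trig_sum_def[abs_def] by (intro A2_cmult A2_sum)

lemma trig_sum_diff:
  assumes "finite S" "T \<subseteq> S"
  shows "trig_sum \<phi> S \<eta> z - trig_sum \<phi> T \<eta> z = trig_sum \<phi> (S - T) \<eta> z"
  using assms by (simp add: trig_sum_def sum_diff right_diff_distrib)

section \<open>Parseval identity and dependence on \<eta>\<close>

lemma L2_inner_sum_left: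
  assumes "\<And>i. i \<in> I \<Longrightarrow> f i \<in> L2 \<Omega>" "h \<in> L2 \<Omega>"
  shows "L2_inner \<Omega> (\<lambda>z. \<Sum>i\<in>I. f i z) h = (\<Sum>i\<in>I. L2_inner \<Omega> (f i) h)"
  using assms(1)
proof (induction I rule: infinite_finite_induct)
  case (insert i I)
  have "L2_inner \<Omega> (\<lambda>z. f i z + (\<Sum>i\<in>I. f i z)) h = L2_inner \<Omega> (f i) h + L2_inner \<Omega> (\<lambda>z. \<Sum>i\<in>I. f i z) h"
    using insert assms(2) by (intro L2_inner_add_left L2_sum) auto
  then show ?case using insert by simp
qed (auto simp: L2_inner_def)

lemma L2_inner_trig_sum_left:
  assumes "\<And>m. \<phi> m \<in> L2 \<Omega>" "h \<in> L2 \<Omega>"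
  shows "L2_inner \<Omega> (trig_sum \<phi> S \<eta>) h = 1 / sqrt (2 * pi) * (\<Sum>m\<in>S. exp (- \<i> * \<eta> * of_int m) * L2_inner \<Omega> (\<phi> m) h)"
  unfolding trig_sum_def[abs_def]
  using assms by (simp add: L2_inner_cmult_left L2_inner_sum_left L2_cmult del: of_real_mult of_real_divide)

text \<open>The squared norm is a double sum of inner products times exp(i \<eta> (n - m));
  integrating over a full period leaves the diagonal, and the length 2 pi cancels the
  normalisation.\<close>

lemma trig_sum_Parseval:
  assumes \<phi>: "\<And>m. \<phi> m \<in> L2 \<Omega>" and S: "finite S"
  shows "(LINT \<eta>|lebesgue_on {-pi..pi}. (L2_norm \<Omega> (trig_sum \<phi> S \<eta>))\<^sup>2) = (\<Sum>m\<in>S. (L2_norm \<Omega> (\<phi> m))\<^sup>2)"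
proof -
  let ?e = "\<lambda>\<eta> k. exp (\<i> * of_real \<eta> * of_int k) :: complex"
  have norm2: "of_real ((L2_norm \<Omega> (trig_sum \<phi> S \<eta>))\<^sup>2)
      = (\<Sum>m\<in>S. \<Sum>n\<in>S. L2_inner \<Omega> (\<phi> m) (\<phi> n) / (2 * pi) * ?e \<eta> (n - m))" for \<eta>
  proof -
    define c where "c = complex_of_real (1 / sqrt (2 * pi))"
    have c: "c * cnj c = 1 / (2 * pi)" unfolding c_def complex_cnj_complex_of_real of_real_mult[symmetric] by simp
    have T: "trig_sum \<phi> S \<eta> \<in> L2 \<Omega>" using \<phi> by (rule trig_sum_L2)
    have "L2_inner \<Omega> (trig_sum \<phi> S \<eta>) (trig_sum \<phi> S \<eta>)
        = c * (\<Sum>m\<in>S. exp (- \<i> * \<eta> * of_int m) * cnj (L2_inner \<Omega> (trig_sum \<phi> S \<eta>) (\<phi> m)))"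
      unfolding L2_inner_trig_sum_left[OF \<phi> T] c_def L2_inner_commute[of \<Omega> "\<phi> _"] ..
    also have "\<dots> = c * (\<Sum>m\<in>S. exp (- \<i> * \<eta> * of_int m) *
        (cnj c * (\<Sum>n\<in>S. cnj (exp (- \<i> * \<eta> * of_int n)) * L2_inner \<Omega> (\<phi> m) (\<phi> n))))"
      unfolding L2_inner_trig_sum_left[OF \<phi> \<phi>] c_def[symmetric] complex_cnj_mult cnj_sum L2_inner_commute[symmetric] ..
    also have "\<dots> = (\<Sum>m\<in>S. \<Sum>n\<in>S. (c * cnj c) * (L2_inner \<Omega> (\<phi> m) (\<phi> n) *
        (exp (- \<i> * \<eta> * of_int m) * cnj (exp (- \<i> * \<eta> * of_int n)))))"
      by (simp add: sum_distrib_left sum_distrib_right mult_ac)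
    also have "\<dots> = (\<Sum>m\<in>S. \<Sum>n\<in>S. L2_inner \<Omega> (\<phi> m) (\<phi> n) / (2 * pi) * ?e \<eta> (n - m))"
      unfolding c by (intro sum.cong refl) (simp add: exp_cnj algebra_simps flip: exp_add)
    finally show ?thesis by (simp only: L2_inner_self)
  qed
  have ie: "integrable (lebesgue_on {-pi..pi}) (\<lambda>\<eta>. ?e \<eta> k)" for k
    by (intro continuous_integrable_lebesgue_on continuous_intros)
  have "of_real (LINT \<eta>|lebesgue_on {-pi..pi}. (L2_norm \<Omega> (trig_sum \<phi> S \<eta>))\<^sup>2)
      = (LINT \<eta>|lebesgue_on {-pi..pi}. of_real ((L2_norm \<Omega> (trig_sum \<phi> S \<eta>))\<^sup>2) :: complex)"
    by (rule integral_complex_of_real[symmetric])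
  also have "\<dots> = (\<Sum>m\<in>S. \<Sum>n\<in>S. L2_inner \<Omega> (\<phi> m) (\<phi> n) / (2 * pi) * (LINT \<eta>|lebesgue_on {-pi..pi}. ?e \<eta> (n - m)))"
  proof -
    have I: "integrable (lebesgue_on {-pi..pi}) (\<lambda>\<eta>. d * ?e \<eta> k)" for d k
      using ie by (rule integrable_mult_right)
    show ?thesis unfolding norm2
      by (simp only: Bochner_Integration.integral_sum Bochner_Integration.integrable_sum I integral_mult_right_zero)
  qed
  also have "\<dots> = (\<Sum>m\<in>S. \<Sum>n\<in>S. if n = m then L2_inner \<Omega> (\<phi> m) (\<phi> n) else 0)"
    by (intro sum.cong refl, subst integral_exp_int) auto
  also have "\<dots> = (\<Sum>m\<in>S. L2_inner \<Omega> (\<phi> m) (\<phi> m))" using S by simp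
  also have "\<dots> = of_real (\<Sum>m\<in>S. (L2_norm \<Omega> (\<phi> m))\<^sup>2)" by (simp add: L2_inner_self)
  finally show ?thesis by (simp only: of_real_eq_iff)
qed

text \<open>The constant is the sum of |m| times the coefficient norms over sqrt(2 pi), from
  |exp(ia) - exp(ib)| <= |a - b|. Lipschitz dependence gives measurability of fibre norms in \<eta>
  and uniform approximation by step functions.\<close>

lemma trig_sum_lipschitz:
  assumes \<phi>: "\<And>m. \<phi> m \<in> L2 \<Omega>" and S: "finite S"
  shows "\<exists>L\<ge>0. \<forall>\<eta> \<eta>'. L2_norm \<Omega> (\<lambda>z. trig_sum \<phi> S \<eta> z - trig_sum \<phi> S \<eta>' z) \<le> L * \<bar>\<eta> - \<eta>'\<bar>"
proof -
  let ?c = "\<lambda>\<eta> m. 1 / sqrt (2 * pi) * exp (- \<i> * of_real \<eta> * of_int m) :: complex"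
  define L where "L = (\<Sum>m\<in>S. 1 / sqrt (2 * pi) * \<bar>real_of_int m\<bar> * L2_norm \<Omega> (\<phi> m))"
  have L0: "L \<ge> 0" unfolding L_def by (intro sum_nonneg) (simp add: L2_norm_nonneg)
  have "L2_norm \<Omega> (\<lambda>z. trig_sum \<phi> S \<eta> z - trig_sum \<phi> S \<eta>' z) \<le> L * \<bar>\<eta> - \<eta>'\<bar>" for \<eta> \<eta>'
  proof -
    have c: "norm (?c \<eta> m - ?c \<eta>' m) \<le> 1 / sqrt (2 * pi) * (\<bar>\<eta> - \<eta>'\<bar> * \<bar>real_of_int m\<bar>)" for m
    proof -
      have "norm (?c \<eta> m - ?c \<eta>' m)
          = norm (complex_of_real (1 / sqrt (2 * pi)) * (exp (\<i> * of_real (- \<eta> * m)) - exp (\<i> * of_real (- \<eta>' * m))))"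
        by (simp add: algebra_simps)
      also have "\<dots> = 1 / sqrt (2 * pi) * norm (exp (\<i> * of_real (- \<eta> * m)) - exp (\<i> * of_real (- \<eta>' * m)))"
        unfolding norm_mult norm_of_real by simp
      also have "\<dots> \<le> 1 / sqrt (2 * pi) * \<bar>- \<eta> * m - - \<eta>' * m\<bar>"
        by (intro mult_left_mono norm_exp_i_diff_le) auto
      also have "\<bar>- \<eta> * m - - \<eta>' * m\<bar> = \<bar>(\<eta>' - \<eta>) * m\<bar>" by (simp add: algebra_simps)
      also have "\<dots> = \<bar>\<eta> - \<eta>'\<bar> * \<bar>real_of_int m\<bar>" by (simp add: abs_mult abs_minus_commute)
      finally show ?thesis .
    qed
    have "(\<lambda>z. trig_sum \<phi> S \<eta> z - trig_sum \<phi> S \<eta>' z) = (\<lambda>z. \<Sum>m\<in>S. (?c \<eta> m - ?c \<eta>' m) * \<phi> m z)"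
      by (simp add: trig_sum_def sum_distrib_left left_diff_distrib sum_subtractf mult.assoc)
    then have "L2_norm \<Omega> (\<lambda>z. trig_sum \<phi> S \<eta> z - trig_sum \<phi> S \<eta>' z)
        \<le> (\<Sum>m\<in>S. L2_norm \<Omega> (\<lambda>z. (?c \<eta> m - ?c \<eta>' m) * \<phi> m z))"
      using L2_norm_sum[of S "\<lambda>m z. (?c \<eta> m - ?c \<eta>' m) * \<phi> m z" \<Omega>] \<phi> L2_cmult by simp
    also have "\<dots> \<le> (\<Sum>m\<in>S. 1 / sqrt (2 * pi) * (\<bar>\<eta> - \<eta>'\<bar> * \<bar>real_of_int m\<bar>) * L2_norm \<Omega> (\<phi> m))"
      unfolding L2_norm_cmult by (intro sum_mono mult_right_mono c L2_norm_nonneg)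
    also have "\<dots> = L * \<bar>\<eta> - \<eta>'\<bar>" by (simp add: L_def sum_distrib_left mult_ac)
    finally show ?thesis .
  qed
  with L0 show ?thesis by blast
qed

lemma continuous_L2_norm_trig_sum_diff:
  assumes \<phi>: "\<And>m. \<phi> m \<in> L2 \<Omega>" and S: "finite S" and g: "g \<in> L2 \<Omega>"
  shows "continuous_on A (\<lambda>\<eta>. L2_norm \<Omega> (\<lambda>z. trig_sum \<phi> S \<eta> z - g z))"
proof -
  obtain L where L: "L \<ge> 0" "\<And>\<eta> \<eta>'. L2_norm \<Omega> (\<lambda>z. trig_sum \<phi> S \<eta> z - trig_sum \<phi> S \<eta>' z) \<le> L * \<bar>\<eta> - \<eta>'\<bar>"
    using trig_sum_lipschitz[where \<phi> = \<phi>, OF \<phi> S] by blast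
  note T = trig_sum_L2[where \<phi> = \<phi>, OF \<phi>]
  let ?n = "\<lambda>\<eta>. L2_norm \<Omega> (\<lambda>z. trig_sum \<phi> S \<eta> z - g z)"
  have 1: "?n \<eta> \<le> L * \<bar>\<eta> - \<eta>'\<bar> + ?n \<eta>'" for \<eta> \<eta>'
    using L2_norm_diff_triangle[OF T[of S \<eta>] T[of S \<eta>'] g] L(2)[of \<eta> \<eta>'] by simp
  have "\<bar>?n \<eta> - ?n \<eta>'\<bar> \<le> L * \<bar>\<eta> - \<eta>'\<bar>" for \<eta> \<eta>'
    using 1[of \<eta> \<eta>'] 1[of \<eta>' \<eta>] by (simp add: abs_le_iff abs_minus_commute)
  then have "L-lipschitz_on A ?n" using L(1) by (intro lipschitz_onI) (auto simp: dist_real_def)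
  then show ?thesis by (rule lipschitz_on_continuous_on)
qed

text \<open>Membership in \<open>bochner_L2\<close> supplies only simple approximants. Each takes
  finitely many values \<open>h\<close>, for which the norm of the trigonometric sum minus
  \<open>h\<close> is continuous in \<eta>; the limit is then taken almost everywhere.\<close>

lemma bochner_L2_strongly_measurable:
  assumes \<phi>: "\<And>m. \<phi> m \<in> L2 \<Omega>" and S: "finite S" and g: "g \<in> bochner_L2 \<Omega>"
  shows "(\<lambda>\<eta>. L2_norm \<Omega> (\<lambda>z. trig_sum \<phi> S \<eta> z - g \<eta> z)) \<in> borel_measurable (lebesgue_on {-pi..pi})"
proof -
  obtain s :: "nat \<Rightarrow> real \<Rightarrow> complex \<Rightarrow> complex" where s: "\<And>n. simple_function (lebesgue_on {-pi..pi}) (s n)"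
    "\<And>n \<eta>. \<eta> \<in> {-pi..pi} \<Longrightarrow> s n \<eta> \<in> L2 \<Omega>"
    "AE \<eta> in lebesgue_on {-pi..pi}. (\<lambda>n. L2_norm \<Omega> (\<lambda>z. s n \<eta> z - g \<eta> z)) \<longlonglongrightarrow> 0"
    using g unfolding bochner_L2_def mem_Collect_eq by blast
  have gL: "g \<eta> \<in> L2 \<Omega>" if "\<eta> \<in> {-pi..pi}" for \<eta> using g that by (auto simp: bochner_L2_def)
  note T = trig_sum_L2[where \<phi> = \<phi>, OF \<phi>]
  show ?thesis
  proof (rule borel_measurable_AE_LIMSEQ)
    fix n
    let ?I = "s n ` {-pi..pi}"
    have "s n \<in> measurable (lebesgue_on {-pi..pi}) (count_space ?I)"
      using simple_functionD[OF s(1)[of n]] by (subst measurable_count_space_eq2) auto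
    then show "(\<lambda>\<eta>. L2_norm \<Omega> (\<lambda>z. trig_sum \<phi> S \<eta> z - s n \<eta> z)) \<in> borel_measurable (lebesgue_on {-pi..pi})"
    proof (rule measurable_compose_countable'[rotated])
      show "countable ?I" using simple_functionD(1)[OF s(1)[of n]] by (simp add: countable_finite)
      fix h assume "h \<in> ?I"
      then have "h \<in> L2 \<Omega>" using s(2) by auto
      then show "(\<lambda>\<eta>. L2_norm \<Omega> (\<lambda>z. trig_sum \<phi> S \<eta> z - h z)) \<in> borel_measurable (lebesgue_on {-pi..pi})"
        by (intro continuous_imp_measurable_on_sets_lebesgue continuous_L2_norm_trig_sum_diff[where \<phi> = \<phi>, OF \<phi> S]) auto
    qed
  next
    have "AE \<eta> in lebesgue_on {-pi..pi}. \<eta> \<in> {-pi..pi}" by (intro AE_I2) simp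
    then show "AE \<eta> in lebesgue_on {-pi..pi}. (\<lambda>n. L2_norm \<Omega> (\<lambda>z. trig_sum \<phi> S \<eta> z - s n \<eta> z))
        \<longlonglongrightarrow> L2_norm \<Omega> (\<lambda>z. trig_sum \<phi> S \<eta> z - g \<eta> z)"
      using s(3)
    proof eventually_elim
      case (elim \<eta>)
      have "\<bar>L2_norm \<Omega> (\<lambda>z. trig_sum \<phi> S \<eta> z - s n \<eta> z) - L2_norm \<Omega> (\<lambda>z. trig_sum \<phi> S \<eta> z - g \<eta> z)\<bar>
          \<le> L2_norm \<Omega> (\<lambda>z. s n \<eta> z - g \<eta> z)" for n
        using L2_norm_diff_triangle[OF T[of S \<eta>] s(2)[OF elim(1), of n] gL[OF elim(1)]]
          L2_norm_diff_triangle[OF T[of S \<eta>] gL[OF elim(1)] s(2)[OF elim(1), of n]]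
          L2_norm_minus_commute[of \<Omega> "s n \<eta>" "g \<eta>"] by (simp add: abs_le_iff)
      then have "(\<lambda>n. L2_norm \<Omega> (\<lambda>z. trig_sum \<phi> S \<eta> z - s n \<eta> z) - L2_norm \<Omega> (\<lambda>z. trig_sum \<phi> S \<eta> z - g \<eta> z)) \<longlonglongrightarrow> 0"
        by (intro Lim_null_comparison[OF _ elim(2)] always_eventually) simp
      then show ?case by (simp add: LIM_zero_iff)
    qed
  qed simp
qed

lemma power2_sum_le: "(x + y)\<^sup>2 \<le> 2 * x\<^sup>2 + 2 * y\<^sup>2" for x y :: real
  using sum_squares_bound[of x y] by (simp add: power2_sum)

lemma L2_norm_diff_power2_le:
  assumes "f \<in> L2 \<Omega>" "g \<in> L2 \<Omega>"
  shows "(L2_norm \<Omega> (\<lambda>z. f z - g z))\<^sup>2 \<le> 2 * (L2_norm \<Omega> f)\<^sup>2 + 2 * (L2_norm \<Omega> g)\<^sup>2"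
proof -
  have "L2_norm \<Omega> (\<lambda>z. f z - g z) \<le> L2_norm \<Omega> f + L2_norm \<Omega> g"
    using L2_norm_diff_triangle[OF assms(1) L2_zero assms(2)] by (simp add: L2_norm_uminus)
  then have "(L2_norm \<Omega> (\<lambda>z. f z - g z))\<^sup>2 \<le> (L2_norm \<Omega> f + L2_norm \<Omega> g)\<^sup>2"
    using L2_norm_nonneg by (intro power_mono)
  then show ?thesis using power2_sum_le order_trans by blast
qed

lemma trig_sum_norm_integrable:
  assumes \<phi>: "\<And>m. \<phi> m \<in> L2 \<Omega>" and S: "finite S"
  shows "integrable (lebesgue_on {-pi..pi}) (\<lambda>\<eta>. (L2_norm \<Omega> (trig_sum \<phi> S \<eta>))\<^sup>2)"
proof -
  have "continuous_on {-pi..pi} (\<lambda>\<eta>. L2_norm \<Omega> (\<lambda>z. trig_sum \<phi> S \<eta> z - 0))"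
    by (rule continuous_L2_norm_trig_sum_diff[where \<phi> = \<phi>, OF \<phi> S L2_zero])
  then show ?thesis by (intro continuous_integrable_lebesgue_on continuous_on_power) simp
qed

lemma bochner_L2_trig_sum_diff_integrable:
  assumes \<phi>: "\<And>m. \<phi> m \<in> L2 \<Omega>" and S: "finite S" and g: "g \<in> bochner_L2 \<Omega>"
  shows "integrable (lebesgue_on {-pi..pi}) (\<lambda>\<eta>. (L2_norm \<Omega> (\<lambda>z. trig_sum \<phi> S \<eta> z - g \<eta> z))\<^sup>2)"
proof (rule Bochner_Integration.integrable_bound)
  have gi: "integrable (lebesgue_on {-pi..pi}) (\<lambda>\<eta>. (L2_norm \<Omega> (g \<eta>))\<^sup>2)" using g by (simp add: bochner_L2_def)
  show "integrable (lebesgue_on {-pi..pi}) (\<lambda>\<eta>. 2 * (L2_norm \<Omega> (trig_sum \<phi> S \<eta>))\<^sup>2 + 2 * (L2_norm \<Omega> (g \<eta>))\<^sup>2)"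
    using gi trig_sum_norm_integrable[where \<phi> = \<phi>, OF \<phi> S] by simp
  show "(\<lambda>\<eta>. (L2_norm \<Omega> (\<lambda>z. trig_sum \<phi> S \<eta> z - g \<eta> z))\<^sup>2) \<in> borel_measurable (lebesgue_on {-pi..pi})"
    using bochner_L2_strongly_measurable[where \<phi> = \<phi>, OF \<phi> S g] by simp
  show "AE \<eta> in lebesgue_on {-pi..pi}. norm ((L2_norm \<Omega> (\<lambda>z. trig_sum \<phi> S \<eta> z - g \<eta> z))\<^sup>2)
      \<le> norm (2 * (L2_norm \<Omega> (trig_sum \<phi> S \<eta>))\<^sup>2 + 2 * (L2_norm \<Omega> (g \<eta>))\<^sup>2)"
  proof (rule AE_I2)
    fix \<eta> assume "\<eta> \<in> space (lebesgue_on {-pi..pi})"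
    then have "g \<eta> \<in> L2 \<Omega>" using g by (simp add: bochner_L2_def)
    from L2_norm_diff_power2_le[OF trig_sum_L2[where \<phi> = \<phi>, OF \<phi>] this, of S \<eta>]
    show "norm ((L2_norm \<Omega> (\<lambda>z. trig_sum \<phi> S \<eta> z - g \<eta> z))\<^sup>2)
      \<le> norm (2 * (L2_norm \<Omega> (trig_sum \<phi> S \<eta>))\<^sup>2 + 2 * (L2_norm \<Omega> (g \<eta>))\<^sup>2)" by simp
  qed
qed

section \<open>Unordered convergence in the Bochner space\<close>

lemma L2_complete_summable:
  assumes f: "\<And>n. f n \<in> L2 \<Omega>" and s: "summable (\<lambda>n. L2_norm \<Omega> (\<lambda>z. f (Suc n) z - f n z))"
  shows "\<exists>g\<in>L2 \<Omega>. (\<lambda>n. L2_norm \<Omega> (\<lambda>z. f n z - g z)) \<longlonglongrightarrow> 0"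
proof -
  let ?d = "\<lambda>n. L2_norm \<Omega> (\<lambda>z. f (Suc n) z - f n z)"
  have step: "L2_norm \<Omega> (\<lambda>z. f (n + k) z - f n z) \<le> (\<Sum>i=n..<n+k. ?d i)" for n k
  proof (induction k)
    case (Suc k)
    then show ?case
      using L2_norm_diff_triangle[OF f[of "n + Suc k"] f[of "n + k"] f[of n]] by simp
  qed (simp add: L2_norm_zero)
  have sym: "L2_norm \<Omega> (\<lambda>z. f m z - f n z) = L2_norm \<Omega> (\<lambda>z. f n z - f m z)" for m n
    by (rule L2_norm_minus_commute)
  obtain g r where "g \<in> L2 \<Omega>" "(\<lambda>n. L2_norm \<Omega> (\<lambda>z. f n z - g z)) \<longlonglongrightarrow> 0"
  proof (rule L2_complete[of f \<Omega>])
    fix e :: real assume "e > 0"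
    then obtain N where N: "\<And>m n. m \<ge> N \<Longrightarrow> norm (\<Sum>i=m..<n. ?d i) < e"
      using s unfolding summable_Cauchy by blast
    have le: "L2_norm \<Omega> (\<lambda>z. f m z - f n z) < e" if n: "n \<ge> N" and nm: "n \<le> m" for m n
    proof -
      obtain k where k: "m = n + k" using nm by (auto simp: le_iff_add)
      show ?thesis using step[of n k] N[OF n, of m] unfolding k real_norm_def by linarith
    qed
    have "L2_norm \<Omega> (\<lambda>z. f m z - f n z) < e" if "m \<ge> N" "n \<ge> N" for m n
      using le[of n m] le[of m n] that sym[of m n] by (cases "n \<le> m") auto
    then show "\<exists>N. \<forall>m\<ge>N. \<forall>n\<ge>N. L2_norm \<Omega> (\<lambda>z. f m z - f n z) < e" by blast
  qed (use f in auto)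
  then show ?thesis by blast
qed

abbreviation int_ball :: "nat \<Rightarrow> int set" where
  "int_ball N \<equiv> {- int N..int N}"

text \<open>Symmetric intervals are cofinal among the finite sets of integers, so the net in
  \<open>floquet\<close> can be followed along a sequence, where subsequences and Fatou are
  available.\<close>

lemma filterlim_int_ball: "filterlim int_ball (finite_subsets_at_top UNIV) sequentially"
  unfolding filterlim_finite_subsets_at_top
proof (intro allI impI)
  fix X :: "int set" assume X: "finite X \<and> X \<subseteq> UNIV"
  then obtain N where N: "\<And>x. x \<in> X \<Longrightarrow> \<bar>x\<bar> \<le> int N"
  proof -
    obtain b where b: "\<And>x. x \<in> X \<Longrightarrow> \<bar>x\<bar> \<le> b"
      using X finite_imp_bounded[of "(\<lambda>x. real_of_int x) ` X"] that
      by (metis Max_ge finite_imageI imageI)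
    have "\<bar>x\<bar> \<le> int (nat b)" if "x \<in> X" for x using b[OF that] by linarith
    then show ?thesis using that by blast
  qed
  have "X \<subseteq> int_ball n" if "n \<ge> N" for n
  proof
    fix x assume "x \<in> X"
    from N[OF this] show "x \<in> int_ball n" using that by auto
  qed
  then show "\<forall>\<^sub>F n in sequentially. finite (int_ball n) \<and> X \<subseteq> int_ball n \<and> int_ball n \<subseteq> UNIV"
    by (intro eventually_sequentiallyI[of N]) auto
qed

lemma eventually_subset_int_ball:
  assumes "finite X"
  shows "\<forall>\<^sub>F n in sequentially. X \<subseteq> int_ball n"
proof -
  have "\<forall>\<^sub>F n in sequentially. finite (int_ball n) \<and> X \<subseteq> int_ball n \<and> int_ball n \<subseteq> UNIV"
    using filterlim_int_ball assms unfolding filterlim_finite_subsets_at_top by blast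
  then show ?thesis by eventually_elim simp
qed

lemma trig_sum_diff_Parseval:
  assumes \<phi>: "\<And>m. \<phi> m \<in> L2 \<Omega>" and "finite S" "T \<subseteq> S"
  shows "(LINT \<eta>|lebesgue_on {-pi..pi}. (L2_norm \<Omega> (\<lambda>z. trig_sum \<phi> S \<eta> z - trig_sum \<phi> T \<eta> z))\<^sup>2)
    = (\<Sum>m\<in>S-T. (L2_norm \<Omega> (\<phi> m))\<^sup>2)"
    "integrable (lebesgue_on {-pi..pi}) (\<lambda>\<eta>. (L2_norm \<Omega> (\<lambda>z. trig_sum \<phi> S \<eta> z - trig_sum \<phi> T \<eta> z))\<^sup>2)"
    "(\<lambda>\<eta>. L2_norm \<Omega> (\<lambda>z. trig_sum \<phi> S \<eta> z - trig_sum \<phi> T \<eta> z)) \<in> borel_measurable (lebesgue_on {-pi..pi})"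
proof -
  have eq: "(\<lambda>z. trig_sum \<phi> S \<eta> z - trig_sum \<phi> T \<eta> z) = trig_sum \<phi> (S - T) \<eta>" for \<eta>
    using trig_sum_diff assms by blast
  have fin: "finite (S - T)" using assms by blast
  show "(LINT \<eta>|lebesgue_on {-pi..pi}. (L2_norm \<Omega> (\<lambda>z. trig_sum \<phi> S \<eta> z - trig_sum \<phi> T \<eta> z))\<^sup>2)
    = (\<Sum>m\<in>S-T. (L2_norm \<Omega> (\<phi> m))\<^sup>2)"
    unfolding eq by (rule trig_sum_Parseval[where \<phi> = \<phi>, OF \<phi> fin])
  show "integrable (lebesgue_on {-pi..pi}) (\<lambda>\<eta>. (L2_norm \<Omega> (\<lambda>z. trig_sum \<phi> S \<eta> z - trig_sum \<phi> T \<eta> z))\<^sup>2)"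
    unfolding eq by (rule trig_sum_norm_integrable[where \<phi> = \<phi>, OF \<phi> fin])
  show "(\<lambda>\<eta>. L2_norm \<Omega> (\<lambda>z. trig_sum \<phi> S \<eta> z - trig_sum \<phi> T \<eta> z)) \<in> borel_measurable (lebesgue_on {-pi..pi})"
    unfolding eq using continuous_L2_norm_trig_sum_diff[where \<phi> = \<phi>, OF \<phi> fin L2_zero, of "{-pi..pi}"]
    by (intro continuous_imp_measurable_on_sets_lebesgue) auto
qed

text \<open>Rounding \<eta> down to a grid of mesh \<delta> takes finitely many values on the
  interval, and the Lipschitz bound controls the error uniformly.\<close>

lemma trig_sum_simple_approx:
  assumes \<phi>: "\<And>m. \<phi> m \<in> L2 \<Omega>" and S: "finite S" and \<epsilon>: "\<epsilon> > 0"
  obtains s where "simple_function (lebesgue_on {-pi..pi}) s" "\<And>\<eta>. s \<eta> \<in> L2 \<Omega>"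
    "\<And>\<eta>. L2_norm \<Omega> (\<lambda>z. s \<eta> z - trig_sum \<phi> S \<eta> z) \<le> \<epsilon>"
proof -
  obtain L where L: "L \<ge> 0" "\<And>\<eta> \<eta>'. L2_norm \<Omega> (\<lambda>z. trig_sum \<phi> S \<eta> z - trig_sum \<phi> S \<eta>' z) \<le> L * \<bar>\<eta> - \<eta>'\<bar>"
    using trig_sum_lipschitz[where \<phi> = \<phi>, OF \<phi> S] by blast
  define \<delta> where "\<delta> = \<epsilon> / (L + 1)"
  have \<delta>: "\<delta> > 0" using \<epsilon> L by (simp add: \<delta>_def)
  have L\<delta>: "L * \<delta> \<le> \<epsilon>"
  proof -
    have "L * \<delta> \<le> (L + 1) * \<delta>" using \<delta> by (intro mult_right_mono) auto
    also have "\<dots> = \<epsilon>" using L by (simp add: \<delta>_def)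
    finally show ?thesis .
  qed
  define q where "q = (\<lambda>\<eta>. \<delta> * real_of_int \<lfloor>\<eta> / \<delta>\<rfloor>)"
  have q: "\<bar>q \<eta> - \<eta>\<bar> \<le> \<delta>" for \<eta>
  proof -
    have "of_int \<lfloor>\<eta> / \<delta>\<rfloor> \<le> \<eta> / \<delta>" "\<eta> / \<delta> \<le> of_int \<lfloor>\<eta> / \<delta>\<rfloor> + 1" by linarith+
    then have "\<delta> * of_int \<lfloor>\<eta> / \<delta>\<rfloor> \<le> \<delta> * (\<eta> / \<delta>)" "\<delta> * (\<eta> / \<delta>) \<le> \<delta> * (of_int \<lfloor>\<eta> / \<delta>\<rfloor> + 1)"
      using \<delta> by (simp_all only: mult_left_mono less_imp_le)
    then have "\<delta> * of_int \<lfloor>\<eta> / \<delta>\<rfloor> \<le> \<eta>" "\<eta> \<le> \<delta> * of_int \<lfloor>\<eta> / \<delta>\<rfloor> + \<delta>"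
      using \<delta> by (simp_all add: distrib_left)
    then show ?thesis by (simp add: q_def abs_le_iff)
  qed
  have "q ` {-pi..pi} \<subseteq> (\<lambda>k. \<delta> * real_of_int k) ` {\<lfloor>-pi / \<delta>\<rfloor>..\<lfloor>pi / \<delta>\<rfloor>}"
  proof
    fix x assume "x \<in> q ` {-pi..pi}"
    then obtain \<eta> where \<eta>: "-pi \<le> \<eta>" "\<eta> \<le> pi" "x = \<delta> * real_of_int \<lfloor>\<eta> / \<delta>\<rfloor>" by (auto simp: q_def)
    have "-pi / \<delta> \<le> \<eta> / \<delta>" "\<eta> / \<delta> \<le> pi / \<delta>" using \<eta> \<delta> by (intro divide_right_mono; simp)+
    then have "\<lfloor>\<eta> / \<delta>\<rfloor> \<in> {\<lfloor>-pi / \<delta>\<rfloor>..\<lfloor>pi / \<delta>\<rfloor>}" by (simp only: floor_mono atLeastAtMost_iff)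
    then show "x \<in> (\<lambda>k. \<delta> * real_of_int k) ` {\<lfloor>-pi / \<delta>\<rfloor>..\<lfloor>pi / \<delta>\<rfloor>}" unfolding \<eta>(3) by (rule imageI)
  qed
  then have "finite (q ` {-pi..pi})" by (rule finite_subset) simp
  moreover have "q \<in> borel_measurable (lebesgue_on {-pi..pi})"
    unfolding q_def by (intro measurable_restrict_space1 measurable_completion) measurable
  ultimately have "simple_function (lebesgue_on {-pi..pi}) q"
    by (intro simple_function_borel_measurable) auto
  then have "simple_function (lebesgue_on {-pi..pi}) (\<lambda>\<eta>. trig_sum \<phi> S (q \<eta>))"
    by (rule simple_function_compose1)
  moreover have "L2_norm \<Omega> (\<lambda>z. trig_sum \<phi> S (q \<eta>) z - trig_sum \<phi> S \<eta> z) \<le> \<epsilon>" for \<eta>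
    using L(2)[of "q \<eta>" \<eta>] mult_left_mono[OF q[of \<eta>] L(1)] L\<delta> by linarith
  ultimately show ?thesis using that trig_sum_L2[where \<phi> = \<phi>, OF \<phi>] by blast
qed

text \<open>Instead of completeness of the Bochner space, a fast subsequence of symmetric partial
  sums is made to converge in \<open>L2 \<Omega>\<close> for almost every \<eta>, and the limits are
  chosen fibre by fibre. By Parseval all errors are bounded by tails of one convergent series of
  squares. This supplies the witness for the choice in \<open>floquet\<close>.\<close>

lemma trig_series_bochner_limit:
  assumes \<phi>: "\<And>m. \<phi> m \<in> L2 \<Omega>"
    and B: "\<And>F. finite F \<Longrightarrow> (\<Sum>m\<in>F. (L2_norm \<Omega> (\<phi> m))\<^sup>2) \<le> B"
  obtains g where "g \<in> bochner_L2 \<Omega>"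
    "((\<lambda>S. bochner_L2_norm \<Omega> (\<lambda>\<eta> z. trig_sum \<phi> S \<eta> z - g \<eta> z)) \<longlongrightarrow> 0) (finite_subsets_at_top UNIV)"
proof -
  let ?M = "lebesgue_on {-pi..pi}"
  let ?a = "\<lambda>m. (L2_norm \<Omega> (\<phi> m))\<^sup>2"
  have Ms: "{-pi..pi} \<in> sets lebesgue" by simp
  note T = trig_sum_L2[where \<phi> = \<phi>, OF \<phi>]
  have tail: "\<exists>F0. finite F0 \<and> (\<forall>F. finite F \<longrightarrow> F \<inter> F0 = {} \<longrightarrow> sum ?a F < \<epsilon>)" if "\<epsilon> > 0" for \<epsilon>
    using small_tail_sum[of ?a B \<epsilon>] B that by (metis zero_le_power2)
  obtain r :: "nat \<Rightarrow> nat" where r: "strict_mono r"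
    and rD: "\<And>k m n. m \<ge> r k \<Longrightarrow> n \<ge> r k \<Longrightarrow> sum ?a (int_ball m - int_ball n) < (1/8) ^ k"
  proof (rule Cauchy_fast_subsequence[of "\<lambda>m n. sum ?a (int_ball m - int_ball n)" "\<lambda>k. (1/8) ^ k"])
    fix e :: real assume "e > 0"
    from tail[OF this] obtain F0 where F0: "finite F0" "\<And>F. finite F \<Longrightarrow> F \<inter> F0 = {} \<Longrightarrow> sum ?a F < e" by blast
    obtain N where N: "\<And>n. n \<ge> N \<Longrightarrow> F0 \<subseteq> int_ball n"
      using eventually_subset_int_ball[OF F0(1)] by (auto simp: eventually_sequentially)
    have "sum ?a (int_ball m - int_ball n) < e" if "n \<ge> N" for m n
      using N[OF that] by (intro F0(2)) auto
    then show "\<exists>N. \<forall>m\<ge>N. \<forall>n\<ge>N. sum ?a (int_ball m - int_ball n) < e" by blast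
  qed auto
  define t where "t = (\<lambda>k. trig_sum \<phi> (int_ball (r k)))"
  have tL: "t k \<eta> \<in> L2 \<Omega>" for k \<eta> unfolding t_def by (rule T)
  have "AE \<eta> in ?M. summable (\<lambda>k. \<bar>L2_norm \<Omega> (\<lambda>z. t (Suc k) \<eta> z - t k \<eta> z)\<bar>)"
  proof (rule AE_summable_of_square_integrals)
    fix k
    have sub: "int_ball (r k) \<subseteq> int_ball (r (Suc k))"
      using strict_monoD[OF r, of k "Suc k"] by auto
    have fin: "finite (int_ball (r (Suc k)))" by simp
    note P = trig_sum_diff_Parseval[where \<phi> = \<phi>, OF \<phi> fin sub]
    show "(\<lambda>\<eta>. L2_norm \<Omega> (\<lambda>z. t (Suc k) \<eta> z - t k \<eta> z)) \<in> borel_measurable ?M"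
      unfolding t_def by (rule P(3))
    show "integrable ?M (\<lambda>\<eta>. (L2_norm \<Omega> (\<lambda>z. t (Suc k) \<eta> z - t k \<eta> z))\<^sup>2)"
      unfolding t_def by (rule P(2))
    show "(LINT \<eta>|?M. (L2_norm \<Omega> (\<lambda>z. t (Suc k) \<eta> z - t k \<eta> z))\<^sup>2) \<le> (1/8) ^ k"
      unfolding t_def P(1) using rD[of k "r (Suc k)" "r k"] strict_monoD[OF r, of k "Suc k"] by simp
  qed
  then have conv: "AE \<eta> in ?M. \<exists>g\<in>L2 \<Omega>. (\<lambda>k. L2_norm \<Omega> (\<lambda>z. t k \<eta> z - g z)) \<longlonglongrightarrow> 0"
  proof eventually_elim
    case (elim \<eta>)
    then have "summable (\<lambda>k. L2_norm \<Omega> (\<lambda>z. t (Suc k) \<eta> z - t k \<eta> z))" by (simp add: L2_norm_nonneg)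
    then show ?case by (rule L2_complete_summable[rotated]) (rule tL)
  qed
  \<comment> \<open>Measurability comes afterwards: norms of differences from
    \<open>g \<eta>\<close> are almost everywhere limits of measurable functions. The value 0
    elsewhere keeps every fibre in \<open>L2 \<Omega>\<close>.\<close>
  define g where "g = (\<lambda>\<eta>. if \<exists>g\<in>L2 \<Omega>. (\<lambda>k. L2_norm \<Omega> (\<lambda>z. t k \<eta> z - g z)) \<longlonglongrightarrow> 0
    then SOME g. g \<in> L2 \<Omega> \<and> (\<lambda>k. L2_norm \<Omega> (\<lambda>z. t k \<eta> z - g z)) \<longlonglongrightarrow> 0 else (\<lambda>z. 0))"
  have g: "g \<eta> \<in> L2 \<Omega> \<and> (\<lambda>k. L2_norm \<Omega> (\<lambda>z. t k \<eta> z - g \<eta> z)) \<longlonglongrightarrow> 0"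
    if "\<exists>g\<in>L2 \<Omega>. (\<lambda>k. L2_norm \<Omega> (\<lambda>z. t k \<eta> z - g z)) \<longlonglongrightarrow> 0" for \<eta>
  proof -
    have "\<exists>g. g \<in> L2 \<Omega> \<and> (\<lambda>k. L2_norm \<Omega> (\<lambda>z. t k \<eta> z - g z)) \<longlonglongrightarrow> 0" using that by blast
    from someI_ex[OF this] show ?thesis unfolding g_def using that by presburger
  qed
  have gL: "g \<eta> \<in> L2 \<Omega>" for \<eta>
    using g[of \<eta>] L2_zero[of \<Omega>] by (cases "\<exists>g\<in>L2 \<Omega>. (\<lambda>k. L2_norm \<Omega> (\<lambda>z. t k \<eta> z - g z)) \<longlonglongrightarrow> 0") (auto simp: g_def)
  have lim: "AE \<eta> in ?M. (\<lambda>k. L2_norm \<Omega> (\<lambda>z. t k \<eta> z - g \<eta> z)) \<longlonglongrightarrow> 0"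
    using conv by eventually_elim (use g in blast)
  have limd: "AE \<eta> in ?M. (\<lambda>k. L2_norm \<Omega> (\<lambda>z. trig_sum \<phi> S \<eta> z - t k \<eta> z)) \<longlonglongrightarrow> L2_norm \<Omega> (\<lambda>z. trig_sum \<phi> S \<eta> z - g \<eta> z)" for S
    using lim
  proof eventually_elim
    case (elim \<eta>)
    have "\<bar>L2_norm \<Omega> (\<lambda>z. trig_sum \<phi> S \<eta> z - t k \<eta> z) - L2_norm \<Omega> (\<lambda>z. trig_sum \<phi> S \<eta> z - g \<eta> z)\<bar>
        \<le> L2_norm \<Omega> (\<lambda>z. t k \<eta> z - g \<eta> z)" for k
      using L2_norm_diff_triangle[OF T[of S \<eta>] tL[of k \<eta>] gL[of \<eta>]]
        L2_norm_diff_triangle[OF T[of S \<eta>] gL[of \<eta>] tL[of k \<eta>]]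
        L2_norm_minus_commute[of \<Omega> "t k \<eta>" "g \<eta>"] by (simp add: abs_le_iff)
    then have "(\<lambda>k. L2_norm \<Omega> (\<lambda>z. trig_sum \<phi> S \<eta> z - t k \<eta> z) - L2_norm \<Omega> (\<lambda>z. trig_sum \<phi> S \<eta> z - g \<eta> z)) \<longlonglongrightarrow> 0"
      by (intro Lim_null_comparison[OF _ elim] always_eventually) simp
    then show ?case by (simp add: LIM_zero_iff)
  qed
  have tdiff: "finite S \<Longrightarrow> S \<subseteq> int_ball (r k) \<Longrightarrow>
      integrable ?M (\<lambda>\<eta>. (L2_norm \<Omega> (\<lambda>z. trig_sum \<phi> S \<eta> z - t k \<eta> z))\<^sup>2) \<and>
      (LINT \<eta>|?M. (L2_norm \<Omega> (\<lambda>z. trig_sum \<phi> S \<eta> z - t k \<eta> z))\<^sup>2) = sum ?a (int_ball (r k) - S)" for S k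
    unfolding t_def L2_norm_minus_commute[of \<Omega> "trig_sum \<phi> S _"]
    using trig_sum_diff_Parseval[where \<phi> = \<phi> and S = "int_ball (r k)", OF \<phi>] by simp
  have sev: "\<forall>\<^sub>F k in sequentially. S \<subseteq> int_ball (r k)" if "finite S" for S
    using filterlim_subseq[OF r, unfolded filterlim_iff, rule_format, OF eventually_subset_int_ball[OF that]] .
  \<comment> \<open>Fatou along the subsequence, started at \<open>K\<close> because Parseval for
    differences asks for \<open>S\<close> to lie inside the interval. With \<open>S\<close> empty it
    gives integrability for \<open>g\<close>, with large \<open>S\<close> the convergence of the
    net.\<close>
  have bound: "integrable ?M (\<lambda>\<eta>. (L2_norm \<Omega> (\<lambda>z. trig_sum \<phi> S \<eta> z - g \<eta> z))\<^sup>2) \<and>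
      (LINT \<eta>|?M. (L2_norm \<Omega> (\<lambda>z. trig_sum \<phi> S \<eta> z - g \<eta> z))\<^sup>2) \<le> \<epsilon>"
    if S: "finite S" and le: "\<And>F. finite F \<Longrightarrow> F \<inter> S = {} \<Longrightarrow> sum ?a F \<le> \<epsilon>" for S \<epsilon>
  proof -
    obtain K where K: "\<And>k. k \<ge> K \<Longrightarrow> S \<subseteq> int_ball (r k)"
      using sev[OF S] by (auto simp: eventually_sequentially)
    let ?u = "\<lambda>k \<eta>. (L2_norm \<Omega> (\<lambda>z. trig_sum \<phi> S \<eta> z - t (k + K) \<eta> z))\<^sup>2"
    have u: "integrable ?M (?u k)" "(LINT \<eta>|?M. ?u k \<eta>) = sum ?a (int_ball (r (k + K)) - S)" for k
      using tdiff[OF S K, of "k + K"] by auto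
    have limu: "AE \<eta> in ?M. (\<lambda>k. ?u k \<eta>) \<longlonglongrightarrow> (L2_norm \<Omega> (\<lambda>z. trig_sum \<phi> S \<eta> z - g \<eta> z))\<^sup>2"
      using limd[of S] by eventually_elim (intro tendsto_power, rule LIMSEQ_ignore_initial_segment)
    have meas: "(\<lambda>\<eta>. (L2_norm \<Omega> (\<lambda>z. trig_sum \<phi> S \<eta> z - g \<eta> z))\<^sup>2) \<in> borel_measurable ?M"
      by (rule borel_measurable_AE_LIMSEQ[OF Ms _ limu]) (use u(1) in blast)
    have ev: "\<forall>\<^sub>F k in sequentially. (LINT \<eta>|?M. ?u k \<eta>) \<le> \<epsilon>"
      unfolding u(2) by (intro always_eventually allI le) auto
    show ?thesis
      using fatou_integral_bound[OF u(1) _ meas _ limu ev] by simp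
  qed
  have "g \<in> bochner_L2 \<Omega>"
  proof -
    \<comment> \<open>\<open>t n\<close> converges to \<open>g\<close> almost everywhere but is not
      simple; step functions within 1/(n+1) of it inherit the limit.\<close>
    have "\<exists>s. \<forall>n. simple_function ?M (s n) \<and> (\<forall>\<eta>. s n \<eta> \<in> L2 \<Omega>) \<and>
        (\<forall>\<eta>. L2_norm \<Omega> (\<lambda>z. s n \<eta> z - t n \<eta> z) \<le> 1 / real (Suc n))"
    proof (rule choice, rule allI)
      fix n
      have "1 / real (Suc n) > 0" by simp
      from trig_sum_simple_approx[where \<phi> = \<phi> and S = "int_ball (r n)", OF \<phi> _ this]
      show "\<exists>s. simple_function ?M s \<and> (\<forall>\<eta>. s \<eta> \<in> L2 \<Omega>) \<and>
        (\<forall>\<eta>. L2_norm \<Omega> (\<lambda>z. s \<eta> z - t n \<eta> z) \<le> 1 / real (Suc n))"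
        unfolding t_def by (metis finite_atLeastAtMost_int)
    qed
    then obtain s where s: "\<And>n. simple_function ?M (s n)" "\<And>n \<eta>. s n \<eta> \<in> L2 \<Omega>"
      "\<And>n \<eta>. L2_norm \<Omega> (\<lambda>z. s n \<eta> z - t n \<eta> z) \<le> 1 / real (Suc n)" by blast
    have slim: "AE \<eta> in ?M. (\<lambda>n. L2_norm \<Omega> (\<lambda>z. s n \<eta> z - g \<eta> z)) \<longlonglongrightarrow> 0"
      using lim
    proof eventually_elim
      case (elim \<eta>)
      have le: "L2_norm \<Omega> (\<lambda>z. s n \<eta> z - g \<eta> z) \<le> 1 / real (Suc n) + L2_norm \<Omega> (\<lambda>z. t n \<eta> z - g \<eta> z)" for n
        using L2_norm_diff_triangle[OF s(2)[of n \<eta>] tL[of n \<eta>] gL[of \<eta>]] s(3)[of n \<eta>] by linarith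
      have "(\<lambda>n. 1 / real (Suc n) + L2_norm \<Omega> (\<lambda>z. t n \<eta> z - g \<eta> z)) \<longlonglongrightarrow> 0"
        using tendsto_add[OF LIMSEQ_Suc[OF lim_1_over_n] elim] by simp
      then show ?case
        by (rule Lim_null_comparison[rotated]) (intro always_eventually allI, simp only: real_norm_def abs_of_nonneg L2_norm_nonneg le)
    qed
    have "(\<lambda>z. trig_sum \<phi> {} \<eta> z - g \<eta> z) = (\<lambda>z. - g \<eta> z)" for \<eta> by (simp add: trig_sum_def)
    then have "integrable ?M (\<lambda>\<eta>. (L2_norm \<Omega> (g \<eta>))\<^sup>2)"
      using bound[of "{}" B] B L2_norm_uminus[of \<Omega> "g _"] by simp
    then show ?thesis unfolding bochner_L2_def using s(1,2) slim gL by blast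
  qed
  moreover have "((\<lambda>S. bochner_L2_norm \<Omega> (\<lambda>\<eta> z. trig_sum \<phi> S \<eta> z - g \<eta> z)) \<longlongrightarrow> 0) (finite_subsets_at_top UNIV)"
  proof (rule tendstoI)
    fix e :: real assume e: "e > 0"
    then have "(e/2)\<^sup>2 > 0" by simp
    from tail[OF this] obtain F0 where F0: "finite F0" "\<And>F. finite F \<Longrightarrow> F \<inter> F0 = {} \<Longrightarrow> sum ?a F < (e/2)\<^sup>2" by blast
    have le: "bochner_L2_norm \<Omega> (\<lambda>\<eta> z. trig_sum \<phi> S \<eta> z - g \<eta> z) \<le> e/2" if "finite S" "F0 \<subseteq> S" for S
    proof -
      have "sum ?a F \<le> (e/2)\<^sup>2" if "finite F" "F \<inter> S = {}" for F
        using F0(2)[of F] that \<open>F0 \<subseteq> S\<close> by force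
      from bound[OF \<open>finite S\<close> this] show ?thesis
        unfolding bochner_L2_norm_def using e by (intro real_le_lsqrt) auto
    qed
    have nn: "0 \<le> bochner_L2_norm \<Omega> (\<lambda>\<eta> z. trig_sum \<phi> S \<eta> z - g \<eta> z)" for S
      unfolding bochner_L2_norm_def by (intro real_sqrt_ge_zero integral_nonneg_AE) simp
    have "dist (bochner_L2_norm \<Omega> (\<lambda>\<eta> z. trig_sum \<phi> S \<eta> z - g \<eta> z)) 0 < e"
      if "finite S" "F0 \<subseteq> S" for S
      using le[OF that] nn[of S] e unfolding dist_real_def by linarith
    then show "\<forall>\<^sub>F S in finite_subsets_at_top UNIV. dist (bochner_L2_norm \<Omega> (\<lambda>\<eta> z. trig_sum \<phi> S \<eta> z - g \<eta> z)) 0 < e"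
      unfolding eventually_finite_subsets_at_top using F0(1) by blast
  qed
  ultimately show ?thesis using that by blast
qed

lemma bochner_limit_integrals:
  assumes \<phi>: "\<And>m. \<phi> m \<in> L2 \<Omega>" and g: "g \<in> bochner_L2 \<Omega>"
    and lim: "((\<lambda>S. bochner_L2_norm \<Omega> (\<lambda>\<eta> z. trig_sum \<phi> S \<eta> z - g \<eta> z)) \<longlongrightarrow> 0) (finite_subsets_at_top UNIV)"
  shows "(\<lambda>N. LINT \<eta>|lebesgue_on {-pi..pi}. (L2_norm \<Omega> (\<lambda>z. trig_sum \<phi> (int_ball N) \<eta> z - g \<eta> z))\<^sup>2) \<longlonglongrightarrow> 0"
    "(\<lambda>N. LINT \<eta>|lebesgue_on {-pi..pi}. L2_norm \<Omega> (\<lambda>z. trig_sum \<phi> (int_ball N) \<eta> z - g \<eta> z)) \<longlonglongrightarrow> 0"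
    "integrable (lebesgue_on {-pi..pi}) (\<lambda>\<eta>. L2_norm \<Omega> (\<lambda>z. trig_sum \<phi> (int_ball N) \<eta> z - g \<eta> z))"
proof -
  let ?M = "lebesgue_on {-pi..pi}"
  interpret finite_measure ?M by (rule finite_measure_lebesgue_on_Icc)
  let ?x = "\<lambda>N \<eta>. L2_norm \<Omega> (\<lambda>z. trig_sum \<phi> (int_ball N) \<eta> z - g \<eta> z)"
  have sq: "integrable ?M (\<lambda>\<eta>. (?x N \<eta>)\<^sup>2)" for N
    by (rule bochner_L2_trig_sum_diff_integrable[where \<phi> = \<phi>, OF \<phi> _ g]) simp
  have i: "integrable ?M (?x N)" for N
  proof (rule Bochner_Integration.integrable_bound)
    show "integrable ?M (\<lambda>\<eta>. 1 + (?x N \<eta>)\<^sup>2)" using sq by simp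
    show "?x N \<in> borel_measurable ?M"
      by (rule bochner_L2_strongly_measurable[where \<phi> = \<phi>, OF \<phi> _ g]) simp
    have "\<bar>x\<bar> \<le> 1 + x\<^sup>2" for x :: real
      using sum_squares_bound[of "\<bar>x\<bar>" 1] by (simp add: power2_eq_square)
    then show "AE \<eta> in ?M. norm (?x N \<eta>) \<le> norm (1 + (?x N \<eta>)\<^sup>2)" by simp
  qed
  show "integrable ?M (?x N)" by (rule i)
  have "(\<lambda>N. bochner_L2_norm \<Omega> (\<lambda>\<eta> z. trig_sum \<phi> (int_ball N) \<eta> z - g \<eta> z)) \<longlonglongrightarrow> 0"
    by (rule filterlim_compose[OF lim filterlim_int_ball])
  from tendsto_power[OF this, of 2] have "(\<lambda>N. (bochner_L2_norm \<Omega> (\<lambda>\<eta> z. trig_sum \<phi> (int_ball N) \<eta> z - g \<eta> z))\<^sup>2) \<longlonglongrightarrow> 0"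
    by simp
  moreover have "(bochner_L2_norm \<Omega> (\<lambda>\<eta> z. trig_sum \<phi> (int_ball N) \<eta> z - g \<eta> z))\<^sup>2 = (LINT \<eta>|?M. (?x N \<eta>)\<^sup>2)" for N
    unfolding bochner_L2_norm_def by (subst real_sqrt_pow2) (auto intro!: integral_nonneg_AE)
  ultimately show "(\<lambda>N. LINT \<eta>|?M. (?x N \<eta>)\<^sup>2) \<longlonglongrightarrow> 0" by simp
  then show "(\<lambda>N. LINT \<eta>|?M. ?x N \<eta>) \<longlonglongrightarrow> 0"
    by (rule integral_tendsto_0_of_square[OF finite_measure_axioms i sq])
qed

text \<open>The given \<open>r0\<close> makes it possible to thin out a subsequence already chosen
  for another limit.\<close>

lemma bochner_limit_subseq:
  assumes \<phi>: "\<And>m. \<phi> m \<in> L2 \<Omega>" and g: "g \<in> bochner_L2 \<Omega>"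
    and lim: "((\<lambda>S. bochner_L2_norm \<Omega> (\<lambda>\<eta> z. trig_sum \<phi> S \<eta> z - g \<eta> z)) \<longlongrightarrow> 0) (finite_subsets_at_top UNIV)"
    and r0: "strict_mono r0"
  obtains r :: "nat \<Rightarrow> nat" where "strict_mono r"
    "AE \<eta> in lebesgue_on {-pi..pi}. (\<lambda>n. L2_norm \<Omega> (\<lambda>z. trig_sum \<phi> (int_ball (r0 (r n))) \<eta> z - g \<eta> z)) \<longlonglongrightarrow> 0"
proof -
  let ?x = "\<lambda>N \<eta>. L2_norm \<Omega> (\<lambda>z. trig_sum \<phi> (int_ball N) \<eta> z - g \<eta> z)"
  note * = bochner_limit_integrals[where \<phi> = \<phi>, OF \<phi> g lim]
  have "(\<lambda>n. LINT \<eta>|lebesgue_on {-pi..pi}. norm (?x (r0 n) \<eta>)) \<longlonglongrightarrow> 0"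
    using LIMSEQ_subseq_LIMSEQ[OF *(2) r0] by (simp add: o_def L2_norm_nonneg)
  from tendsto_L1_AE_subseq[OF *(3) this] that show ?thesis by blast
qed

section \<open>Geometry of the periodic domain\<close>

text \<open>Below the graph lies an open set disjoint from \<Omega>, and it reaches every
  neighbourhood of the boundary point, so no boundary point is interior to the closure. This
  excludes slits in the cell, which the interior of the union of closures would fill in.\<close>

lemma interior_closure_lipschitz_domain:
  assumes "lipschitz_domain \<Omega>"
  shows "interior (closure \<Omega>) = \<Omega>"
proof
  have op: "open \<Omega>" using assms by (simp add: lipschitz_domain_def)
  show "\<Omega> \<subseteq> interior (closure \<Omega>)" using op closure_subset by (rule interior_maximal[rotated])
  show "interior (closure \<Omega>) \<subseteq> \<Omega>"
  proof (rule subsetI, rule ccontr)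
    fix p assume p: "p \<in> interior (closure \<Omega>)" "p \<notin> \<Omega>"
    then have "p \<in> frontier \<Omega>" using op interior_subset[of "closure \<Omega>"] by (auto simp: frontier_def interior_open)
    then obtain r u \<phi> L where r: "r > 0" and u: "norm (u::complex) = 1" and \<phi>: "L-lipschitz_on UNIV \<phi>"
      and graph: "\<And>\<zeta>. norm \<zeta> < r \<Longrightarrow> p + u * \<zeta> \<in> \<Omega> \<longleftrightarrow> \<phi> (Re \<zeta>) < Im \<zeta>"
      using assms unfolding lipschitz_domain_def by metis
    have u0: "u \<noteq> 0" using u by auto
    have "\<phi> 0 \<ge> 0" using graph[of 0] r p by auto
    obtain e where e: "e > 0" "ball p e \<subseteq> closure \<Omega>" using p(1) by (auto simp: mem_interior)
    define t where "t = min r e / 2"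
    have t: "t > 0" "t < r" "t < e" using r e by (auto simp: t_def)
    \<comment> \<open>The region strictly below the graph; (q - p) / u inverts the rigid
      motion.\<close>
    define W where "W = {q. norm ((q - p) / u) < r \<and> Im ((q - p) / u) < \<phi> (Re ((q - p) / u))}"
    have c: "continuous_on UNIV (\<lambda>x. \<phi> (f x))" if "continuous_on UNIV f" for f :: "complex \<Rightarrow> real"
      using continuous_on_compose2[OF lipschitz_on_continuous_on[OF \<phi>] that] by simp
    have "open W" unfolding W_def
      by (intro open_Collect_conj open_Collect_less c continuous_intros) (use u0 in auto)
    moreover have "W \<inter> \<Omega> = {}"
    proof -
      have "q \<notin> \<Omega>" if "q \<in> W" for q
        using graph[of "(q - p) / u"] that u0 by (auto simp: W_def)
      then show ?thesis by blast
    qed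
    ultimately have "W \<inter> closure \<Omega> = {}" by (simp add: open_Int_closure_eq_empty)
    moreover have "p + u * (- \<i> * of_real t) \<in> W"
      using t u0 \<open>\<phi> 0 \<ge> 0\<close> by (simp add: W_def norm_mult)
    moreover have "p + u * (- \<i> * of_real t) \<in> closure \<Omega>"
      using t u by (intro subsetD[OF e(2)]) (simp add: dist_norm norm_mult)
    ultimately show False by blast
  qed
qed

lemma lebesgue_distr_plus:
  fixes c :: "'a::euclidean_space"
  shows "distr lebesgue lebesgue ((+) c) = lebesgue" "(+) c \<in> lebesgue \<rightarrow>\<^sub>M lebesgue"
proof -
  have T: "(\<lambda>x. c + (\<Sum>j\<in>Basis. (1 * (x \<bullet> j)) *\<^sub>R j)) = (+) c"
    by (simp add: fun_eq_iff euclidean_representation)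
  show "(+) c \<in> lebesgue \<rightarrow>\<^sub>M lebesgue"
    using lebesgue_affine_measurable[of "\<lambda>_. 1" c] unfolding T by simp
  show "distr lebesgue lebesgue ((+) c) = lebesgue"
    using lebesgue_affine_euclidean[of "\<lambda>_. 1" c] unfolding T by (simp add: density_1)
qed

lemma negligible_Re_Ints: "negligible {z::complex. Re z \<in> \<int>}"
proof -
  have "negligible {z::complex. Re z = of_int k}" for k
    using negligible_standard_hyperplane[of "1::complex" "of_int k"] by (simp add: Basis_complex_def)
  then have "negligible (\<Union>k::int. {z::complex. Re z = of_int k})"
    by (intro negligible_countable_Union) auto
  also have "(\<Union>k::int. {z::complex. Re z = of_int k}) = {z. Re z \<in> \<int>}" by (auto simp: Ints_def)
  finally show ?thesis .
qed

section \<open>The periodic domain and its cells\<close>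

locale periodic_cell =
  fixes M a b :: real and cell :: "complex set"
  assumes cell_strip: "cell \<subseteq> {z. 0 < Re z \<and> Re z < 1 \<and> - M < Im z \<and> Im z < M}"
    and closure_cell_left: "closure cell \<inter> {z. Re z = 0} = {z. Re z = 0 \<and> a \<le> Im z \<and> Im z \<le> b}"
    and closure_cell_right: "closure cell \<inter> {z. Re z = 1} = {z. Re z = 1 \<and> a \<le> Im z \<and> Im z \<le> b}"
    and lipschitz_cell: "lipschitz_domain cell"
begin

abbreviation Pdom :: "complex set" ("\<Pi>") where "\<Pi> \<equiv> periodic_domain cell"

lemma open_cell: "open cell"
  using lipschitz_cell by (simp add: lipschitz_domain_def)

lemma open_Pdom: "open \<Pi>"
  by (simp add: periodic_domain_def)

lemma cell_lebesgue [simp]: "cell \<in> sets lebesgue" and Pdom_lebesgue [simp]: "\<Pi> \<in> sets lebesgue"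
  using open_cell open_Pdom by auto

lemma closure_cell_strip: "z \<in> closure cell \<Longrightarrow> 0 \<le> Re z \<and> Re z \<le> 1 \<and> \<bar>Im z\<bar> \<le> M"
proof -
  have "closed {z. 0 \<le> Re z \<and> Re z \<le> 1 \<and> \<bar>Im z\<bar> \<le> M}"
    by (intro closed_Collect_conj closed_Collect_le continuous_intros)
  moreover have "cell \<subseteq> {z. 0 \<le> Re z \<and> Re z \<le> 1 \<and> \<bar>Im z\<bar> \<le> M}" using cell_strip by auto
  ultimately show "z \<in> closure cell \<Longrightarrow> 0 \<le> Re z \<and> Re z \<le> 1 \<and> \<bar>Im z\<bar> \<le> M"
    using closure_minimal by blast
qed

definition cell_cover :: "complex set" where
  "cell_cover = {z. \<exists>m::int. z - of_int m \<in> closure cell}"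

lemma Pdom_eq: "\<Pi> = interior cell_cover"
proof -
  have "closure ((\<lambda>z. z + of_int m) ` cell) = {z. z - of_int m \<in> closure cell}" for m :: int
  proof -
    have "closure ((\<lambda>z. z + of_int m) ` cell) = (\<lambda>z. z + of_int m) ` closure cell"
      using closure_translation[of "of_int m" cell] by (simp add: add.commute)
    also have "\<dots> = {z. z - of_int m \<in> closure cell}" by (force simp: image_iff)
    finally show ?thesis .
  qed
  then show ?thesis unfolding periodic_domain_def cell_cover_def by (auto intro!: arg_cong[of _ _ interior])
qed

lemma Pdom_shift_imp: "z \<in> \<Pi> \<Longrightarrow> z + of_int k \<in> \<Pi>"
proof -
  assume z: "z \<in> \<Pi>"
  obtain e where e: "e > 0" "ball z e \<subseteq> cell_cover" using z by (auto simp: Pdom_eq mem_interior)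
  have "ball (z + of_int k) e \<subseteq> cell_cover"
  proof
    fix w assume "w \<in> ball (z + of_int k) e"
    then have "w - of_int k \<in> ball z e" by (simp add: dist_norm algebra_simps)
    then obtain m :: int where "w - of_int k - of_int m \<in> closure cell" using e by (auto simp: cell_cover_def)
    then have "w - of_int (k + m) \<in> closure cell" by (simp add: algebra_simps)
    then show "w \<in> cell_cover" unfolding cell_cover_def by blast
  qed
  then show ?thesis using e by (auto simp: Pdom_eq mem_interior)
qed

lemma Pdom_shift: "z + of_int k \<in> \<Pi> \<longleftrightarrow> z \<in> \<Pi>"
  using Pdom_shift_imp[of z k] Pdom_shift_imp[of "z + of_int k" "-k"] by auto

lemma Pdom_shift_diff: "z - of_int k \<in> \<Pi> \<longleftrightarrow> z \<in> \<Pi>"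
  using Pdom_shift[of z "-k"] by simp

lemma cell_subset_Pdom: "cell \<subseteq> \<Pi>"
proof -
  have "cell \<subseteq> cell_cover" using closure_subset[of cell] by (force simp: cell_cover_def intro!: exI[of _ 0])
  then show ?thesis unfolding Pdom_eq using open_cell by (rule interior_maximal)
qed

lemma cell_shift_in_Pdom: "z \<in> cell \<Longrightarrow> z + of_int m \<in> \<Pi>"
  using cell_subset_Pdom Pdom_shift by blast

lemma Pdom_Im_le: "z \<in> \<Pi> \<Longrightarrow> \<bar>Im z\<bar> \<le> M"
  using interior_subset[of cell_cover] closure_cell_strip by (fastforce simp: Pdom_eq cell_cover_def)

text \<open>In the open unit strip only the translate with m = 0 contributes, so this part of \<Pi>
  is an open subset of \<open>closure cell\<close>; the Lipschitz boundary brings it back to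
  \<open>cell\<close>.\<close>

lemma Pdom_in_strip: "z \<in> \<Pi> \<Longrightarrow> 0 < Re z \<Longrightarrow> Re z < 1 \<Longrightarrow> z \<in> cell"
proof -
  assume z: "z \<in> \<Pi>" "0 < Re z" "Re z < 1"
  let ?S = "{z. 0 < Re z} \<inter> {z. Re z < 1}"
  have oS: "open (\<Pi> \<inter> ?S)"
    by (intro open_Int open_Pdom open_halfspace_Re_gt open_halfspace_Re_lt)
  have "\<Pi> \<inter> ?S \<subseteq> closure cell"
  proof
    fix w assume w: "w \<in> \<Pi> \<inter> ?S"
    then obtain m :: int where m: "w - of_int m \<in> closure cell"
      using interior_subset[of cell_cover] by (auto simp: Pdom_eq cell_cover_def)
    then have "0 \<le> Re w - of_int m" "Re w - of_int m \<le> 1" using closure_cell_strip[OF m] by auto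
    then have "real_of_int m < 1" "real_of_int m > -1" using w by auto
    then have "m = 0" by linarith
    then show "w \<in> closure cell" using m by simp
  qed
  then have "\<Pi> \<inter> ?S \<subseteq> interior (closure cell)" using oS by (rule interior_maximal)
  then show "z \<in> cell" using z interior_closure_lipschitz_domain[OF lipschitz_cell] by auto
qed

text \<open>Only the translates 0 and -1 reach the line Re z = 0, and the closure hypotheses bound
  Im z by a and b. Moving vertically by half the radius of a disc in the cover makes the bounds
  strict, which matches the range of y in \<open>A2_ext\<close>.\<close>

lemma Pdom_on_line:
  assumes "z \<in> \<Pi>" "Re z = 0"
  shows "a < Im z \<and> Im z < b \<and> z \<in> closure cell \<and> z + 1 \<in> closure cell"
proof -
  have *: "a \<le> Im w \<and> Im w \<le> b" if "w \<in> cell_cover" "Re w = 0" for w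
  proof -
    obtain m :: int where m: "w - of_int m \<in> closure cell" using \<open>w \<in> cell_cover\<close> by (auto simp: cell_cover_def)
    then have "0 \<le> - real_of_int m" "- real_of_int m \<le> 1" using closure_cell_strip[OF m] that by auto
    then have "m = 0 \<or> m = -1" by linarith
    then show ?thesis
    proof
      assume "m = 0"
      then have "w \<in> closure cell \<inter> {z. Re z = 0}" using m that by simp
      then show ?thesis unfolding closure_cell_left by simp
    next
      assume "m = -1"
      then have "w + 1 \<in> closure cell \<inter> {z. Re z = 1}" using m that by simp
      then show ?thesis unfolding closure_cell_right by simp
    qed
  qed
  obtain e where e: "e > 0" "ball z e \<subseteq> cell_cover" using assms(1) by (auto simp: Pdom_eq mem_interior)
  have shift: "z + \<i> * of_real t \<in> cell_cover" if "\<bar>t\<bar> < e" for t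
    using that by (intro subsetD[OF e(2)]) (simp add: dist_norm norm_mult)
  have "a \<le> Im z + e/2 \<and> Im z + e/2 \<le> b" using *[OF shift[of "e/2"]] assms e by simp
  moreover have "a \<le> Im z - e/2 \<and> Im z - e/2 \<le> b" using *[OF shift[of "-e/2"]] assms e by simp
  ultimately have "a < Im z \<and> Im z < b" using e(1) by auto
  moreover from this have "z \<in> {z. Re z = 0 \<and> a \<le> Im z \<and> Im z \<le> b}" "z + 1 \<in> {z. Re z = 1 \<and> a \<le> Im z \<and> Im z \<le> b}"
    using assms by auto
  ultimately show ?thesis unfolding closure_cell_left[symmetric] closure_cell_right[symmetric] by blast
qed

lemma Pdom_off_lines:
  assumes "z \<in> \<Pi>" "Re z \<notin> \<int>"
  shows "z - of_int \<lfloor>Re z\<rfloor> \<in> cell"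
proof (rule Pdom_in_strip)
  show "z - of_int \<lfloor>Re z\<rfloor> \<in> \<Pi>" using assms by (simp add: Pdom_shift_diff)
  show "0 < Re (z - of_int \<lfloor>Re z\<rfloor>)" 
  proof -
    have "of_int \<lfloor>Re z\<rfloor> \<noteq> Re z" using assms(2) Ints_of_int by metis
    then have "of_int \<lfloor>Re z\<rfloor> < Re z" by (rule le_neq_trans[OF of_int_floor_le])
    then show ?thesis by simp
  qed
  show "Re (z - of_int \<lfloor>Re z\<rfloor>) < 1" by simp linarith
qed

lemma cell_floor: "z \<in> cell \<Longrightarrow> \<lfloor>Re (z + of_int m)\<rfloor> = m"
proof -
  assume "z \<in> cell"
  then have "0 < Re z" "Re z < 1" using cell_strip by auto
  then show ?thesis by (simp add: floor_eq_iff)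
qed

section \<open>Integration over translated cells\<close>

lemma AE_Pdom_off_lines: "AE z in lebesgue_on \<Pi>. Re z \<notin> \<int>"
proof -
  have "AE z in lebesgue. z \<notin> {z. Re z \<in> \<int>}"
    using negligible_Re_Ints by (intro AE_not_in) (simp add: negligible_iff_null_sets)
  then show ?thesis by (subst AE_restrict_space_iff) auto
qed

lemma shift_indicator_lebesgue: "\<Omega> \<in> sets lebesgue \<Longrightarrow> {w::complex. w - c \<in> \<Omega>} \<in> sets lebesgue"
  using measurable_sets[OF lebesgue_distr_plus(2)[of "-c"], of \<Omega>] by (simp add: vimage_def)

text \<open>Translation invariance, with the indicator kept under an integral over the fixed set
  \<Pi>. Sums over m then become sums of indicators, that is, counts of the translates of \<Omega>
  covering a point.\<close>

lemma shift_integral: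
  fixes \<phi> :: "complex \<Rightarrow> 'b::{banach, second_countable_topology}"
  assumes \<phi>: "\<phi> \<in> borel_measurable (lebesgue_on \<Pi>)" and \<Omega>: "\<Omega> \<in> sets lebesgue" "\<Omega> \<subseteq> \<Pi>"
  shows "(\<lambda>z. \<phi> (z + of_int m)) \<in> borel_measurable (lebesgue_on \<Omega>)"
    "(LINT z|lebesgue_on \<Omega>. \<phi> (z + of_int m)) = (LINT w|lebesgue_on \<Pi>. indicator \<Omega> (w - of_int m) *\<^sub>R \<phi> w)"
    "integrable (lebesgue_on \<Omega>) (\<lambda>z. \<phi> (z + of_int m)) \<longleftrightarrow>
      integrable (lebesgue_on \<Pi>) (\<lambda>w. indicator \<Omega> (w - of_int m) *\<^sub>R \<phi> w)"
proof -
  define \<psi> where "\<psi> = (\<lambda>w. indicator \<Pi> w *\<^sub>R \<phi> w)"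
  have \<psi>: "\<psi> \<in> borel_measurable lebesgue"
    using \<phi> unfolding \<psi>_def by (subst (asm) borel_measurable_restrict_space_iff) auto
  have \<psi>c: "(\<lambda>z. \<psi> (of_int m + z)) \<in> borel_measurable lebesgue"
    using measurable_compose[OF lebesgue_distr_plus(2) \<psi>] .
  have in\<Pi>: "z + of_int m \<in> \<Pi>" if "z \<in> \<Omega>" for z using that \<Omega>(2) Pdom_shift by blast
  have eq\<psi>: "\<phi> (z + of_int m) = \<psi> (of_int m + z)" if "z \<in> \<Omega>" for z
    using in\<Pi>[OF that] by (simp add: \<psi>_def add.commute)
  show "(\<lambda>z. \<phi> (z + of_int m)) \<in> borel_measurable (lebesgue_on \<Omega>)"
    using measurable_restrict_space1[OF \<psi>c, of \<Omega>] by (subst measurable_cong[of _ _ "\<lambda>z. \<psi> (of_int m + z)"]) (auto simp: eq\<psi>)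
  define F where "F = (\<lambda>w. indicator \<Omega> (w - of_int m) *\<^sub>R \<psi> w)"
  have ind: "(\<lambda>w. indicator \<Omega> (w - of_int m) :: real) \<in> borel_measurable lebesgue"
  proof -
    have "(\<lambda>w. indicator \<Omega> (w - of_int m) :: real) = indicator {w. w - of_int m \<in> \<Omega>}" by (auto simp: indicator_def)
    then show ?thesis using shift_indicator_lebesgue[OF \<Omega>(1)] by simp
  qed
  have F: "F \<in> borel_measurable lebesgue" unfolding F_def using ind \<psi> by simp
  have r\<Omega>: "indicator \<Omega> z *\<^sub>R \<phi> (z + of_int m) = F (of_int m + z)" for z
    by (auto simp: F_def indicator_def eq\<psi>)
  have r\<Pi>: "indicator \<Pi> w *\<^sub>R (indicator \<Omega> (w - of_int m) *\<^sub>R \<phi> w) = F w" for w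
    by (auto simp: F_def \<psi>_def indicator_def)
  have "(LINT z|lebesgue_on \<Omega>. \<phi> (z + of_int m)) = (LINT z|lebesgue. F (of_int m + z))"
    unfolding r\<Omega>[symmetric] using \<Omega> by (intro integral_restrict_space) simp
  also have "\<dots> = (LINT w|distr lebesgue lebesgue ((+) (of_int m)). F w)"
    by (rule integral_distr[symmetric, OF lebesgue_distr_plus(2) F])
  also have "\<dots> = (LINT w|lebesgue. F w)" by (simp only: lebesgue_distr_plus(1))
  also have "\<dots> = (LINT w|lebesgue_on \<Pi>. indicator \<Omega> (w - of_int m) *\<^sub>R \<phi> w)"
    unfolding r\<Pi>[symmetric] by (rule integral_restrict_space[symmetric]) simp
  finally show "(LINT z|lebesgue_on \<Omega>. \<phi> (z + of_int m)) = (LINT w|lebesgue_on \<Pi>. indicator \<Omega> (w - of_int m) *\<^sub>R \<phi> w)" .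
  have "integrable (lebesgue_on \<Omega>) (\<lambda>z. \<phi> (z + of_int m)) \<longleftrightarrow> integrable lebesgue (\<lambda>z. F (of_int m + z))"
    unfolding r\<Omega>[symmetric] using \<Omega> by (intro integrable_restrict_space) simp
  also have "\<dots> \<longleftrightarrow> integrable (distr lebesgue lebesgue ((+) (of_int m))) F"
    by (rule integrable_distr_eq[symmetric, OF lebesgue_distr_plus(2) F])
  also have "\<dots> \<longleftrightarrow> integrable lebesgue F" by (simp only: lebesgue_distr_plus(1))
  also have "\<dots> \<longleftrightarrow> integrable (lebesgue_on \<Pi>) (\<lambda>w. indicator \<Omega> (w - of_int m) *\<^sub>R \<phi> w)"
    unfolding r\<Pi>[symmetric] by (rule integrable_restrict_space[symmetric]) simp
  finally show "integrable (lebesgue_on \<Omega>) (\<lambda>z. \<phi> (z + of_int m)) \<longleftrightarrow>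
      integrable (lebesgue_on \<Pi>) (\<lambda>w. indicator \<Omega> (w - of_int m) *\<^sub>R \<phi> w)" .
qed

lemma shift_integrable:
  fixes \<phi> :: "complex \<Rightarrow> 'b::{banach, second_countable_topology}"
  assumes \<phi>: "integrable (lebesgue_on \<Pi>) \<phi>" and \<Omega>: "\<Omega> \<in> sets lebesgue" "\<Omega> \<subseteq> \<Pi>"
  shows "integrable (lebesgue_on \<Omega>) (\<lambda>z. \<phi> (z + of_int m))"
    "integrable (lebesgue_on \<Pi>) (\<lambda>w. indicator \<Omega> (w - of_int m) *\<^sub>R \<phi> w)"
proof -
  have "{w. w - of_int m \<in> \<Omega>} \<inter> \<Pi> \<in> sets (lebesgue_on \<Pi>)"
    using shift_indicator_lebesgue[OF \<Omega>(1)] by (auto simp: sets_restrict_space)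
  then have "integrable (lebesgue_on \<Pi>) (\<lambda>w. indicator ({w. w - of_int m \<in> \<Omega>} \<inter> \<Pi>) w *\<^sub>R \<phi> w)"
    using \<phi> by (rule integrable_mult_indicator)
  then show 1: "integrable (lebesgue_on \<Pi>) (\<lambda>w. indicator \<Omega> (w - of_int m) *\<^sub>R \<phi> w)"
    by (rule Bochner_Integration.integrable_cong[THEN iffD1, rotated -1]) (auto simp: indicator_def)
  then show "integrable (lebesgue_on \<Omega>) (\<lambda>z. \<phi> (z + of_int m))"
    using shift_integral(3)[OF borel_measurable_integrable[OF \<phi>] \<Omega>] by simp
qed

text \<open>At most three integers m put w - m into an open strip of width 3, the floor of Re w and
  its two neighbours; hence the factor 3.\<close>

lemma sum_shift_integral_le:
  fixes \<phi> :: "complex \<Rightarrow> real"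
  assumes \<phi>: "integrable (lebesgue_on \<Pi>) \<phi>" "\<And>z. 0 \<le> \<phi> z" and \<Omega>: "\<Omega> \<in> sets lebesgue" "\<Omega> \<subseteq> \<Pi>"
    and strip: "\<Omega> \<subseteq> {z. -1 < Re z \<and> Re z < 2}" and F: "finite F"
  shows "(\<Sum>m\<in>F. LINT z|lebesgue_on \<Omega>. \<phi> (z + of_int m)) \<le> 3 * (LINT z|lebesgue_on \<Pi>. \<phi> z)"
proof -
  have m: "\<phi> \<in> borel_measurable (lebesgue_on \<Pi>)" using \<phi>(1) by simp
  have "(\<Sum>m\<in>F. LINT z|lebesgue_on \<Omega>. \<phi> (z + of_int m)) = (\<Sum>m\<in>F. LINT w|lebesgue_on \<Pi>. indicator \<Omega> (w - of_int m) *\<^sub>R \<phi> w)"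
    using shift_integral(2)[OF m \<Omega>] by simp
  also have "\<dots> = (LINT w|lebesgue_on \<Pi>. (\<Sum>m\<in>F. indicator \<Omega> (w - of_int m) *\<^sub>R \<phi> w))"
    by (rule Bochner_Integration.integral_sum[symmetric]) (rule shift_integrable(2)[OF \<phi>(1) \<Omega>])
  also have "\<dots> \<le> (LINT w|lebesgue_on \<Pi>. 3 * \<phi> w)"
  proof (rule integral_mono)
    show "integrable (lebesgue_on \<Pi>) (\<lambda>w. \<Sum>m\<in>F. indicator \<Omega> (w - of_int m) *\<^sub>R \<phi> w)"
      by (intro Bochner_Integration.integrable_sum shift_integrable(2)[OF \<phi>(1) \<Omega>])
    show "integrable (lebesgue_on \<Pi>) (\<lambda>w. 3 * \<phi> w)" using \<phi>(1) by simp
    fix w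
    let ?G = "{m\<in>F. w - of_int m \<in> \<Omega>}"
    have "?G \<subseteq> {\<lfloor>Re w\<rfloor> - 1, \<lfloor>Re w\<rfloor>, \<lfloor>Re w\<rfloor> + 1}"
    proof
      fix m assume "m \<in> ?G"
      then have "-1 < Re w - of_int m" "Re w - of_int m < 2" using strip by auto
      then have "m = \<lfloor>Re w\<rfloor> - 1 \<or> m = \<lfloor>Re w\<rfloor> \<or> m = \<lfloor>Re w\<rfloor> + 1" by linarith
      then show "m \<in> {\<lfloor>Re w\<rfloor> - 1, \<lfloor>Re w\<rfloor>, \<lfloor>Re w\<rfloor> + 1}" by simp
    qed
    then have "card ?G \<le> card {\<lfloor>Re w\<rfloor> - 1, \<lfloor>Re w\<rfloor>, \<lfloor>Re w\<rfloor> + 1}" by (intro card_mono) auto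
    also have "\<dots> \<le> 3" by (simp add: card_insert_if)
    finally have c: "real (card ?G) \<le> 3" by simp
    have "(\<Sum>m\<in>F. indicator \<Omega> (w - of_int m) *\<^sub>R \<phi> w) = (\<Sum>m\<in>?G. \<phi> w)"
      unfolding sum.inter_filter[OF F] by (intro sum.cong refl) (simp add: indicator_def)
    also have "\<dots> = real (card ?G) * \<phi> w" by simp
    also have "\<dots> \<le> 3 * \<phi> w" using c \<phi>(2) by (rule mult_right_mono)
    finally show "(\<Sum>m\<in>F. indicator \<Omega> (w - of_int m) *\<^sub>R \<phi> w) \<le> 3 * \<phi> w" .
  qed
  also have "\<dots> = 3 * (LINT z|lebesgue_on \<Pi>. \<phi> z)" by simp
  finally show ?thesis .
qed

lemma sum_cell_indicator:
  assumes "w \<in> \<Pi>" "Re w \<notin> \<int>" "finite F"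
  shows "(\<Sum>m\<in>F. indicator cell (w - of_int m) *\<^sub>R x) = (if \<lfloor>Re w\<rfloor> \<in> F then x else (0::'b::real_vector))"
proof -
  have "w - of_int m \<in> cell \<longleftrightarrow> m = \<lfloor>Re w\<rfloor>" for m
    using Pdom_off_lines[OF assms(1,2)] cell_floor[of "w - of_int m" m] by auto
  then have "(\<Sum>m\<in>F. indicator cell (w - of_int m) *\<^sub>R x) = (\<Sum>m\<in>F. if m = \<lfloor>Re w\<rfloor> then x else 0)"
    by (intro sum.cong) (auto simp: indicator_def)
  then show ?thesis using assms(3) by simp
qed

lemma sum_cell_tendsto:
  fixes x :: "'b::real_normed_vector"
  assumes "w \<in> \<Pi>" "Re w \<notin> \<int>"
  shows "(\<lambda>N. \<Sum>m\<in>int_ball N. indicator cell (w - of_int m) *\<^sub>R x) \<longlonglongrightarrow> x"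
proof (rule tendsto_eventually)
  have "\<forall>\<^sub>F N in sequentially. {\<lfloor>Re w\<rfloor>} \<subseteq> int_ball N" by (rule eventually_subset_int_ball) simp
  then show "\<forall>\<^sub>F N in sequentially. (\<Sum>m\<in>int_ball N. indicator cell (w - of_int m) *\<^sub>R x) = x"
    
  proof eventually_elim
    case (elim N)
    then show ?case by (subst sum_cell_indicator[OF assms]) auto
  qed
qed

text \<open>Off the null set of lines with integer real part each w lies in exactly one translated
  cell, so the partial sums of indicators are at most 1 and eventually equal to 1; dominated
  convergence applies.\<close>

lemma cell_decomposition:
  fixes \<phi> :: "complex \<Rightarrow> 'b::{banach, second_countable_topology}"
  assumes \<phi>: "integrable (lebesgue_on \<Pi>) \<phi>"
  shows "(\<lambda>N. \<Sum>m\<in>int_ball N. LINT z|lebesgue_on cell. \<phi> (z + of_int m)) \<longlonglongrightarrow> (LINT w|lebesgue_on \<Pi>. \<phi> w)"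
proof -
  have m: "\<phi> \<in> borel_measurable (lebesgue_on \<Pi>)" using \<phi> by simp
  note i = shift_integrable(2)[OF \<phi> cell_lebesgue cell_subset_Pdom]
  have off: "AE w in lebesgue_on \<Pi>. w \<in> \<Pi> \<and> Re w \<notin> \<int>"
    using AE_Pdom_off_lines AE_I2[of "lebesgue_on \<Pi>" "\<lambda>w. w \<in> \<Pi>"] by auto
  have "(\<lambda>N. LINT w|lebesgue_on \<Pi>. (\<Sum>m\<in>int_ball N. indicator cell (w - of_int m) *\<^sub>R \<phi> w)) \<longlonglongrightarrow> (LINT w|lebesgue_on \<Pi>. \<phi> w)"
  proof (rule integral_dominated_convergence[where w = "\<lambda>w. norm (\<phi> w)"])
    show "AE w in lebesgue_on \<Pi>. (\<lambda>N. \<Sum>m\<in>int_ball N. indicator cell (w - of_int m) *\<^sub>R \<phi> w) \<longlonglongrightarrow> \<phi> w"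
      using off by eventually_elim (rule sum_cell_tendsto; simp)
    show "AE w in lebesgue_on \<Pi>. norm (\<Sum>m\<in>int_ball N. indicator cell (w - of_int m) *\<^sub>R \<phi> w) \<le> norm (\<phi> w)" for N
      using off
    proof eventually_elim
      case (elim w)
      then show ?case by (subst sum_cell_indicator) auto
    qed
    show "(\<lambda>w. \<Sum>m\<in>int_ball N. indicator cell (w - of_int m) *\<^sub>R \<phi> w) \<in> borel_measurable (lebesgue_on \<Pi>)" for N
      using i by (intro borel_measurable_integrable Bochner_Integration.integrable_sum)
  qed (use \<phi> in auto)
  also have "(\<lambda>N. LINT w|lebesgue_on \<Pi>. (\<Sum>m\<in>int_ball N. indicator cell (w - of_int m) *\<^sub>R \<phi> w))
      = (\<lambda>N. \<Sum>m\<in>int_ball N. LINT z|lebesgue_on cell. \<phi> (z + of_int m))"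
    using shift_integral(2)[OF m cell_lebesgue cell_subset_Pdom] i
    by (simp only: Bochner_Integration.integral_sum)
  finally show ?thesis .
qed

lemma integrable_of_cells:
  fixes \<phi> :: "complex \<Rightarrow> real"
  assumes \<phi>: "\<phi> \<in> borel_measurable (lebesgue_on \<Pi>)" "\<And>z. 0 \<le> \<phi> z"
    and int: "\<And>m. integrable (lebesgue_on cell) (\<lambda>z. \<phi> (z + of_int m))"
    and B: "\<And>N. (\<Sum>m\<in>int_ball N. LINT z|lebesgue_on cell. \<phi> (z + of_int m)) \<le> B"
  shows "integrable (lebesgue_on \<Pi>) \<phi>"
proof (rule fatou_integral_bound(1))
  have i: "integrable (lebesgue_on \<Pi>) (\<lambda>w. indicator cell (w - of_int m) *\<^sub>R \<phi> w)" for m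
    using shift_integral(3)[OF \<phi>(1) cell_lebesgue cell_subset_Pdom] int by blast
  show "integrable (lebesgue_on \<Pi>) (\<lambda>w. \<Sum>m\<in>int_ball N. indicator cell (w - of_int m) *\<^sub>R \<phi> w)" for N
    using i by (rule Bochner_Integration.integrable_sum)
  show "0 \<le> (\<Sum>m\<in>int_ball N. indicator cell (w - of_int m) *\<^sub>R \<phi> w)" for N w
    using \<phi>(2) by (intro sum_nonneg) simp
  have off: "AE w in lebesgue_on \<Pi>. w \<in> \<Pi> \<and> Re w \<notin> \<int>"
    using AE_Pdom_off_lines AE_I2[of "lebesgue_on \<Pi>" "\<lambda>w. w \<in> \<Pi>"] by auto
  then show "AE w in lebesgue_on \<Pi>. (\<lambda>N. \<Sum>m\<in>int_ball N. indicator cell (w - of_int m) *\<^sub>R \<phi> w) \<longlonglongrightarrow> \<phi> w"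
    by eventually_elim (rule sum_cell_tendsto; simp)
  have "(LINT w|lebesgue_on \<Pi>. (\<Sum>m\<in>int_ball N. indicator cell (w - of_int m) *\<^sub>R \<phi> w))
      = (\<Sum>m\<in>int_ball N. LINT z|lebesgue_on cell. \<phi> (z + of_int m))" for N
    using shift_integral(2)[OF \<phi>(1) cell_lebesgue cell_subset_Pdom] i
    by (simp only: Bochner_Integration.integral_sum)
  then show "\<forall>\<^sub>F N in sequentially. (LINT w|lebesgue_on \<Pi>. (\<Sum>m\<in>int_ball N. indicator cell (w - of_int m) *\<^sub>R \<phi> w)) \<le> B"
    using B by simp
qed (use \<phi> in auto)

end

section \<open>The Floquet transform of Bergman functions\<close>

lemma sum_int_ball_shift:
  fixes u :: "int \<Rightarrow> 'a::ab_group_add"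
  shows "(\<Sum>m\<in>int_ball N. u (m + 1)) = (\<Sum>m\<in>int_ball N. u m) + u (int N + 1) - u (- int N)"
proof (induction N)
  case (Suc N)
  define l where "l = - int (Suc N)"
  define u' where "u' = int (Suc N)"
  have *: "{l..u'} = insert u' (insert l (int_ball N))" by (auto simp: l_def u'_def)
  have "(\<Sum>m\<in>{l..u'}. v m) = v u' + (v l + (\<Sum>m\<in>int_ball N. v m))" for v :: "int \<Rightarrow> 'a"
    unfolding * by (subst sum.insert, simp, simp add: l_def u'_def, subst sum.insert) (auto simp: l_def)
  note sums = this[of u] this[of "\<lambda>m. u (m + 1)"]
  have lu: "l + 1 = - int N" "int N + 1 = u'" by (auto simp: l_def u'_def)
  show ?case
    unfolding l_def[symmetric] unfolding u'_def[symmetric] sums lu Suc.IH by simp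
qed simp

text \<open>Reindexing m to m + 1 turns translation by 1 into the factor exp(i \<eta>), up to the
  two terms at the ends of the symmetric range. Quasi-periodicity of the Floquet transform amounts
  to the vanishing of this remainder in the limit.\<close>

lemma trig_sum_shift:
  fixes h :: "complex \<Rightarrow> complex"
  shows "trig_sum (\<lambda>m z. h (z + of_int m)) (int_ball N) \<eta> (z + 1) = exp (\<i> * \<eta>) * trig_sum (\<lambda>m z. h (z + of_int m)) (int_ball N) \<eta> z
     + 1 / sqrt (2 * pi) * exp (\<i> * \<eta>) * (exp (- \<i> * \<eta> * of_int (int N + 1)) * h (z + of_int (int N + 1))
         - exp (- \<i> * \<eta> * of_int (- int N)) * h (z + of_int (- int N)))"
proof -
  let ?u = "\<lambda>m. exp (- \<i> * \<eta> * of_int m) * h (z + of_int m)"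
  have "(\<Sum>m\<in>int_ball N. exp (- \<i> * \<eta> * of_int m) * h (z + 1 + of_int m)) = (\<Sum>m\<in>int_ball N. exp (\<i> * \<eta>) * ?u (m + 1))"
  proof (intro sum.cong refl)
    fix m :: int
    have "exp (- \<i> * \<eta> * of_int m) = exp (\<i> * \<eta>) * exp (- \<i> * \<eta> * of_int (m + 1))"
      unfolding exp_add[symmetric] by (simp add: algebra_simps)
    then show "exp (- \<i> * \<eta> * of_int m) * h (z + 1 + of_int m) = exp (\<i> * \<eta>) * ?u (m + 1)"
      by (simp add: algebra_simps)
  qed
  also have "\<dots> = exp (\<i> * \<eta>) * ((\<Sum>m\<in>int_ball N. ?u m) + ?u (int N + 1) - ?u (- int N))"
    unfolding sum_distrib_left[symmetric] sum_int_ball_shift[of ?u] ..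
  finally show ?thesis unfolding trig_sum_def by (simp only:) (simp only: algebra_simps)
qed

lemma filter_outside_finite:
  assumes "inj (k :: nat \<Rightarrow> 'a)" "finite F"
  shows "\<forall>\<^sub>F n in sequentially. k n \<notin> F"
proof -
  have "finite (k -` F)" using assms by (intro finite_vimageI)
  then have "\<forall>\<^sub>F n in sequentially. n \<notin> k -` F"
    using eventually_cofinite[of "\<lambda>n. n \<notin> k -` F"] by (simp add: cofinite_eq_sequentially vimage_def)
  then show ?thesis by simp
qed

context periodic_cell
begin

abbreviation shifts :: "(complex \<Rightarrow> complex) \<Rightarrow> int \<Rightarrow> complex \<Rightarrow> complex" where
  "shifts f \<equiv> \<lambda>m z. f (z + of_int m)"

text \<open>One unit is added on either side, so that the lines carrying the vertical sides of the
  cell run through the interior.\<close>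

definition cell3 :: "complex set" where
  "cell3 = \<Pi> \<inter> {z. -1 < Re z \<and> Re z < 2}"

lemma open_cell3: "open cell3"
  unfolding cell3_def
  by (intro open_Int open_Pdom open_Collect_conj open_Collect_less continuous_intros)

lemma cell3_subset: "cell3 \<subseteq> \<Pi>" "cell3 \<subseteq> {z. -1 < Re z \<and> Re z < 2}"
  by (auto simp: cell3_def)

lemma cell_subset_cell3: "cell \<subseteq> cell3"
  using cell_subset_Pdom cell_strip by (auto simp: cell3_def)

lemma cell_subset_strip: "cell \<subseteq> {z. -1 < Re z \<and> Re z < 2}"
  using cell_strip by auto

lemma cell3_lebesgue [simp]: "cell3 \<in> sets lebesgue"
  using open_cell3 by simp

lemma shifts_L2:
  assumes "f \<in> L2 \<Pi>" "\<Omega> \<in> sets lebesgue" "\<Omega> \<subseteq> \<Pi>"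
  shows "shifts f m \<in> L2 \<Omega>"
  using shift_integral(1)[OF L2_measurable[OF assms(1)] assms(2,3)]
    shift_integrable(1)[OF L2_square_integrable[OF assms(1)] assms(2,3)]
  by (simp add: L2_def)

lemma shifts_L2_cell: "f \<in> L2 \<Pi> \<Longrightarrow> shifts f m \<in> L2 cell"
  by (intro shifts_L2) (simp_all add: cell_subset_Pdom)

lemma shifts_A2:
  assumes "h \<in> A2 \<Pi>" "open \<Omega>" "\<Omega> \<subseteq> \<Pi>"
  shows "shifts h m \<in> A2 \<Omega>"
proof -
  have "(\<lambda>z. z + of_int m) ` \<Omega> \<subseteq> \<Pi>" using assms(3) Pdom_shift by blast
  then have "h analytic_on (\<lambda>z. z + of_int m) ` \<Omega>" using A2_analytic[OF assms(1)] analytic_on_subset by blast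
  then have "(h \<circ> (\<lambda>z. z + of_int m)) analytic_on \<Omega>"
    by (intro analytic_on_compose analytic_intros)
  then show ?thesis using shifts_L2[OF A2_L2[OF assms(1)] _ assms(3)] assms(2) by (simp add: A2_def o_def)
qed

lemma shifts_sum_bound:
  assumes "f \<in> L2 \<Pi>" "\<Omega> \<in> sets lebesgue" "\<Omega> \<subseteq> \<Pi>" "\<Omega> \<subseteq> {z. -1 < Re z \<and> Re z < 2}" "finite F"
  shows "(\<Sum>m\<in>F. (L2_norm \<Omega> (shifts f m))\<^sup>2) \<le> 3 * (L2_norm \<Pi> f)\<^sup>2"
  unfolding L2_norm_power2
  using sum_shift_integral_le[OF L2_square_integrable[OF assms(1)] _ assms(2-5)] by simp

text \<open>Makes the choice in \<open>floquet\<close> effective: the squared norms of the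
  translates have bounded finite sums, which is what the abstract limit theorem asks for.\<close>

lemma floquet_spec:
  assumes f: "f \<in> L2 \<Pi>"
  shows "floquet cell f \<in> bochner_L2 cell"
    "((\<lambda>S. bochner_L2_norm cell (\<lambda>\<eta> z. trig_sum (shifts f) S \<eta> z - floquet cell f \<eta> z)) \<longlongrightarrow> 0) (finite_subsets_at_top UNIV)"
proof -
  have "\<exists>g. g \<in> bochner_L2 cell \<and>
    ((\<lambda>S. bochner_L2_norm cell (\<lambda>\<eta> z. trig_sum (shifts f) S \<eta> z - g \<eta> z)) \<longlongrightarrow> 0) (finite_subsets_at_top UNIV)"
    using trig_series_bochner_limit[of "shifts f" cell "3 * (L2_norm \<Pi> f)\<^sup>2", OF shifts_L2_cell[OF f]
      shifts_sum_bound[OF f cell_lebesgue cell_subset_Pdom cell_subset_strip]] by blast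
  from someI_ex[OF this]
  show "floquet cell f \<in> bochner_L2 cell"
    "((\<lambda>S. bochner_L2_norm cell (\<lambda>\<eta> z. trig_sum (shifts f) S \<eta> z - floquet cell f \<eta> z)) \<longlongrightarrow> 0) (finite_subsets_at_top UNIV)"
    unfolding floquet_def trig_sum_def by blast+
qed

lemma floquet_L2: "f \<in> L2 \<Pi> \<Longrightarrow> \<eta> \<in> {-pi..pi} \<Longrightarrow> floquet cell f \<eta> \<in> L2 cell"
  using floquet_spec(1)[of f] by (simp add: bochner_L2_def)

lemma floquet_integrals:
  assumes f: "f \<in> L2 \<Pi>"
  shows "(\<lambda>N. LINT \<eta>|lebesgue_on {-pi..pi}. (L2_norm cell (\<lambda>z. trig_sum (shifts f) (int_ball N) \<eta> z - floquet cell f \<eta> z))\<^sup>2) \<longlonglongrightarrow> 0"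
    "(\<lambda>N. LINT \<eta>|lebesgue_on {-pi..pi}. L2_norm cell (\<lambda>z. trig_sum (shifts f) (int_ball N) \<eta> z - floquet cell f \<eta> z)) \<longlonglongrightarrow> 0"
    "integrable (lebesgue_on {-pi..pi}) (\<lambda>\<eta>. L2_norm cell (\<lambda>z. trig_sum (shifts f) (int_ball N) \<eta> z - floquet cell f \<eta> z))"
  by (rule bochner_limit_integrals[where \<phi> = "shifts f", OF shifts_L2_cell[OF f] floquet_spec[OF f]])+

lemma floquet_subseq:
  assumes f: "f \<in> L2 \<Pi>" and r0: "strict_mono r0"
  obtains r :: "nat \<Rightarrow> nat" where "strict_mono r"
    "AE \<eta> in lebesgue_on {-pi..pi}. (\<lambda>n. L2_norm cell (\<lambda>z. trig_sum (shifts f) (int_ball (r0 (r n))) \<eta> z - floquet cell f \<eta> z)) \<longlonglongrightarrow> 0"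
  by (rule bochner_limit_subseq[where \<phi> = "shifts f", OF shifts_L2_cell[OF f] floquet_spec[OF f] r0])

text \<open>Square-summability over \<open>cell3\<close> forces the norms of distinct translates to
  0, and the Bergman inequality passes this on to values at a point. Applied with two injections it
  removes both end terms of a symmetric sum.\<close>

lemma shifts_tendsto_0:
  fixes h :: "complex \<Rightarrow> complex"
  assumes h: "h \<in> A2 \<Pi>" and z: "z \<in> cell3" and k: "inj (k :: nat \<Rightarrow> int)"
  shows "(\<lambda>n. h (z + of_int (k n))) \<longlonglongrightarrow> 0"
proof -
  let ?a = "\<lambda>m. L2_norm cell3 (shifts h m)"
  obtain r C where C: "r > 0" "C \<ge> 0" "\<And>f w. f \<in> A2 cell3 \<Longrightarrow> w \<in> cball z r \<Longrightarrow> norm (f w) \<le> C * L2_norm cell3 f"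
    using A2_pointwise_bound[OF open_cell3 z] by metis
  have bound: "norm (h (z + of_int m)) \<le> C * ?a m" for m
    using C(3)[OF shifts_A2[OF h open_cell3 cell3_subset(1)], of z m] C(1) by simp
  have "(\<lambda>n. ?a (k n)) \<longlonglongrightarrow> 0"
  proof (rule tendstoI)
    fix e :: real assume e: "e > 0"
    then have "e\<^sup>2 > 0" by simp
    obtain F0 where F0: "finite F0" "\<And>F. finite F \<Longrightarrow> F \<inter> F0 = {} \<Longrightarrow> (\<Sum>m\<in>F. (?a m)\<^sup>2) < e\<^sup>2"
      using small_tail_sum[OF _ _ \<open>e\<^sup>2 > 0\<close>, of "\<lambda>m. (?a m)\<^sup>2" "3 * (L2_norm \<Pi> h)\<^sup>2"]
        shifts_sum_bound[OF A2_L2[OF h] cell3_lebesgue cell3_subset] by (metis zero_le_power2)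
    show "\<forall>\<^sub>F n in sequentially. dist (?a (k n)) 0 < e"
      using filter_outside_finite[OF k F0(1)]
    proof eventually_elim
      case (elim n)
      then have "(?a (k n))\<^sup>2 < e\<^sup>2" using F0(2)[of "{k n}"] by simp
      then have "?a (k n) < e" using e by (simp add: power_less_imp_less_base)
      then show ?case by (simp add: L2_norm_nonneg)
    qed
  qed
  from tendsto_mult_left[OF this, of C] have "(\<lambda>n. C * ?a (k n)) \<longlonglongrightarrow> 0" by simp
  then show ?thesis by (rule Lim_null_comparison[rotated]) (use bound in auto)
qed

text \<open>The limit on \<open>cell3\<close> and the transform on \<open>cell\<close> are chosen
  independently and are compared as limits of the same partial sums. The former provides the
  analytic extension past the closed cell that membership in \<open>A2_ext\<close> demands.\<close>

lemma floquet_A2_ext: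
  fixes h :: "complex \<Rightarrow> complex"
  assumes h: "h \<in> A2 \<Pi>"
  shows "AE \<eta> in lebesgue_on {-pi..pi}. \<exists>p\<in>A2_ext a b cell \<eta>. AE z in lebesgue_on cell. floquet cell h \<eta> z = p z"
proof -
  let ?\<phi> = "shifts h"
  have \<phi>3A: "?\<phi> m \<in> A2 cell3" for m by (rule shifts_A2[OF h open_cell3 cell3_subset(1)])
  then have \<phi>3: "?\<phi> m \<in> L2 cell3" for m by (rule A2_L2)
  have hL: "h \<in> L2 \<Pi>" using h by (rule A2_L2)
  obtain g where g: "g \<in> bochner_L2 cell3"
    "((\<lambda>S. bochner_L2_norm cell3 (\<lambda>\<eta> z. trig_sum ?\<phi> S \<eta> z - g \<eta> z)) \<longlongrightarrow> 0) (finite_subsets_at_top UNIV)"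
    using trig_series_bochner_limit[of ?\<phi> cell3 "3 * (L2_norm \<Pi> h)\<^sup>2", OF \<phi>3
      shifts_sum_bound[OF hL cell3_lebesgue cell3_subset]] by blast
  obtain r1 where r1: "strict_mono r1"
    "AE \<eta> in lebesgue_on {-pi..pi}. (\<lambda>n. L2_norm cell3 (\<lambda>z. trig_sum ?\<phi> (int_ball (id (r1 n))) \<eta> z - g \<eta> z)) \<longlonglongrightarrow> 0"
    using bochner_limit_subseq[where \<phi> = ?\<phi>, OF \<phi>3 g strict_mono_id] by blast
  \<comment> \<open>Extracted inside \<open>r1\<close>, so that along the composed indices both
    limits hold.\<close>
  obtain r2 where r2: "strict_mono r2"
    "AE \<eta> in lebesgue_on {-pi..pi}. (\<lambda>n. L2_norm cell (\<lambda>z. trig_sum ?\<phi> (int_ball (r1 (r2 n))) \<eta> z - floquet cell h \<eta> z)) \<longlonglongrightarrow> 0"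
    using floquet_subseq[OF hL r1(1)] by blast
  have "AE \<eta> in lebesgue_on {-pi..pi}. \<eta> \<in> {-pi..pi}" by (rule AE_I2) simp
  then show ?thesis using r1(2) r2(2)
  proof eventually_elim
    case (elim \<eta>)
    let ?N = "\<lambda>n. r1 (r2 n)"
    let ?T = "\<lambda>n. trig_sum ?\<phi> (int_ball (?N n)) \<eta>"
    have N: "strict_mono ?N" using r1(1) r2(1) by (simp add: strict_mono_def)
    have TA: "?T n \<in> A2 cell3" for n using \<phi>3A by (rule trig_sum_A2)
    have g\<eta>: "g \<eta> \<in> L2 cell3" using g(1) elim(1) by (simp add: bochner_L2_def)
    have lim3: "(\<lambda>n. L2_norm cell3 (\<lambda>z. ?T n z - g \<eta> z)) \<longlonglongrightarrow> 0"
      using LIMSEQ_subseq_LIMSEQ[OF elim(2) r2(1)] by (simp add: o_def)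
    obtain G where G: "G \<in> A2 cell3" "AE z in lebesgue_on cell3. G z = g \<eta> z" "\<And>z. z \<in> cell3 \<Longrightarrow> (\<lambda>n. ?T n z) \<longlonglongrightarrow> G z"
      using A2_limit[OF open_cell3 TA g\<eta> lim3] by blast
    have "L2_norm cell3 (\<lambda>z. ?T n z - g \<eta> z) = L2_norm cell3 (\<lambda>z. ?T n z - G z)" for n
      by (rule L2_norm_cong_AE) (use G g\<eta> A2_L2 TA in \<open>auto intro!: L2_diff\<close>)
    with lim3 have lim3: "(\<lambda>n. L2_norm cell3 (\<lambda>z. ?T n z - G z)) \<longlonglongrightarrow> 0" by simp
    have GA: "G \<in> A2 cell"
      using L2_subset(1)[OF A2_L2[OF G(1)] cell_subset_cell3] A2_analytic[OF G(1)] cell_subset_cell3 analytic_on_subset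
      by (auto simp: A2_def)
    have fl: "floquet cell h \<eta> \<in> L2 cell" using floquet_L2[OF hL elim(1)] .
    have Tc: "?T n \<in> L2 cell" for n using L2_subset(1)[OF A2_L2[OF TA] cell_subset_cell3] by simp
    have le: "L2_norm cell (\<lambda>z. G z - floquet cell h \<eta> z)
        \<le> L2_norm cell3 (\<lambda>z. ?T n z - G z) + L2_norm cell (\<lambda>z. ?T n z - floquet cell h \<eta> z)" for n
      using L2_norm_diff_triangle[OF A2_L2[OF GA] Tc[of n] fl]
        L2_norm_minus_commute[of cell G "?T n"]
        L2_subset(2)[OF L2_diff[OF A2_L2[OF TA[of n]] A2_L2[OF G(1)]] cell_subset_cell3 cell3_lebesgue cell_lebesgue] by linarith
    have "L2_norm cell (\<lambda>z. G z - floquet cell h \<eta> z) \<le> 0"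
      using tendsto_add[OF lim3 elim(3)] by (intro tendsto_lowerbound[where F = sequentially]) (use le in auto)
    then have "L2_norm cell (\<lambda>z. G z - floquet cell h \<eta> z) = 0" by (simp add: antisym L2_norm_nonneg)
    then have AEeq: "AE z in lebesgue_on cell. floquet cell h \<eta> z = G z"
      using L2_norm_eq_0_iff[OF L2_diff[OF A2_L2[OF GA] fl]] by (auto elim: eventually_mono)
    \<comment> \<open>Outside \<open>cell3\<close> the value 0 satisfies the boundary relation
      trivially, so it holds for every y, whichever points of the two lines belong to \<Pi>.\<close>
    define F where "F = (\<lambda>z. if z \<in> cell3 then G z else 0)"
    have "F holomorphic_on cell3"
      using holomorphic_transform[of G cell3 F] A2_analytic[OF G(1)] analytic_imp_holomorphic by (auto simp: F_def)
    then have Fa: "F analytic_on cell3" using open_cell3 by (simp add: analytic_on_open)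
    have period: "G (z + 1) = exp (\<i> * \<eta>) * G z" if z: "z \<in> cell3" "z + 1 \<in> cell3" for z
    proof -
      let ?R = "\<lambda>N::nat. 1 / sqrt (2 * pi) * exp (\<i> * \<eta>) * (exp (- \<i> * \<eta> * of_int (int N + 1)) * h (z + of_int (int N + 1))
         - exp (- \<i> * \<eta> * of_int (- int N)) * h (z + of_int (- int N)))"
      have b: "Bfun (\<lambda>n. exp (- \<i> * complex_of_real \<eta> * of_int (k n))) sequentially" for k :: "nat \<Rightarrow> int"
      proof (rule BfunI)
        have "norm (exp (- \<i> * complex_of_real \<eta> * of_int (k n))) = 1" for n
          using norm_exp_i_times[of "- \<eta> * of_int (k n)"] by simp
        then show "\<forall>\<^sub>F n in sequentially. norm (exp (- \<i> * complex_of_real \<eta> * of_int (k n))) \<le> 1" by simp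
      qed
      have z0: "(\<lambda>n. exp (- \<i> * complex_of_real \<eta> * of_int (k n)) * h (z + of_int (k n))) \<longlonglongrightarrow> 0" if "inj k" for k :: "nat \<Rightarrow> int"
        using bounded_bilinear.Bfun_prod_Zfun[OF bounded_bilinear_mult b[of k]] shifts_tendsto_0[OF h z(1) that]
        by (simp add: tendsto_Zfun_iff)
      have "(\<lambda>N. exp (- \<i> * \<eta> * of_int (int N + 1)) * h (z + of_int (int N + 1))
         - exp (- \<i> * \<eta> * of_int (- int N)) * h (z + of_int (- int N))) \<longlonglongrightarrow> 0 - 0"
        by (intro tendsto_diff z0) (auto simp: inj_def)
      from tendsto_mult_left[OF this, of "1 / sqrt (2 * pi) * exp (\<i> * \<eta>)"] have "?R \<longlonglongrightarrow> 0" by simp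
      from LIMSEQ_subseq_LIMSEQ[OF this N] have R0: "(\<lambda>n. ?R (?N n)) \<longlonglongrightarrow> 0" by (simp only: o_def)
      have "(\<lambda>n. exp (\<i> * \<eta>) * ?T n z + ?R (?N n)) \<longlonglongrightarrow> exp (\<i> * \<eta>) * G z + 0"
        by (intro tendsto_add tendsto_mult_left G(3) z R0)
      then have "(\<lambda>n. ?T n (z + 1)) \<longlonglongrightarrow> exp (\<i> * \<eta>) * G z"
        unfolding trig_sum_shift by simp
      with G(3)[OF z(2)] show ?thesis by (rule LIMSEQ_unique)
    qed
    have line: "F (Complex 1 y) = exp (\<i> * \<eta>) * F (Complex 0 y)" for y
    proof -
      have c: "Complex 1 y = Complex 0 y + 1" by (simp add: complex_eq_iff)
      have "Complex 1 y \<in> cell3 \<longleftrightarrow> Complex 0 y \<in> cell3"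
        using Pdom_shift[of "Complex 0 y" 1] by (simp add: cell3_def c[symmetric])
      then show ?thesis using period[of "Complex 0 y"] by (auto simp: F_def c[symmetric])
    qed
    have "closure cell \<inter> \<Pi> \<subseteq> cell3"
    proof
      fix z assume "z \<in> closure cell \<inter> \<Pi>"
      then show "z \<in> cell3" using closure_cell_strip[of z] by (auto simp: cell3_def)
    qed
    then have "G \<in> A2_ext a b cell \<eta>"
      unfolding A2_ext_def using GA open_cell3 cell3_subset(1) Fa cell_subset_cell3 line
      by (auto intro!: exI[of _ cell3] exI[of _ F] simp: F_def)
    with AEeq show ?case by blast
  qed
qed

text \<open>Inversion at every point of the cell and not just almost everywhere. The Fourier
  coefficient of a partial sum at w is exact as soon as the sum contains the index m, and the
  Bergman inequality bounds the error at w by C times the fibre norm of the error, whose integral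
  over \<eta> tends to 0. Any family \<open>p\<close> of analytic representatives will do, so
  projections and kernels can be inserted later.\<close>

lemma floquet_A2_inversion:
  fixes h :: "complex \<Rightarrow> complex"
  assumes h: "h \<in> A2 \<Pi>" and w: "w \<in> cell"
    and p: "AE \<eta> in lebesgue_on {-pi..pi}. p \<eta> analytic_on cell \<and> (AE z in lebesgue_on cell. floquet cell h \<eta> z = p \<eta> z)"
  shows "integrable (lebesgue_on {-pi..pi}) (\<lambda>\<eta>. exp (\<i> * of_real \<eta> * of_int m) * p \<eta> w)"
    "(LINT \<eta>|lebesgue_on {-pi..pi}. exp (\<i> * of_real \<eta> * of_int m) * p \<eta> w) = sqrt (2 * pi) * h (w + of_int m)"
proof -
  let ?M = "lebesgue_on {-pi..pi}"
  let ?\<phi> = "shifts h"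
  let ?e = "\<lambda>\<eta> k. exp (\<i> * of_real \<eta> * of_int k) :: complex"
  have hL: "h \<in> L2 \<Pi>" using h by (rule A2_L2)
  let ?x = "\<lambda>N \<eta>. trig_sum ?\<phi> (int_ball N) \<eta> w"
  let ?n = "\<lambda>N \<eta>. L2_norm cell (\<lambda>z. trig_sum ?\<phi> (int_ball N) \<eta> z - floquet cell h \<eta> z)"
  have \<phi>A: "?\<phi> m \<in> A2 cell" for m by (rule shifts_A2[OF h open_cell cell_subset_Pdom])
  obtain r C where C: "r > 0" "C \<ge> 0" "\<And>f z. f \<in> A2 cell \<Longrightarrow> z \<in> cball w r \<Longrightarrow> norm (f z) \<le> C * L2_norm cell f"
    using A2_pointwise_bound[OF open_cell w] by metis
  have "AE \<eta> in ?M. \<eta> \<in> {-pi..pi}" by (rule AE_I2) simp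
  then have bound: "AE \<eta> in ?M. \<forall>N. norm (?x N \<eta> - p \<eta> w) \<le> C * ?n N \<eta>"
    using p
  proof eventually_elim
    case (elim \<eta>)
    have fl: "floquet cell h \<eta> \<in> L2 cell" using floquet_L2[OF hL elim(1)] .
    have pA: "p \<eta> \<in> A2 cell"
      using L2_memI_AE[OF fl] analytic_on_open_measurable[OF open_cell] elim(2) by (simp add: A2_def)
    have "norm (?x N \<eta> - p \<eta> w) \<le> C * ?n N \<eta>" for N
    proof -
      have T: "trig_sum ?\<phi> (int_ball N) \<eta> \<in> A2 cell" using \<phi>A by (rule trig_sum_A2)
      have "norm (?x N \<eta> - p \<eta> w) \<le> C * L2_norm cell (\<lambda>z. trig_sum ?\<phi> (int_ball N) \<eta> z - p \<eta> z)"
        using C(3)[OF A2_diff[OF T pA], of w] C(1) by simp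
      also have "L2_norm cell (\<lambda>z. trig_sum ?\<phi> (int_ball N) \<eta> z - p \<eta> z) = ?n N \<eta>"
        by (rule L2_norm_cong_AE) (use T pA fl A2_L2 elim(2) in \<open>auto intro!: L2_diff elim: eventually_mono\<close>)
      finally show ?thesis .
    qed
    then show ?case by blast
  qed
  have xc: "continuous_on A (\<lambda>\<eta>. ?x N \<eta>)" for N A
    unfolding trig_sum_def by (intro continuous_intros)
  have xi: "integrable ?M (?x N)" for N by (rule continuous_integrable_lebesgue_on[OF xc])
  note ni = floquet_integrals(3)[OF hL]
  obtain r where r: "strict_mono r" "AE \<eta> in ?M. (\<lambda>k. ?n (id (r k)) \<eta>) \<longlonglongrightarrow> 0"
    using floquet_subseq[OF hL strict_mono_id] by blast
  \<comment> \<open>A conclusion, not an assumption on \<open>p\<close>: the values at w are an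
    almost everywhere limit of functions continuous in \<eta>.\<close>
  have pm: "(\<lambda>\<eta>. p \<eta> w) \<in> borel_measurable ?M"
  proof (rule borel_measurable_AE_LIMSEQ)
    show "AE \<eta> in ?M. (\<lambda>k. ?x (r k) \<eta>) \<longlonglongrightarrow> p \<eta> w"
      using r(2) bound
    proof eventually_elim
      case (elim \<eta>)
      have "(\<lambda>k. C * ?n (r k) \<eta>) \<longlonglongrightarrow> 0" using tendsto_mult_left[OF elim(1), of C] by simp
      then have "(\<lambda>k. ?x (r k) \<eta> - p \<eta> w) \<longlonglongrightarrow> 0"
        by (rule Lim_null_comparison[rotated]) (use elim(2) in auto)
      then show ?case by (simp add: LIM_zero_iff)
    qed
  qed (use xi in auto)
  have dm: "(\<lambda>\<eta>. ?e \<eta> m * (?x N \<eta> - p \<eta> w)) \<in> borel_measurable ?M" for N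
  proof -
    have "(\<lambda>\<eta>. ?e \<eta> m) \<in> borel_measurable ?M"
      by (intro continuous_imp_measurable_on_sets_lebesgue continuous_intros) simp
    then show ?thesis using pm xi[of N] by simp
  qed
  have ne: "norm (?e \<eta> m) = 1" for \<eta> using norm_exp_i_times[of "\<eta> * of_int m"] by (simp add: mult.assoc)
  have dle: "AE \<eta> in ?M. norm (?e \<eta> m * (?x N \<eta> - p \<eta> w)) \<le> C * ?n N \<eta>" for N
    using bound by eventually_elim (simp add: norm_mult ne)
  have di: "integrable ?M (\<lambda>\<eta>. ?e \<eta> m * (?x N \<eta> - p \<eta> w))" for N
  proof (rule Bochner_Integration.integrable_bound[OF _ dm])
    show "integrable ?M (\<lambda>\<eta>. C * ?n N \<eta>)" using ni by simp
    show "AE \<eta> in ?M. norm (?e \<eta> m * (?x N \<eta> - p \<eta> w)) \<le> norm (C * ?n N \<eta>)"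
      using dle[of N] by eventually_elim simp
  qed
  have exi: "integrable ?M (\<lambda>\<eta>. ?e \<eta> m * ?x N \<eta>)" for N
    by (intro continuous_integrable_lebesgue_on continuous_intros xc)
  have eq: "(\<lambda>\<eta>. ?e \<eta> m * p \<eta> w) = (\<lambda>\<eta>. ?e \<eta> m * ?x N \<eta> - ?e \<eta> m * (?x N \<eta> - p \<eta> w))" for N
    by (simp add: algebra_simps)
  show "integrable ?M (\<lambda>\<eta>. ?e \<eta> m * p \<eta> w)"
    unfolding eq[of 0] by (intro Bochner_Integration.integrable_diff exi di)
  have main: "(LINT \<eta>|?M. ?e \<eta> m * ?x N \<eta>) = sqrt (2 * pi) * h (w + of_int m)" if "nat \<bar>m\<bar> \<le> N" for N
  proof -
    have mN: "m \<in> int_ball N" using that by auto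
    have expand: "(\<lambda>\<eta>. ?e \<eta> m * ?x N \<eta>) = (\<lambda>\<eta>. \<Sum>k\<in>int_ball N. (1 / sqrt (2 * pi) * h (w + of_int k)) * ?e \<eta> (m - k))"
      unfolding trig_sum_def sum_distrib_left
      by (intro ext sum.cong refl) (simp add: algebra_simps flip: exp_add)
    have "(LINT \<eta>|?M. (\<Sum>k\<in>int_ball N. (1 / sqrt (2 * pi) * h (w + of_int k)) * ?e \<eta> (m - k)))
        = (\<Sum>k\<in>int_ball N. (1 / sqrt (2 * pi) * h (w + of_int k)) * (LINT \<eta>|?M. ?e \<eta> (m - k)))"
    proof -
      have "integrable ?M (\<lambda>\<eta>. c * ?e \<eta> k)" for c k
        by (intro continuous_integrable_lebesgue_on continuous_intros)
      then show ?thesis by (simp only: Bochner_Integration.integral_sum integral_mult_right_zero)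
    qed
    also have "\<dots> = (\<Sum>k\<in>int_ball N. if k = m then (1 / sqrt (2 * pi) * h (w + of_int k)) * (2 * of_real pi) else 0)"
      by (intro sum.cong refl, subst integral_exp_int) auto
    also have "\<dots> = (1 / sqrt (2 * pi) * h (w + of_int m)) * (2 * of_real pi)" using mN by simp
    also have "\<dots> = complex_of_real (1 / sqrt (2 * pi) * (2 * pi)) * h (w + of_int m)" by simp
    also have "1 / sqrt (2 * pi) * (2 * pi) = sqrt (2 * pi)" by (simp add: real_div_sqrt)
    finally show ?thesis unfolding expand .
  qed
  let ?I = "LINT \<eta>|?M. ?e \<eta> m * p \<eta> w"
  have "?I = (LINT \<eta>|?M. ?e \<eta> m * ?x N \<eta>) - (LINT \<eta>|?M. ?e \<eta> m * (?x N \<eta> - p \<eta> w))" for N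
    unfolding eq[of N] by (rule Bochner_Integration.integral_diff[OF exi di])
  then have I: "norm (sqrt (2 * pi) * h (w + of_int m) - ?I) \<le> C * (LINT \<eta>|?M. ?n N \<eta>)" if "nat \<bar>m\<bar> \<le> N" for N
  proof -
    have "norm (sqrt (2 * pi) * h (w + of_int m) - ?I) = norm (LINT \<eta>|?M. ?e \<eta> m * (?x N \<eta> - p \<eta> w))"
      using \<open>\<And>N. ?I = (LINT \<eta>|?M. ?e \<eta> m * ?x N \<eta>) - (LINT \<eta>|?M. ?e \<eta> m * (?x N \<eta> - p \<eta> w))\<close>[of N] main[OF that] by simp
    also have "\<dots> \<le> (LINT \<eta>|?M. norm (?e \<eta> m * (?x N \<eta> - p \<eta> w)))" by (rule integral_norm_bound)
    also have "\<dots> \<le> (LINT \<eta>|?M. C * ?n N \<eta>)"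
      using di dle ni by (intro integral_mono_AE integrable_norm) auto
    finally show ?thesis by simp
  qed
  have "(\<lambda>N. C * (LINT \<eta>|?M. ?n N \<eta>)) \<longlonglongrightarrow> 0"
    using tendsto_mult_left[OF floquet_integrals(2)[OF hL], of C] by simp
  then have "norm (sqrt (2 * pi) * h (w + of_int m) - ?I) \<le> 0"
    by (rule tendsto_lowerbound) (use I in \<open>auto simp: eventually_sequentially\<close>)
  then show "?I = sqrt (2 * pi) * h (w + of_int m)" by simp
qed

end

section \<open>Quasi-periodic Bergman spaces\<close>

lemma norm_exp_i_mult_le:
  assumes "\<bar>\<eta>\<bar> \<le> pi" "\<bar>Im z\<bar> \<le> M"
  shows "norm (exp (\<i> * of_real \<eta> * z)) \<le> exp (pi * M)"
proof -
  have "- (\<eta> * Im z) \<le> \<bar>\<eta>\<bar> * \<bar>Im z\<bar>" by (simp add: abs_mult[symmetric])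
  also have "\<dots> \<le> pi * M" using assms by (intro mult_mono) auto
  finally show ?thesis by simp
qed

text \<open>The induction runs on a telescoping bound, from 2 / (1 + (N+1)^2) <= 4 / ((N+1)(N+2));
  for N = 0 it is the equality 1 = 5 - 4. What matters later is the uniform bound 5.\<close>

lemma sum_inverse_1_plus_square:
  "(\<Sum>m\<in>int_ball N. 1 / (1 + (real_of_int m)\<^sup>2)) \<le> 5 - 4 / (real N + 1)"
proof (induction N)
  case (Suc N)
  have *: "int_ball (Suc N) = insert (int (Suc N)) (insert (- int (Suc N)) (int_ball N))" by auto
  have "(\<Sum>m\<in>int_ball (Suc N). 1 / (1 + (real_of_int m)\<^sup>2))
      = (\<Sum>m\<in>int_ball N. 1 / (1 + (real_of_int m)\<^sup>2)) + 2 / (1 + (real N + 1)\<^sup>2)"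
    unfolding * by (subst sum.insert, simp, simp, subst sum.insert) (auto simp: add_ac power2_eq_square algebra_simps)
  also have "\<dots> \<le> 5 - 4 / (real N + 1) + 2 / (1 + (real N + 1)\<^sup>2)" using Suc.IH by simp
  also have "2 / (1 + (real N + 1)\<^sup>2) \<le> 4 / ((real N + 1) * (real N + 2))"
  proof -
    have "(real N + 1) * (real N + 2) \<le> 2 * (1 + (real N + 1)\<^sup>2)" by (simp add: power2_eq_square algebra_simps)
    then have "4 / (2 * (1 + (real N + 1)\<^sup>2)) \<le> 4 / ((real N + 1) * (real N + 2))"
      by (intro divide_left_mono mult_pos_pos) (auto intro: add_pos_nonneg)
    moreover have "4 / (2 * x) = 2 / x" for x :: real by simp
    ultimately show ?thesis by (simp only:)
  qed
  also have "5 - 4 / (real N + 1) + 4 / ((real N + 1) * (real N + 2)) = 5 - 4 / (real (Suc N) + 1)"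
    by (simp add: divide_simps) (simp add: algebra_simps)
  finally show ?case by simp
qed simp

text \<open>For -pi <= c and z other than 0 this is (exp(i c z) - exp(-i pi z)) / (i z), and the
  integral form also covers the removable point. Multiplying a periodic function by it corresponds,
  up to the factor sqrt(2 pi), to cutting off at \<eta> <= c on the Floquet side.\<close>

definition exp_integral :: "real \<Rightarrow> complex \<Rightarrow> complex" where
  "exp_integral c z = (LINT \<eta>|lebesgue_on {-pi..c}. exp (\<i> * of_real \<eta> * z))"

lemma exp_integrable: "integrable (lebesgue_on {a..b}) (\<lambda>\<eta>. exp (\<i> * of_real \<eta> * z))"
  by (intro continuous_integrable_lebesgue_on continuous_intros)

lemma exp_integral_analytic: "exp_integral c analytic_on A"
proof -
  have "(\<lambda>z. integral (cbox (-pi) c) (\<lambda>\<eta>. exp (\<i> * of_real \<eta> * z))) holomorphic_on UNIV"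
  proof (rule leibniz_rule_holomorphic)
    show "((\<lambda>z. exp (\<i> * of_real \<eta> * z)) has_field_derivative (\<i> * of_real \<eta>) * exp (\<i> * of_real \<eta> * z)) (at z within UNIV)"
      for z :: complex and \<eta> :: real
      by (auto intro!: derivative_eq_intros)
    show "(\<lambda>\<eta>. exp (\<i> * complex_of_real \<eta> * z)) integrable_on cbox (-pi) c" for z
      by (intro integrable_continuous continuous_intros)
    show "continuous_on (UNIV \<times> cbox (-pi) c) (\<lambda>(z, \<eta>). (\<i> * complex_of_real \<eta>) * exp (\<i> * of_real \<eta> * z))"
      by (auto simp: case_prod_unfold intro!: continuous_intros)
  qed simp
  moreover have "exp_integral c = (\<lambda>z. integral (cbox (-pi) c) (\<lambda>\<eta>. exp (\<i> * of_real \<eta> * z)))"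
    unfolding exp_integral_def using lebesgue_integral_eq_integral[OF exp_integrable] by (simp add: fun_eq_iff)
  ultimately show ?thesis
    using analytic_on_subset[of "exp_integral c" UNIV A] by (simp add: analytic_on_open)
qed

text \<open>The length of the interval bounds the integral itself and the explicit antiderivative
  bounds |z| times it; squaring and adding gives one estimate that is good both near 0 and far out.
  Both use |exp(i \<eta> z)| <= exp(pi M) on the strip.\<close>

lemma exp_integral_bound:
  assumes c: "-pi \<le> c" "c \<le> pi" and z: "\<bar>Im z\<bar> \<le> M"
  shows "(1 + (norm z)\<^sup>2) * (norm (exp_integral c z))\<^sup>2 \<le> (2 * pi * exp (pi * M))\<^sup>2 + (2 * exp (pi * M))\<^sup>2"
proof -
  let ?B = "exp (pi * M)"
  have e: "norm (exp (\<i> * of_real \<eta> * z)) \<le> ?B" if "\<eta> \<in> {-pi..c}" for \<eta>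
    using that c z by (intro norm_exp_i_mult_le) auto
  interpret finite_measure "lebesgue_on {-pi..c}" by (rule finite_measure_lebesgue_on_Icc)
  have "norm (exp_integral c z) \<le> (LINT \<eta>|lebesgue_on {-pi..c}. norm (exp (\<i> * of_real \<eta> * z)))"
    unfolding exp_integral_def by (rule integral_norm_bound)
  also have "\<dots> \<le> (LINT \<eta>|lebesgue_on {-pi..c}. ?B)"
    using e by (intro integral_mono integrable_norm exp_integrable) auto
  also have "\<dots> = (c + pi) * ?B" using c by (simp add: measure_restrict_space)
  also have "\<dots> \<le> 2 * pi * ?B" using c by (intro mult_right_mono) auto
  finally have 1: "(norm (exp_integral c z))\<^sup>2 \<le> (2 * pi * ?B)\<^sup>2" by (intro power_mono) auto
  have "norm z * norm (exp_integral c z) \<le> 2 * ?B"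
  proof (cases "z = 0")
    case False
    have "exp_integral c z = (exp (\<i> * of_real c * z) - exp (\<i> * of_real (-pi) * z)) / (\<i> * z)"
      unfolding exp_integral_def using False c by (intro integral_exp_interval) auto
    then have "norm z * norm (exp_integral c z) = norm (exp (\<i> * of_real c * z) - exp (\<i> * of_real (-pi) * z))"
      using False by (simp add: norm_divide norm_mult)
    also have "\<dots> \<le> norm (exp (\<i> * of_real c * z)) + norm (exp (\<i> * of_real (-pi) * z))" by (rule norm_triangle_ineq4)
    also have "\<dots> \<le> ?B + ?B" using c by (intro add_mono e) auto
    finally show ?thesis by simp
  qed simp
  then have 2: "(norm z * norm (exp_integral c z))\<^sup>2 \<le> (2 * ?B)\<^sup>2" by (intro power_mono) auto
  have "(1 + (norm z)\<^sup>2) * (norm (exp_integral c z))\<^sup>2 = (norm (exp_integral c z))\<^sup>2 + (norm z * norm (exp_integral c z))\<^sup>2"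
    by (simp add: power_mult_distrib algebra_simps)
  with 1 2 show ?thesis by linarith
qed

text \<open>Initial segments form an intersection-stable generator of the Borel sets, so the
  integral of q vanishes over every Borel set, and over every Lebesgue set after removing a null
  set.\<close>

lemma integral_zero_initial_imp_AE_zero:
  fixes q :: "real \<Rightarrow> complex"
  assumes q: "integrable (lebesgue_on {a..b}) q"
    and zero: "\<And>c. a \<le> c \<Longrightarrow> c \<le> b \<Longrightarrow> (LINT \<eta>|lebesgue_on {a..b}. indicator {..c} \<eta> *\<^sub>R q \<eta>) = 0"
  shows "AE \<eta> in lebesgue_on {a..b}. q \<eta> = 0"
proof (cases "a \<le> b")
  case False
  then show ?thesis by (intro AE_I2) simp
next
  case ab: True
  let ?M = "lebesgue_on {a..b}"
  interpret finite_measure ?M by (rule finite_measure_lebesgue_on_Icc)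
  let ?I = "\<lambda>A. LINT \<eta>|?M. indicator A \<eta> *\<^sub>R q \<eta>"
  have M: "A \<inter> {a..b} \<in> sets ?M" if "A \<in> sets borel" for A
    using that by (auto simp: sets_restrict_space)
  have ind: "integrable ?M (\<lambda>\<eta>. indicator A \<eta> *\<^sub>R q \<eta>)" if "A \<in> sets borel" for A
    using integrable_mult_indicator[OF M[OF that] q]
    by (rule Bochner_Integration.integrable_cong[THEN iffD1, rotated -1]) (auto simp: indicator_def)
  have tot: "(LINT \<eta>|?M. q \<eta>) = 0"
  proof -
    have "(LINT \<eta>|?M. q \<eta>) = ?I {..b}"
      by (rule Bochner_Integration.integral_cong) (auto simp: indicator_def)
    then show ?thesis using zero[of b] ab by simp
  qed
  have borel0: "?I A = 0" if A: "A \<in> sets borel" for A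
  proof -
    have S: "sets borel = sigma_sets UNIV (range (\<lambda>c::real. {..c}))"
      by (simp add: borel_eq_atMost[where 'a = real])
    have "A \<in> sigma_sets UNIV (range (\<lambda>c::real. {..c}))" using A S by simp
    then show ?thesis
    proof (induction rule: sigma_sets_induct_disjoint[rotated 2, consumes 1, case_names basic empty compl union])
      case (basic A)
      then obtain c where A: "A = {..c}" by auto
      consider "c < a" | "a \<le> c" "c \<le> b" | "c > b" by linarith
      then show ?case
      proof cases
        case 1
        have "?I A = (LINT \<eta>|?M. 0)" by (rule Bochner_Integration.integral_cong) (use 1 A in \<open>auto simp: indicator_def\<close>)
        then show ?thesis by simp
      next
        case 2
        then show ?thesis using zero A by simp
      next
        case 3
        have "?I A = (LINT \<eta>|?M. q \<eta>)" by (rule Bochner_Integration.integral_cong) (use 3 A in \<open>auto simp: indicator_def\<close>)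
        then show ?thesis using tot by simp
      qed
    next
      case empty
      then show ?case by simp
    next
      case (compl A)
      then have Ab: "A \<in> sets borel" using S by simp
      have "?I (UNIV - A) = (LINT \<eta>|?M. q \<eta> - indicator A \<eta> *\<^sub>R q \<eta>)"
        by (rule Bochner_Integration.integral_cong) (auto simp: indicator_def)
      also have "\<dots> = (LINT \<eta>|?M. q \<eta>) - ?I A" by (rule Bochner_Integration.integral_diff[OF q ind[OF Ab]])
      finally show ?case using tot compl by simp
    next
      case (union A)
      then have Ab: "A i \<in> sets borel" for i using S by blast
      have "(\<lambda>n. ?I (\<Union>i<n. A i)) \<longlonglongrightarrow> ?I (\<Union>i. A i)"
      proof (rule integral_dominated_convergence[where w = "\<lambda>\<eta>. norm (q \<eta>)"])
        show "(\<lambda>\<eta>. indicator (\<Union>i. A i) \<eta> *\<^sub>R q \<eta>) \<in> borel_measurable ?M"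
          using ind[of "\<Union>i. A i"] Ab by auto
        show "(\<lambda>\<eta>. indicator (\<Union>i<n. A i) \<eta> *\<^sub>R q \<eta>) \<in> borel_measurable ?M" for n
          using ind[of "\<Union>i<n. A i"] Ab by auto
        show "AE \<eta> in ?M. (\<lambda>n. indicator (\<Union>i<n. A i) \<eta> *\<^sub>R q \<eta>) \<longlonglongrightarrow> indicator (\<Union>i. A i) \<eta> *\<^sub>R q \<eta>"
          by (intro AE_I2 tendsto_scaleR tendsto_const LIMSEQ_indicator_UN)
        show "AE \<eta> in ?M. norm (indicator (\<Union>i<n. A i) \<eta> *\<^sub>R q \<eta>) \<le> norm (q \<eta>)" for n
          by (intro AE_I2) (auto simp: indicator_def)
      qed (use q in auto)
      moreover have "?I (\<Union>i<n. A i) = 0" for n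
      proof (induction n)
        case (Suc n)
        have "A n \<inter> A i = {}" if "i < n" for i
          using union(1) that by (simp add: disjoint_family_on_def)
        then have "A n \<inter> (\<Union>i<n. A i) = {}" by blast
        then have "?I (\<Union>i<Suc n. A i) = (LINT \<eta>|?M. indicator (A n) \<eta> *\<^sub>R q \<eta> + indicator (\<Union>i<n. A i) \<eta> *\<^sub>R q \<eta>)"
          by (intro Bochner_Integration.integral_cong refl) (auto simp: indicator_def lessThan_Suc)
        also have "\<dots> = ?I (A n) + ?I (\<Union>i<n. A i)"
          using Ab by (intro Bochner_Integration.integral_add ind) auto
        finally show ?case using Suc union(3) by simp
      qed simp
      ultimately show ?case by (simp add: LIMSEQ_const_iff)
    qed (auto simp: Int_stable_def)
  qed
  have "set_lebesgue_integral ?M A q = 0" if "A \<in> sets ?M" for A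
  proof -
    have "A \<in> sets lebesgue" using that by (simp add: sets_restrict_space_iff)
    then obtain C N where CN: "C \<in> sets borel" "N \<in> null_sets lebesgue" "A = C \<union> N"
    proof (rule sets_completionE)
      fix S N N' assume *: "A = S \<union> N" "N \<subseteq> N'" "N' \<in> null_sets lborel" "S \<in> sets lborel"
      then have "N \<in> null_sets lebesgue" by (meson null_sets_completion_subset null_sets_completionI)
      with * that show thesis by simp
    qed
    have "AE \<eta> in lebesgue. \<eta> \<notin> N" using CN(2) by (rule AE_not_in)
    then have N: "AE \<eta> in ?M. \<eta> \<notin> N" by (subst AE_restrict_space_iff) auto
    have "set_lebesgue_integral ?M A q = ?I C"
      unfolding set_lebesgue_integral_def
    proof (rule integral_cong_AE)
      show "(\<lambda>\<eta>. indicator A \<eta> *\<^sub>R q \<eta>) \<in> borel_measurable ?M"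
        using integrable_mult_indicator[OF that q] by simp
      show "(\<lambda>\<eta>. indicator C \<eta> *\<^sub>R q \<eta>) \<in> borel_measurable ?M" using ind[OF CN(1)] by simp
      show "AE \<eta> in ?M. indicator A \<eta> *\<^sub>R q \<eta> = indicator C \<eta> *\<^sub>R q \<eta>"
        using N by eventually_elim (auto simp: CN(3) indicator_def)
    qed
    then show ?thesis using borel0[OF CN(1)] by simp
  qed
  with q show ?thesis by (rule density_zero)
qed

section \<open>Multiplication by exponentials and the quasi-periodic spaces\<close>

context periodic_cell
begin

lemma norm_exp_twist_le:
  assumes "\<eta> \<in> {-pi..pi}" "z \<in> cell"
  shows "norm (exp (\<i> * of_real \<eta> * z)) \<le> exp (pi * M)"
  using assms cell_strip by (intro norm_exp_i_mult_le) (auto simp: abs_le_iff less_imp_le)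

lemma exp_twist_measurable: "(\<lambda>z. exp (\<i> * of_real \<eta> * z)) \<in> borel_measurable (lebesgue_on A)" if "A \<in> sets lebesgue"
  using that by (intro continuous_imp_measurable_on_sets_lebesgue continuous_intros)

lemma twist_bounded: "\<exists>B\<ge>0. \<forall>z\<in>cell. norm (exp (\<i> * of_real \<eta> * z)) \<le> B"
proof -
  have "norm (exp (\<i> * of_real \<eta> * z)) \<le> exp (\<bar>\<eta>\<bar> * \<bar>M\<bar>)" if "z \<in> cell" for z
  proof -
    have "- (\<eta> * Im z) \<le> \<bar>\<eta>\<bar> * \<bar>Im z\<bar>" by (simp add: abs_mult[symmetric])
    also have "\<dots> \<le> \<bar>\<eta>\<bar> * \<bar>M\<bar>" using that cell_strip by (intro mult_left_mono) auto
    finally show ?thesis by simp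
  qed
  then show ?thesis by (intro exI[of _ "exp (\<bar>\<eta>\<bar> * \<bar>M\<bar>)"]) auto
qed

lemma twist_L2:
  assumes "f \<in> L2 cell"
  shows "(\<lambda>z. exp (\<i> * of_real \<eta> * z) * f z) \<in> L2 cell"
    "\<exists>B\<ge>0. \<forall>f\<in>L2 cell. L2_norm cell (\<lambda>z. exp (\<i> * of_real \<eta> * z) * f z) \<le> B * L2_norm cell f"
proof -
  obtain B where B: "B \<ge> 0" "\<And>z. z \<in> cell \<Longrightarrow> norm (exp (\<i> * of_real \<eta> * z)) \<le> B"
    using twist_bounded by blast
  note * = L2_bounded_mult[OF _ exp_twist_measurable[OF cell_lebesgue] B(2) B(1)]
  show "(\<lambda>z. exp (\<i> * of_real \<eta> * z) * f z) \<in> L2 cell" using *(1)[OF assms] .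
  show "\<exists>B\<ge>0. \<forall>f\<in>L2 cell. L2_norm cell (\<lambda>z. exp (\<i> * of_real \<eta> * z) * f z) \<le> B * L2_norm cell f"
    using *(2) B(1) by blast
qed

lemma twist_A2: "f \<in> A2 cell \<Longrightarrow> (\<lambda>z. exp (\<i> * of_real \<eta> * z) * f z) \<in> A2 cell"
  using twist_L2(1)[of f \<eta>] by (auto simp: A2_def intro!: analytic_intros)

lemma A2_ext_add:
  assumes "f \<in> A2_ext a b cell \<eta>" "g \<in> A2_ext a b cell \<eta>"
  shows "(\<lambda>z. f z + g z) \<in> A2_ext a b cell \<eta>"
proof -
  obtain U F where F: "open U" "closure cell \<inter> \<Pi> \<subseteq> U" "U \<subseteq> \<Pi>" "F analytic_on U" "\<And>z. z \<in> cell \<Longrightarrow> F z = f z"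
    "\<And>y. a < y \<Longrightarrow> y < b \<Longrightarrow> F (Complex 1 y) = exp (\<i> * \<eta>) * F (Complex 0 y)"
    using assms(1) unfolding A2_ext_def by blast
  obtain V G where G: "open V" "closure cell \<inter> \<Pi> \<subseteq> V" "V \<subseteq> \<Pi>" "G analytic_on V" "\<And>z. z \<in> cell \<Longrightarrow> G z = g z"
    "\<And>y. a < y \<Longrightarrow> y < b \<Longrightarrow> G (Complex 1 y) = exp (\<i> * \<eta>) * G (Complex 0 y)"
    using assms(2) unfolding A2_ext_def by blast
  have "(\<lambda>z. F z + G z) analytic_on U \<inter> V"
    using F(4) G(4) analytic_on_subset by (intro analytic_on_add) blast+
  moreover have "(\<lambda>z. f z + g z) \<in> A2 cell" using assms by (auto simp: A2_ext_def intro: A2_add)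
  ultimately show ?thesis
    unfolding A2_ext_def using F G
    by (intro CollectI conjI exI[of _ "U \<inter> V"] exI[of _ "\<lambda>z. F z + G z"]) (auto simp: distrib_left)
qed

text \<open>At 1 + iy the exponential is exp(i \<delta>) times its value at iy, so this entire
  factor shifts the boundary phase from \<theta> to \<theta> + \<delta>.\<close>

lemma A2_ext_twist:
  assumes "f \<in> A2_ext a b cell \<theta>"
  shows "(\<lambda>z. exp (\<i> * of_real \<delta> * z) * f z) \<in> A2_ext a b cell (\<theta> + \<delta>)"
proof -
  obtain U F where F: "open U" "closure cell \<inter> \<Pi> \<subseteq> U" "U \<subseteq> \<Pi>" "F analytic_on U" "\<And>z. z \<in> cell \<Longrightarrow> F z = f z"
    "\<And>y. a < y \<Longrightarrow> y < b \<Longrightarrow> F (Complex 1 y) = exp (\<i> * \<theta>) * F (Complex 0 y)"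
    using assms unfolding A2_ext_def by blast
  let ?F = "\<lambda>z. exp (\<i> * of_real \<delta> * z) * F z"
  have "?F analytic_on U" using F(4) by (intro analytic_intros)
  moreover have "(\<lambda>z. exp (\<i> * of_real \<delta> * z) * f z) \<in> A2 cell" using assms by (auto simp: A2_ext_def intro: twist_A2)
  moreover have "?F (Complex 1 y) = exp (\<i> * of_real (\<theta> + \<delta>)) * ?F (Complex 0 y)" if "a < y" "y < b" for y
  proof -
    have "exp (\<i> * of_real \<delta> * Complex 1 y) = exp (\<i> * of_real \<delta>) * exp (\<i> * of_real \<delta> * Complex 0 y)"
      unfolding exp_add[symmetric] by (rule arg_cong[of _ _ exp]) (simp add: complex_eq_iff)
    moreover have "exp (\<i> * of_real (\<theta> + \<delta>)) = exp (\<i> * of_real \<theta>) * exp (\<i> * of_real \<delta>)"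
      unfolding exp_add[symmetric] by (simp add: algebra_simps)
    ultimately show ?thesis using F(6)[OF that] by simp
  qed
  ultimately show ?thesis
    unfolding A2_ext_def using F(1-3,5)
    by (intro CollectI conjI exI[of _ U] exI[of _ ?F]) auto
qed

lemma A2_ext_cmult:
  assumes "f \<in> A2_ext a b cell \<eta>"
  shows "(\<lambda>z. c * f z) \<in> A2_ext a b cell \<eta>"
proof -
  obtain U F where F: "open U" "closure cell \<inter> \<Pi> \<subseteq> U" "U \<subseteq> \<Pi>" "F analytic_on U" "\<And>z. z \<in> cell \<Longrightarrow> F z = f z"
    "\<And>y. a < y \<Longrightarrow> y < b \<Longrightarrow> F (Complex 1 y) = exp (\<i> * \<eta>) * F (Complex 0 y)"
    using assms unfolding A2_ext_def by blast
  moreover have "(\<lambda>z. c * F z) analytic_on U" using F(4) by (intro analytic_intros)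
  moreover have "(\<lambda>z. c * f z) \<in> A2 cell" using assms by (auto simp: A2_ext_def intro: A2_cmult)
  ultimately show ?thesis
    unfolding A2_ext_def
    by (intro CollectI conjI exI[of _ U] exI[of _ "\<lambda>z. c * F z"]) auto
qed

lemma A2_ext_zero: "(\<lambda>z. 0) \<in> A2_ext a b cell \<eta>"
  unfolding A2_ext_def using open_Pdom
  by (intro CollectI conjI exI[of _ \<Pi>] exI[of _ "\<lambda>z. 0"]) (auto simp: A2_zero)

lemma A2_ext_A2: "f \<in> A2_ext a b cell \<eta> \<Longrightarrow> f \<in> A2 cell"
  by (simp add: A2_ext_def)

lemma A2_ext_subset_quasi: "A2_ext a b cell \<eta> \<subseteq> A2_quasi a b cell \<eta>"
proof
  fix f assume f: "f \<in> A2_ext a b cell \<eta>"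
  have "\<exists>g\<in>A2_ext a b cell \<eta>. L2_norm cell (\<lambda>z. f z - g z) < \<epsilon>" if "\<epsilon> > 0" for \<epsilon>
    using f that by (intro bexI[of _ f]) (simp_all add: L2_norm_zero)
  with A2_ext_A2[OF f] show "f \<in> A2_quasi a b cell \<eta>" by (simp add: A2_quasi_def)
qed

lemma A2_quasi_approx: "f \<in> A2_quasi a b cell \<eta> \<Longrightarrow> \<epsilon> > 0 \<Longrightarrow> \<exists>g\<in>A2_ext a b cell \<eta>. L2_norm cell (\<lambda>z. f z - g z) < \<epsilon>"
  by (simp add: A2_quasi_def)

lemma A2_quasi_A2: "f \<in> A2_quasi a b cell \<eta> \<Longrightarrow> f \<in> A2 cell"
  by (simp add: A2_quasi_def)

lemma A2_quasi_closed_subspace: "A2_closed_subspace cell (A2_quasi a b cell \<eta>)"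
  unfolding A2_closed_subspace_def
proof (intro conjI ballI allI impI)
  show "A2_quasi a b cell \<eta> \<subseteq> A2 cell" using A2_quasi_A2 by blast
  show "(\<lambda>z. 0) \<in> A2_quasi a b cell \<eta>" using A2_ext_subset_quasi A2_ext_zero by blast
  show "(\<lambda>z. f z + g z) \<in> A2_quasi a b cell \<eta>" if f: "f \<in> A2_quasi a b cell \<eta>" and g: "g \<in> A2_quasi a b cell \<eta>" for f g
    unfolding A2_quasi_def
  proof (intro CollectI conjI allI impI)
    show "(\<lambda>z. f z + g z) \<in> A2 cell" using f g by (intro A2_add A2_quasi_A2)
    fix \<epsilon> :: real assume "\<epsilon> > 0"
    then have \<epsilon>: "\<epsilon> / 2 > 0" by simp
    obtain f' where f': "f' \<in> A2_ext a b cell \<eta>" "L2_norm cell (\<lambda>z. f z - f' z) < \<epsilon> / 2" using A2_quasi_approx[OF f \<epsilon>] by blast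
    obtain g' where g': "g' \<in> A2_ext a b cell \<eta>" "L2_norm cell (\<lambda>z. g z - g' z) < \<epsilon> / 2" using A2_quasi_approx[OF g \<epsilon>] by blast
    have "L2_norm cell (\<lambda>z. (f z - f' z) + (g z - g' z)) \<le> L2_norm cell (\<lambda>z. f z - f' z) + L2_norm cell (\<lambda>z. g z - g' z)"
      using f g f' g' by (intro L2_norm_triangle L2_diff A2_L2) (auto intro: A2_quasi_A2 A2_ext_A2)
    also have "(\<lambda>z. (f z - f' z) + (g z - g' z)) = (\<lambda>z. (f z + g z) - (f' z + g' z))" by (simp add: algebra_simps)
    finally show "\<exists>k\<in>A2_ext a b cell \<eta>. L2_norm cell (\<lambda>z. (f z + g z) - k z) < \<epsilon>"
      using f' g' by (intro bexI[OF _ A2_ext_add[OF f'(1) g'(1)]]) simp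
  qed
  show "(\<lambda>z. c * f z) \<in> A2_quasi a b cell \<eta>" if f: "f \<in> A2_quasi a b cell \<eta>" for c f
    unfolding A2_quasi_def
  proof (intro CollectI conjI allI impI)
    show "(\<lambda>z. c * f z) \<in> A2 cell" using f by (intro A2_cmult A2_quasi_A2)
    fix \<epsilon> :: real assume "\<epsilon> > 0"
    then have \<epsilon>: "\<epsilon> / (norm c + 1) > 0" by (intro divide_pos_pos add_nonneg_pos) auto
    obtain f' where f': "f' \<in> A2_ext a b cell \<eta>" "L2_norm cell (\<lambda>z. f z - f' z) < \<epsilon> / (norm c + 1)" using A2_quasi_approx[OF f \<epsilon>] by blast
    have "L2_norm cell (\<lambda>z. c * (f z - f' z)) \<le> (norm c + 1) * L2_norm cell (\<lambda>z. f z - f' z)"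
      unfolding L2_norm_cmult by (intro mult_right_mono L2_norm_nonneg) simp
    also have "\<dots> < (norm c + 1) * (\<epsilon> / (norm c + 1))" using f'(2) by (intro mult_strict_left_mono) (auto intro: add_nonneg_pos)
    also have "\<dots> = \<epsilon>" using norm_ge_zero[of c] by (simp add: add_nonneg_eq_0_iff)
    finally show "\<exists>k\<in>A2_ext a b cell \<eta>. L2_norm cell (\<lambda>z. c * f z - k z) < \<epsilon>"
      by (intro bexI[OF _ A2_ext_cmult[OF f'(1), of c]]) (simp add: algebra_simps)
  qed
  show "f \<in> A2_quasi a b cell \<eta>" if f: "f \<in> A2 cell" and app: "\<forall>\<epsilon>>0. \<exists>g\<in>A2_quasi a b cell \<eta>. L2_norm cell (\<lambda>z. f z - g z) < \<epsilon>" for f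
    unfolding A2_quasi_def
  proof (intro CollectI conjI allI impI f)
    fix \<epsilon> :: real assume "\<epsilon> > 0"
    then have \<epsilon>: "\<epsilon> / 2 > 0" by simp
    obtain g where g: "g \<in> A2_quasi a b cell \<eta>" "L2_norm cell (\<lambda>z. f z - g z) < \<epsilon> / 2" using app \<epsilon> by blast
    obtain k where k: "k \<in> A2_ext a b cell \<eta>" "L2_norm cell (\<lambda>z. g z - k z) < \<epsilon> / 2" using A2_quasi_approx[OF g(1) \<epsilon>] by blast
    have "L2_norm cell (\<lambda>z. f z - k z) \<le> L2_norm cell (\<lambda>z. f z - g z) + L2_norm cell (\<lambda>z. g z - k z)"
      using f g k by (intro L2_norm_diff_triangle A2_L2) (auto intro: A2_quasi_A2 A2_ext_A2)
    then show "\<exists>k\<in>A2_ext a b cell \<eta>. L2_norm cell (\<lambda>z. f z - k z) < \<epsilon>" using g(2) k by (intro bexI[OF _ k(1)]) simp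
  qed
qed

text \<open>The factor is bounded on the cell, which lies in a horizontal strip, so the twist is
  continuous in norm and passes to closures. Taking -\<delta> inverts it, which identifies all
  quasi-periodic spaces with the periodic one.\<close>

lemma A2_quasi_twist:
  assumes f: "f \<in> A2_quasi a b cell \<theta>"
  shows "(\<lambda>z. exp (\<i> * of_real \<delta> * z) * f z) \<in> A2_quasi a b cell (\<theta> + \<delta>)"
  unfolding A2_quasi_def
proof (intro CollectI conjI allI impI)
  let ?e = "\<lambda>z. exp (\<i> * of_real \<delta> * z)"
  show "(\<lambda>z. ?e z * f z) \<in> A2 cell" using f by (intro twist_A2 A2_quasi_A2)
  fix \<epsilon> :: real assume \<epsilon>: "\<epsilon> > 0"
  obtain B where B: "B \<ge> 0" "\<And>f. f \<in> L2 cell \<Longrightarrow> L2_norm cell (\<lambda>z. ?e z * f z) \<le> B * L2_norm cell f"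
    using twist_L2(2)[OF L2_zero, of \<delta>] by blast
  have "\<epsilon> / (B + 1) > 0" using \<epsilon> B by simp
  from A2_quasi_approx[OF f this]
  obtain g where g: "g \<in> A2_ext a b cell \<theta>" "L2_norm cell (\<lambda>z. f z - g z) < \<epsilon> / (B + 1)" by blast
  have "L2_norm cell (\<lambda>z. ?e z * (f z - g z)) \<le> B * L2_norm cell (\<lambda>z. f z - g z)"
    using f g by (intro B(2) L2_diff A2_L2) (auto intro: A2_quasi_A2 A2_ext_A2)
  also have "\<dots> \<le> (B + 1) * L2_norm cell (\<lambda>z. f z - g z)" by (intro mult_right_mono L2_norm_nonneg) simp
  also have "\<dots> < (B + 1) * (\<epsilon> / (B + 1))" using g(2) B by (intro mult_strict_left_mono) auto
  also have "\<dots> = \<epsilon>" using B by simp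
  finally show "\<exists>k\<in>A2_ext a b cell (\<theta> + \<delta>). L2_norm cell (\<lambda>z. ?e z * f z - k z) < \<epsilon>"
    by (intro bexI[OF _ A2_ext_twist[OF g(1)]]) (simp add: algebra_simps)
qed

end

section \<open>Test functions on the periodic domain\<close>

context periodic_cell
begin

text \<open>Near a point of \<Pi> with Re z = 0 both F(w) and F(w + 1) are analytic in a small disc
  and agree on its vertical diameter, where the boundary relation with \<eta> = 0 applies; by the
  identity theorem they agree on the disc. Hence gluing by the floor function creates no
  jump.\<close>

lemma periodic_extension:
  assumes h: "h \<in> A2_ext a b cell 0"
  obtains H where "H analytic_on \<Pi>" "\<And>z m. z \<in> cell \<Longrightarrow> H (z + of_int m) = h z"
proof -
  obtain U F where F: "open U" "closure cell \<inter> \<Pi> \<subseteq> U" "U \<subseteq> \<Pi>" "F analytic_on U" "\<And>z. z \<in> cell \<Longrightarrow> F z = h z"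
    "\<And>y. a < y \<Longrightarrow> y < b \<Longrightarrow> F (Complex 1 y) = F (Complex 0 y)"
    using h unfolding A2_ext_def by auto
  define H where "H = (\<lambda>z. F (z - of_int \<lfloor>Re z\<rfloor>))"
  have Hshift: "H (z + of_int m) = H z" for z m by (simp add: H_def)
  have Hcell: "H z = F z" if "z \<in> cell" for z using cell_floor[OF that, of 0] by (simp add: H_def)
  have F_hol: "F holomorphic_on V" if "V \<subseteq> U" for V
    using F(4) that analytic_imp_holomorphic holomorphic_on_subset by blast
  have local: "\<exists>e>0. H holomorphic_on ball z e" if z: "z \<in> \<Pi>" "0 \<le> Re z" "Re z < 1" for z
  proof (cases "Re z = 0")
    case False
    then have "z \<in> cell" using Pdom_in_strip z by simp
    then obtain e where e: "e > 0" "ball z e \<subseteq> cell" using open_cell open_contains_ball by blast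
    have "cell \<subseteq> U" using F(2) closure_subset[of cell] cell_subset_Pdom by blast
    then have "F holomorphic_on ball z e" using e by (intro F_hol) blast
    then have "H holomorphic_on ball z e" by (rule holomorphic_transform) (use e Hcell in auto)
    then show ?thesis using e by blast
  next
    case True
    note line = Pdom_on_line[OF z(1) True]
    have "z \<in> U" using line z(1) F(2) by blast
    moreover have "z + 1 \<in> U" using line Pdom_shift[of z 1] z(1) F(2) by auto
    ultimately obtain e1 e2 where e12: "e1 > 0" "ball z e1 \<subseteq> U" "e2 > 0" "ball (z + 1) e2 \<subseteq> U"
      using F(1) open_contains_ball by metis
    \<comment> \<open>The bound 1 restricts the floor of Re w to 0 or -1 on the disc.\<close>
    define e where "e = min 1 (min e1 e2)"
    have e: "e > 0" "e \<le> 1" "ball z e \<subseteq> U" "ball (z + 1) e \<subseteq> U"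
      using e12 by (auto simp: e_def)
    have sub: "w + 1 \<in> ball (z + 1) e" if "w \<in> ball z e" for w using that by (simp add: dist_norm)
    have hF: "F holomorphic_on ball z e" by (intro F_hol e)
    have hF1: "(\<lambda>w. F (w + 1)) holomorphic_on ball z e"
    proof -
      have "F holomorphic_on (\<lambda>w. w + 1) ` ball z e" using sub e(4) by (intro F_hol) blast
      moreover have "(\<lambda>w. w + 1) holomorphic_on ball z e" by (intro holomorphic_intros)
      ultimately show ?thesis using holomorphic_on_compose[of "\<lambda>w. w + 1" "ball z e" F] by (simp add: o_def)
    qed
    let ?L = "{w \<in> ball z e. Re w = 0}"
    have eq: "F (w + 1) - F w = 0" if w: "w \<in> ball z e" for w
    proof (rule analytic_continuation[of "\<lambda>w. F (w + 1) - F w" "ball z e" ?L z])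
      show "(\<lambda>w. F (w + 1) - F w) holomorphic_on ball z e" using hF hF1 by (intro holomorphic_intros)
      show "z islimpt ?L" unfolding islimpt_approachable
      proof (intro allI impI)
        fix d :: real assume "d > 0"
        define t where "t = min d e / 2"
        have t: "t > 0" "t < d" "t < e" using \<open>d > 0\<close> e(1) by (auto simp: t_def)
        show "\<exists>x'\<in>?L. x' \<noteq> z \<and> dist x' z < d"
          using t True by (intro bexI[of _ "z + \<i> * of_real t"]) (auto simp: dist_norm norm_mult)
      qed
      show "F (w + 1) - F w = 0" if "w \<in> ?L" for w
      proof -
        have "w \<in> \<Pi>" using that e(3) F(3) by blast
        then have ab: "a < Im w" "Im w < b" using Pdom_on_line[of w] that by auto
        have "w + 1 = Complex 1 (Im w)" "w = Complex 0 (Im w)" using that by (auto simp: complex_eq_iff)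
        then show ?thesis using F(6)[OF ab] by simp
      qed
    qed (use e w in auto)
    have "H w = F w" if w: "w \<in> ball z e" for w
    proof -
      have "\<bar>Re w\<bar> < 1"
        using w e(2) abs_Re_le_cmod[of "z - w"] True by (simp add: dist_norm)
      then have "\<lfloor>Re w\<rfloor> = 0 \<or> \<lfloor>Re w\<rfloor> = -1" by linarith
      then show ?thesis using eq[OF w] by (auto simp: H_def)
    qed
    then have "H holomorphic_on ball z e" using holomorphic_transform[OF hF] by simp
    then show ?thesis using e by blast
  qed
  have "H analytic_on \<Pi>"
    unfolding analytic_on_def
  proof
    fix z assume z: "z \<in> \<Pi>"
    let ?k = "\<lfloor>Re z\<rfloor>"
    have "z - of_int ?k \<in> \<Pi>" using z Pdom_shift_diff by blast
    moreover have "0 \<le> Re (z - of_int ?k)" "Re (z - of_int ?k) < 1" by (simp, simp, linarith)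
    ultimately obtain e where e: "e > 0" "H holomorphic_on ball (z - of_int ?k) e" using local by blast
    have "(\<lambda>w. w - of_int ?k) ` ball z e \<subseteq> ball (z - of_int ?k) e" by (auto simp: dist_norm)
    then have "(H \<circ> (\<lambda>w. w - of_int ?k)) holomorphic_on ball z e"
      using e(2) by (intro holomorphic_on_compose holomorphic_intros) (rule holomorphic_on_subset)
    also have "H \<circ> (\<lambda>w. w - of_int ?k) = H"
      using Hshift[of _ "- ?k"] by (simp add: fun_eq_iff)
    finally show "\<exists>e>0. H holomorphic_on ball z e" using e(1) by blast
  qed
  moreover have "H (z + of_int m) = h z" if "z \<in> cell" for z m
    using Hshift[of z m] Hcell[OF that] F(5)[OF that] by simp
  ultimately show ?thesis using that by blast
qed

text \<open>The periodic factor has the same norm on every cell, and on cell m the other factor has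
  square at most a constant over 1 + m^2, so the squared norms over the cells are summable.\<close>

lemma test_function_A2:
  assumes h: "h \<in> A2 cell" and H: "H analytic_on \<Pi>" "\<And>z m. z \<in> cell \<Longrightarrow> H (z + of_int m) = h z"
    and c: "-pi \<le> c" "c \<le> pi"
  shows "(\<lambda>z. H z * exp_integral c z) \<in> A2 \<Pi>"
proof -
  let ?g = "\<lambda>z. H z * exp_integral c z"
  define K where "K = (2 * pi * exp (pi * M))\<^sup>2 + (2 * exp (pi * M))\<^sup>2"
  have K: "K \<ge> 0" by (simp add: K_def)
  have ga: "?g analytic_on \<Pi>" using H(1) exp_integral_analytic by (intro analytic_on_mult)
  have gm: "?g \<in> borel_measurable (lebesgue_on \<Pi>)" by (rule analytic_on_open_measurable[OF open_Pdom ga])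
  have b: "(norm (?g (z + of_int m)))\<^sup>2 \<le> 4 * K / (1 + (real_of_int m)\<^sup>2) * (norm (h z))\<^sup>2" if z: "z \<in> cell" for z m
  proof -
    let ?w = "z + of_int m"
    have w\<Pi>: "?w \<in> \<Pi>" using cell_shift_in_Pdom z by blast
    have E: "(1 + (norm ?w)\<^sup>2) * (norm (exp_integral c ?w))\<^sup>2 \<le> K"
      unfolding K_def using Pdom_Im_le[OF w\<Pi>] by (intro exp_integral_bound c)
    have re: "0 < Re z" "Re z < 1" using z cell_strip by auto
    define R where "R = Re ?w"
    \<comment> \<open>Since m = R - Re z with 0 < Re z < 1, the square of m is at most 2 R^2 + 2;
      the factor 4 absorbs both constants.\<close>
    have "1 + (real_of_int m)\<^sup>2 \<le> 4 * (1 + R\<^sup>2)"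
    proof -
      have "(real_of_int m)\<^sup>2 = (R + (- Re z))\<^sup>2" by (simp add: R_def)
      also have "\<dots> \<le> 2 * R\<^sup>2 + 2 * (- Re z)\<^sup>2" by (rule power2_sum_le)
      finally have "(real_of_int m)\<^sup>2 \<le> 2 * R\<^sup>2 + 2 * (- Re z)\<^sup>2" .
      moreover have "(- Re z)\<^sup>2 \<le> 1" using re by (simp add: power_le_one)
      ultimately show ?thesis using zero_le_power2[of R] unfolding distrib_left by linarith
    qed
    also have "\<dots> \<le> 4 * (1 + (norm ?w)\<^sup>2)" by (simp add: cmod_power2 R_def)
    finally have "(1 + (real_of_int m)\<^sup>2) * (norm (exp_integral c ?w))\<^sup>2 \<le> 4 * (1 + (norm ?w)\<^sup>2) * (norm (exp_integral c ?w))\<^sup>2"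
      by (intro mult_right_mono) auto
    also have "\<dots> \<le> 4 * K" unfolding mult.assoc using E by (intro mult_left_mono) auto
    finally have "(norm (exp_integral c ?w))\<^sup>2 \<le> 4 * K / (1 + (real_of_int m)\<^sup>2)"
      by (simp add: pos_le_divide_eq add_pos_nonneg mult.commute)
    then have "(norm (exp_integral c ?w))\<^sup>2 * (norm (h z))\<^sup>2 \<le> 4 * K / (1 + (real_of_int m)\<^sup>2) * (norm (h z))\<^sup>2"
      by (intro mult_right_mono) auto
    then show ?thesis using H(2)[OF z] by (simp add: norm_mult power_mult_distrib mult.commute)
  qed
  have hi: "integrable (lebesgue_on cell) (\<lambda>z. x * (norm (h z))\<^sup>2)" for x
    using L2_square_integrable[OF A2_L2[OF h]] by simp
  have gi: "integrable (lebesgue_on cell) (\<lambda>z. (norm (?g (z + of_int m)))\<^sup>2)" for m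
  proof (rule Bochner_Integration.integrable_bound[OF hi])
    have "(\<lambda>z. ?g (z + of_int m)) \<in> borel_measurable (lebesgue_on cell)"
      by (rule shift_integral(1)[OF gm cell_lebesgue cell_subset_Pdom])
    then show "(\<lambda>z. (norm (?g (z + of_int m)))\<^sup>2) \<in> borel_measurable (lebesgue_on cell)" by simp
    show "AE z in lebesgue_on cell. norm ((norm (?g (z + of_int m)))\<^sup>2) \<le> norm (4 * K / (1 + (real_of_int m)\<^sup>2) * (norm (h z))\<^sup>2)"
      using b K by (intro AE_I2) (auto intro: order_trans[OF _ abs_ge_self])
  qed
  have "integrable (lebesgue_on \<Pi>) (\<lambda>z. (norm (?g z))\<^sup>2)"
  proof (rule integrable_of_cells)
    show "integrable (lebesgue_on cell) (\<lambda>z. (norm (?g (z + of_int m)))\<^sup>2)" for m by (rule gi)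
    fix N
    let ?h2 = "(L2_norm cell h)\<^sup>2"
    have "(\<Sum>m\<in>int_ball N. LINT z|lebesgue_on cell. (norm (?g (z + of_int m)))\<^sup>2)
        \<le> (\<Sum>m\<in>int_ball N. LINT z|lebesgue_on cell. 4 * K / (1 + (real_of_int m)\<^sup>2) * (norm (h z))\<^sup>2)"
      using b by (intro sum_mono integral_mono gi hi) simp
    also have "\<dots> = (\<Sum>m\<in>int_ball N. (4 * K * ?h2) * (1 / (1 + (real_of_int m)\<^sup>2)))"
      by (simp add: L2_norm_power2)
    also have "\<dots> = (4 * K * ?h2) * (\<Sum>m\<in>int_ball N. 1 / (1 + (real_of_int m)\<^sup>2))" by (rule sum_distrib_left[symmetric])
    also have "\<dots> \<le> (4 * K * ?h2) * 5"
    proof (intro mult_left_mono)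
      have "0 \<le> 4 / (real N + 1)" by simp
      then show "(\<Sum>m\<in>int_ball N. 1 / (1 + (real_of_int m)\<^sup>2)) \<le> 5"
        using sum_inverse_1_plus_square[of N] by linarith
    qed (use K in auto)
    finally show "(\<Sum>m\<in>int_ball N. LINT z|lebesgue_on cell. (norm (?g (z + of_int m)))\<^sup>2) \<le> 4 * K * ?h2 * 5" .
  qed (use gm in auto)
  with ga gm show ?thesis by (simp add: A2_def L2_def)
qed

text \<open>Fubini on the cell times the period, with |exp(i \<eta> z)| <= exp(pi M) on the cell and
  v * cnj h integrable. With a character cut off at c as the weight \<open>q\<close>, integrating
  first in \<eta> produces \<open>exp_integral\<close>.\<close>

lemma twisted_inner_integral:
  fixes q :: "real \<Rightarrow> complex"
  assumes v: "v \<in> L2 cell" and h: "h \<in> L2 cell"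
    and q: "q \<in> borel_measurable borel" "\<And>\<eta>. norm (q \<eta>) \<le> 1"
  shows "integrable (lebesgue_on {-pi..pi}) (\<lambda>\<eta>. q \<eta> * L2_inner cell v (\<lambda>z. exp (\<i> * of_real \<eta> * z) * h z))"
    "(LINT \<eta>|lebesgue_on {-pi..pi}. q \<eta> * L2_inner cell v (\<lambda>z. exp (\<i> * of_real \<eta> * z) * h z))
      = (LINT z|lebesgue_on cell. v z * cnj (h z) * (LINT \<eta>|lebesgue_on {-pi..pi}. q \<eta> * cnj (exp (\<i> * of_real \<eta> * z))))"
proof -
  let ?C = "lebesgue_on cell" and ?M = "lebesgue_on {-pi..pi}"
  interpret M: finite_measure ?M by (rule finite_measure_lebesgue_on_Icc)
  have "cell \<subseteq> box (Complex 0 (- M)) (Complex 1 M)"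
    using cell_strip by (auto simp: in_box_complex_iff)
  then have "bounded cell" by (rule bounded_subset[OF bounded_box])
  then interpret C: finite_measure ?C
    using open_cell by (intro finite_measure_lebesgue_on lmeasurable_open)
  interpret pair_sigma_finite ?C ?M ..
  let ?f = "\<lambda>z \<eta>. v z * cnj (h z) * (q \<eta> * cnj (exp (\<i> * of_real \<eta> * z)))"
  have vh: "integrable ?C (\<lambda>z. v z * cnj (h z))" by (rule L2_inner_integrable[OF v h])
  have idC: "(\<lambda>z. z) \<in> ?C \<rightarrow>\<^sub>M borel" and idM: "(\<lambda>z. z) \<in> ?M \<rightarrow>\<^sub>M borel"
    using id_borel_measurable_lebesgue_on[where 'a = complex, of cell] id_borel_measurable_lebesgue_on[where 'a = real, of "{-pi..pi}"]
    by (simp_all add: id_def)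
  have fm: "(\<lambda>(z, \<eta>). ?f z \<eta>) \<in> borel_measurable (?C \<Otimes>\<^sub>M ?M)"
  proof -
    have 1: "(\<lambda>x. v (fst x) * cnj (h (fst x))) \<in> borel_measurable (?C \<Otimes>\<^sub>M ?M)"
      using measurable_compose[OF measurable_fst borel_measurable_integrable[OF vh]] .
    have q1: "(\<lambda>x. q (snd x)) \<in> borel_measurable (?C \<Otimes>\<^sub>M ?M)"
      using measurable_compose[OF measurable_snd measurable_compose[OF idM q(1)]] .
    have z1: "(\<lambda>x. fst x) \<in> borel_measurable (?C \<Otimes>\<^sub>M ?M)"
      using measurable_compose[OF measurable_fst idC] .
    have z2: "(\<lambda>x. snd x) \<in> borel_measurable (?C \<Otimes>\<^sub>M ?M)"
      using measurable_compose[OF measurable_snd idM] .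
    have "continuous_on UNIV (\<lambda>x::complex \<times> real. cnj (exp (\<i> * of_real (snd x) * fst x)))"
      by (intro continuous_intros)
    then have "(\<lambda>x::complex \<times> real. cnj (exp (\<i> * of_real (snd x) * fst x))) \<in> borel_measurable borel"
      by (rule borel_measurable_continuous_onI)
    from measurable_compose[OF borel_measurable_Pair[OF z1 z2] this]
    have 2: "(\<lambda>x. cnj (exp (\<i> * of_real (snd x) * fst x))) \<in> borel_measurable (?C \<Otimes>\<^sub>M ?M)" by simp
    from borel_measurable_times[OF 1 borel_measurable_times[OF q1 2]]
    show ?thesis by (simp add: case_prod_unfold)
  qed
  have nf: "norm (?f z \<eta>) \<le> norm (v z * cnj (h z)) * exp (pi * M)" if "z \<in> cell" "\<eta> \<in> {-pi..pi}" for z \<eta>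
  proof -
    have "norm (q \<eta> * cnj (exp (\<i> * of_real \<eta> * z))) \<le> 1 * exp (pi * M)"
      unfolding norm_mult complex_mod_cnj using q(2) norm_exp_twist_le[OF that(2,1)] by (intro mult_mono) auto
    then show ?thesis unfolding norm_mult[of "v z * cnj (h z)"] by (intro mult_left_mono) auto
  qed
  have fz: "integrable ?M (?f z)" if "z \<in> cell" for z
  proof (rule M.integrable_const_bound)
    show "AE \<eta> in ?M. norm (?f z \<eta>) \<le> norm (v z * cnj (h z)) * exp (pi * M)" using nf that by (intro AE_I2) auto
    have "(\<lambda>\<eta>. q \<eta> * cnj (exp (\<i> * of_real \<eta> * z))) \<in> borel_measurable borel"
      by (intro borel_measurable_times[OF q(1) borel_measurable_continuous_onI] continuous_intros)
    from measurable_compose[OF idM this] show "?f z \<in> borel_measurable ?M" by simp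
  qed
  have fi: "integrable (?C \<Otimes>\<^sub>M ?M) (\<lambda>(z, \<eta>). ?f z \<eta>)"
  proof (rule Fubini_integrable[OF fm])
    show "AE z in ?C. integrable ?M (\<lambda>\<eta>. case (z, \<eta>) of (z, \<eta>) \<Rightarrow> ?f z \<eta>)"
      using fz by (intro AE_I2) simp
    have "integrable ?C (\<lambda>z. 2 * pi * exp (pi * M) * norm (v z * cnj (h z)))" using vh by simp
    then show "integrable ?C (\<lambda>z. LINT \<eta>|?M. norm (case (z, \<eta>) of (z, \<eta>) \<Rightarrow> ?f z \<eta>))"
    proof (rule Bochner_Integration.integrable_bound)
      show "(\<lambda>z. LINT \<eta>|?M. norm (case (z, \<eta>) of (z, \<eta>) \<Rightarrow> ?f z \<eta>)) \<in> borel_measurable ?C"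
        using fm by (intro M.borel_measurable_lebesgue_integral) (simp add: case_prod_unfold)
      show "AE z in ?C. norm (LINT \<eta>|?M. norm (case (z, \<eta>) of (z, \<eta>) \<Rightarrow> ?f z \<eta>)) \<le> norm (2 * pi * exp (pi * M) * norm (v z * cnj (h z)))"
      proof (rule AE_I2)
        fix z assume "z \<in> space ?C"
        then have z: "z \<in> cell" by simp
        have "(LINT \<eta>|?M. norm (?f z \<eta>)) \<le> (LINT \<eta>|?M. norm (v z * cnj (h z)) * exp (pi * M))"
          using nf[OF z] fz[OF z] by (intro integral_mono integrable_norm) auto
        also have "\<dots> = 2 * pi * exp (pi * M) * norm (v z * cnj (h z))" by (simp add: measure_restrict_space)
        finally show "norm (LINT \<eta>|?M. norm (case (z, \<eta>) of (z, \<eta>) \<Rightarrow> ?f z \<eta>)) \<le> norm (2 * pi * exp (pi * M) * norm (v z * cnj (h z)))"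
          by (simp add: integral_nonneg_AE)
      qed
    qed
  qed
  have inner: "(LINT z|?C. ?f z \<eta>) = q \<eta> * L2_inner cell v (\<lambda>z. exp (\<i> * of_real \<eta> * z) * h z)" for \<eta>
  proof -
    have "(LINT z|?C. ?f z \<eta>) = (LINT z|?C. q \<eta> * (v z * cnj (exp (\<i> * of_real \<eta> * z) * h z)))"
      by (intro Bochner_Integration.integral_cong refl) (simp add: mult_ac)
    then show ?thesis unfolding L2_inner_def by (simp only: integral_mult_right_zero)
  qed
  show "integrable ?M (\<lambda>\<eta>. q \<eta> * L2_inner cell v (\<lambda>z. exp (\<i> * of_real \<eta> * z) * h z))"
    using integrable_snd[OF fi] unfolding inner .
  have "(LINT \<eta>|?M. q \<eta> * L2_inner cell v (\<lambda>z. exp (\<i> * of_real \<eta> * z) * h z)) = (LINT \<eta>|?M. LINT z|?C. ?f z \<eta>)"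
    unfolding inner ..
  also have "\<dots> = (LINT z|?C. LINT \<eta>|?M. ?f z \<eta>)" by (rule Fubini_integral[OF fi])
  also have "\<dots> = (LINT z|?C. v z * cnj (h z) * (LINT \<eta>|?M. q \<eta> * cnj (exp (\<i> * of_real \<eta> * z))))"
    by (simp only: integral_mult_right_zero)
  finally show "(LINT \<eta>|?M. q \<eta> * L2_inner cell v (\<lambda>z. exp (\<i> * of_real \<eta> * z) * h z))
      = (LINT z|?C. v z * cnj (h z) * (LINT \<eta>|?M. q \<eta> * cnj (exp (\<i> * of_real \<eta> * z))))" .
qed

text \<open>The character of the m-th Floquet term merges with the twist into exp(i \<eta> (z + m)).
  This move to the translated point is how a sum over m becomes an integral over \<Pi>.\<close>

lemma exp_integral_shift_cnj:
  assumes "c \<le> pi"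
  shows "(LINT \<eta>|lebesgue_on {-pi..pi}. (indicator {..c} \<eta> * exp (- \<i> * of_real \<eta> * of_int m)) * cnj (exp (\<i> * of_real \<eta> * z)))
    = cnj (exp_integral c (z + of_int m))"
proof -
  have "(\<lambda>\<eta>. (indicator {..c} \<eta> * exp (- \<i> * of_real \<eta> * of_int m)) * cnj (exp (\<i> * of_real \<eta> * z)))
     = (\<lambda>\<eta>. cnj (if \<eta> \<in> {..c} then exp (\<i> * of_real \<eta> * (z + of_int m)) else 0))"
    by (auto simp: fun_eq_iff indicator_def exp_cnj algebra_simps simp flip: exp_add)
  then have "(LINT \<eta>|lebesgue_on {-pi..pi}. (indicator {..c} \<eta> * exp (- \<i> * of_real \<eta> * of_int m)) * cnj (exp (\<i> * of_real \<eta> * z)))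
     = cnj (LINT \<eta>|lebesgue_on {-pi..pi}. (if \<eta> \<in> {..c} then exp (\<i> * of_real \<eta> * (z + of_int m)) else 0))"
    by (simp only: Bochner_Integration.integral_cnj)
  also have "(LINT \<eta>|lebesgue_on {-pi..pi}. (if \<eta> \<in> {..c} then exp (\<i> * of_real \<eta> * (z + of_int m)) else 0))
     = (LINT \<eta>|lebesgue_on ({..c} \<inter> {-pi..pi}). exp (\<i> * of_real \<eta> * (z + of_int m)))"
    by (rule Lebesgue_Measure.integral_restrict_Int) auto
  also have "{..c} \<inter> {-pi..pi} = {-pi..c}" using assms by auto
  finally show ?thesis by (simp add: exp_integral_def)
qed

text \<open>This is unitarity of the transform against a test function whose own transform is sqrt(2
  pi) exp(i \<eta> z) h for \<eta> <= c and 0 beyond, proved without computing that transform. For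
  partial sums, Fubini turns the m-th term into an integral over the m-th cell, and the cells add up
  to \<Pi>; Cauchy-Schwarz controls the error by fibre norms.\<close>

lemma floquet_pairing:
  assumes u: "u \<in> L2 \<Pi>" and h: "h \<in> A2 cell" and H: "H analytic_on \<Pi>" "\<And>z m. z \<in> cell \<Longrightarrow> H (z + of_int m) = h z"
    and c: "-pi \<le> c" "c \<le> pi"
  shows "integrable (lebesgue_on {-pi..pi}) (\<lambda>\<eta>. L2_inner cell (floquet cell u \<eta>) (\<lambda>z. exp (\<i> * of_real \<eta> * z) * h z))" (is ?I)
    "sqrt (2 * pi) * (LINT \<eta>|lebesgue_on {-pi..pi}. indicator {..c} \<eta> *\<^sub>R L2_inner cell (floquet cell u \<eta>) (\<lambda>z. exp (\<i> * of_real \<eta> * z) * h z))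
      = L2_inner \<Pi> u (\<lambda>z. H z * exp_integral c z)"
proof -
  let ?M = "lebesgue_on {-pi..pi}"
  let ?\<phi> = "shifts u"
  let ?k = "\<lambda>\<eta> z. exp (\<i> * of_real \<eta> * z) * h z"
  let ?T = "\<lambda>N. trig_sum ?\<phi> (int_ball N)"
  let ?n = "\<lambda>N \<eta>. L2_norm cell (\<lambda>z. ?T N \<eta> z - floquet cell u \<eta> z)"
  have hL: "h \<in> L2 cell" using h by (rule A2_L2)
  have \<phi>: "?\<phi> m \<in> L2 cell" for m by (rule shifts_L2_cell[OF u])
  have T: "?T N \<eta> \<in> L2 cell" for N \<eta> by (rule trig_sum_L2) (rule \<phi>)
  have k: "?k \<eta> \<in> L2 cell" for \<eta> by (rule twist_L2(1)[OF hL])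
  have kn: "L2_norm cell (?k \<eta>) \<le> exp (pi * M) * L2_norm cell h" if "\<eta> \<in> {-pi..pi}" for \<eta>
    by (rule L2_bounded_mult(2)[OF hL exp_twist_measurable[OF cell_lebesgue]]) (use norm_exp_twist_le[OF that] in auto)
  define B where "B = exp (pi * M) * L2_norm cell h"
  have d: "norm (L2_inner cell (?T N \<eta>) (?k \<eta>) - L2_inner cell (floquet cell u \<eta>) (?k \<eta>)) \<le> B * ?n N \<eta>"
    if \<eta>: "\<eta> \<in> {-pi..pi}" for N \<eta>
  proof -
    have fl: "floquet cell u \<eta> \<in> L2 cell" by (rule floquet_L2[OF u \<eta>])
    have "norm (L2_inner cell (\<lambda>z. ?T N \<eta> z - floquet cell u \<eta> z) (?k \<eta>)) \<le> ?n N \<eta> * L2_norm cell (?k \<eta>)"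
      by (rule L2_Cauchy_Schwarz[OF L2_diff[OF T fl] k])
    also have "\<dots> \<le> ?n N \<eta> * B" unfolding B_def by (intro mult_left_mono kn \<eta> L2_norm_nonneg)
    finally show ?thesis unfolding L2_inner_diff_left[OF T fl k] by (simp add: mult.commute)
  qed
  have Texp: "L2_inner cell (?T N \<eta>) (?k \<eta>) = (\<Sum>m\<in>int_ball N. 1 / sqrt (2 * pi) * (exp (- \<i> * \<eta> * of_int m) * L2_inner cell (?\<phi> m) (?k \<eta>)))" for N \<eta>
    unfolding L2_inner_trig_sum_left[where \<phi> = ?\<phi>, OF \<phi> k] by (rule sum_distrib_left)
  let ?q = "\<lambda>m \<eta>. indicator {..c} \<eta> * exp (- \<i> * of_real \<eta> * of_int m) :: complex"
  have ne: "norm (exp (- \<i> * complex_of_real \<eta> * of_int m)) = 1" for \<eta> m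
    using norm_exp_i_times[of "- \<eta> * of_int m"] by simp
  have qm: "?q m \<in> borel_measurable borel" for m
    by (intro borel_measurable_times borel_measurable_indicator borel_measurable_continuous_onI continuous_intros) simp
  have q1: "norm (?q m \<eta>) \<le> 1" for m \<eta> using ne[of \<eta> m] by (simp add: norm_mult indicator_def)
  have em: "(\<lambda>\<eta>. exp (- \<i> * of_real \<eta> * of_int m) :: complex) \<in> borel_measurable borel" for m
    by (intro borel_measurable_continuous_onI continuous_intros)
  have Ti: "integrable ?M (\<lambda>\<eta>. L2_inner cell (?T N \<eta>) (?k \<eta>))" for N
    unfolding Texp
    by (intro Bochner_Integration.integrable_sum integrable_mult_right twisted_inner_integral(1)[OF \<phi> hL em]) (simp only: ne order_refl)
  note ni = floquet_integrals(3)[OF u]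
  have "AE \<eta> in ?M. \<eta> \<in> {-pi..pi}" by (rule AE_I2) simp
  then have dAE: "AE \<eta> in ?M. \<forall>N. norm (L2_inner cell (?T N \<eta>) (?k \<eta>) - L2_inner cell (floquet cell u \<eta>) (?k \<eta>)) \<le> B * ?n N \<eta>"
    by eventually_elim (use d in blast)
  obtain r where r: "strict_mono r" "AE \<eta> in ?M. (\<lambda>n. ?n (id (r n)) \<eta>) \<longlonglongrightarrow> 0"
    using floquet_subseq[OF u strict_mono_id] by blast
  \<comment> \<open>Pairings with partial sums are integrable by Fubini and converge almost
    everywhere along a subsequence, which makes the pairing with the chosen transform
    measurable.\<close>
  have fm: "(\<lambda>\<eta>. L2_inner cell (floquet cell u \<eta>) (?k \<eta>)) \<in> borel_measurable ?M"
  proof (rule borel_measurable_AE_LIMSEQ)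
    show "AE \<eta> in ?M. (\<lambda>n. L2_inner cell (?T (r n) \<eta>) (?k \<eta>)) \<longlonglongrightarrow> L2_inner cell (floquet cell u \<eta>) (?k \<eta>)"
      using r(2) dAE
    proof eventually_elim
      case (elim \<eta>)
      have "(\<lambda>n. B * ?n (r n) \<eta>) \<longlonglongrightarrow> 0" using tendsto_mult_left[OF elim(1), of B] by simp
      then have "(\<lambda>n. L2_inner cell (?T (r n) \<eta>) (?k \<eta>) - L2_inner cell (floquet cell u \<eta>) (?k \<eta>)) \<longlonglongrightarrow> 0"
        by (rule Lim_null_comparison[rotated]) (use elim(2) in auto)
      then show ?case by (simp add: LIM_zero_iff)
    qed
  qed (use Ti in auto)
  let ?d = "\<lambda>N \<eta>. L2_inner cell (?T N \<eta>) (?k \<eta>) - L2_inner cell (floquet cell u \<eta>) (?k \<eta>)"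
  have di: "integrable ?M (?d N)" for N
  proof (rule Bochner_Integration.integrable_bound)
    show "integrable ?M (\<lambda>\<eta>. B * ?n N \<eta>)" using ni by simp
    show "?d N \<in> borel_measurable ?M" using fm Ti[of N] by simp
    show "AE \<eta> in ?M. norm (?d N \<eta>) \<le> norm (B * ?n N \<eta>)"
      using dAE by eventually_elim (auto intro: order_trans[OF _ abs_ge_self])
  qed
  show fi: ?I
    using Bochner_Integration.integrable_diff[OF Ti[of 0] di[of 0]] by simp
  let ?i = "\<lambda>\<eta>. indicator {..c} \<eta> :: real"
  have ii: "integrable ?M (\<lambda>\<eta>. ?i \<eta> *\<^sub>R x \<eta>)" if "integrable ?M x" for x :: "real \<Rightarrow> complex"
  proof -
    have "{..c} \<inter> {-pi..pi} \<in> sets ?M" by (auto simp: sets_restrict_space)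
    from integrable_mult_indicator[OF this that] show ?thesis
      by (rule Bochner_Integration.integrable_cong[THEN iffD1, rotated -1]) (auto simp: indicator_def)
  qed
  let ?J = "LINT \<eta>|?M. ?i \<eta> *\<^sub>R L2_inner cell (floquet cell u \<eta>) (?k \<eta>)"
  let ?JN = "\<lambda>N. LINT \<eta>|?M. ?i \<eta> *\<^sub>R L2_inner cell (?T N \<eta>) (?k \<eta>)"
  have "(\<lambda>N. ?JN N - ?J) \<longlonglongrightarrow> 0"
  proof (rule Lim_null_comparison)
    show "(\<lambda>N. B * (LINT \<eta>|?M. ?n N \<eta>)) \<longlonglongrightarrow> 0"
      using tendsto_mult_left[OF floquet_integrals(2)[OF u], of B] by simp
    have "norm (?JN N - ?J) \<le> B * (LINT \<eta>|?M. ?n N \<eta>)" for N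
    proof -
      have "?JN N - ?J = (LINT \<eta>|?M. ?i \<eta> *\<^sub>R ?d N \<eta>)"
        unfolding scaleR_diff_right by (rule Bochner_Integration.integral_diff[symmetric, OF ii[OF Ti] ii[OF fi]])
      then have "norm (?JN N - ?J) \<le> (LINT \<eta>|?M. norm (?i \<eta> *\<^sub>R ?d N \<eta>))"
        using integral_norm_bound[of ?M "\<lambda>\<eta>. ?i \<eta> *\<^sub>R ?d N \<eta>"] by simp
      also have "\<dots> \<le> (LINT \<eta>|?M. B * ?n N \<eta>)"
      proof (rule integral_mono_AE)
        show "integrable ?M (\<lambda>\<eta>. norm (?i \<eta> *\<^sub>R ?d N \<eta>))" by (intro integrable_norm ii di)
        show "integrable ?M (\<lambda>\<eta>. B * ?n N \<eta>)" using ni by simp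
        show "AE \<eta> in ?M. norm (?i \<eta> *\<^sub>R ?d N \<eta>) \<le> B * ?n N \<eta>"
          using dAE by eventually_elim (auto simp: indicator_def intro: order_trans[OF norm_ge_zero])
      qed
      also have "\<dots> = B * (LINT \<eta>|?M. ?n N \<eta>)" by simp
      finally show ?thesis .
    qed
    then show "\<forall>\<^sub>F N in sequentially. norm (?JN N - ?J) \<le> B * (LINT \<eta>|?M. ?n N \<eta>)" by simp
  qed
  then have lim1: "?JN \<longlonglongrightarrow> ?J" by (simp add: LIM_zero_iff)
  let ?g = "\<lambda>z. H z * exp_integral c z"
  have g: "?g \<in> L2 \<Pi>" by (rule A2_L2[OF test_function_A2[OF h H c]])
  have JN: "sqrt (2 * pi) * ?JN N = (\<Sum>m\<in>int_ball N. LINT z|lebesgue_on cell. u (z + of_int m) * cnj (?g (z + of_int m)))" for N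
  proof -
    have "?i \<eta> *\<^sub>R L2_inner cell (?T N \<eta>) (?k \<eta>) = (\<Sum>m\<in>int_ball N. 1 / sqrt (2 * pi) * (?q m \<eta> * L2_inner cell (?\<phi> m) (?k \<eta>)))" for \<eta>
      unfolding Texp scaleR_sum_right by (intro sum.cong refl) (simp add: scaleR_conv_of_real indicator_def)
    then have "?JN N = (LINT \<eta>|?M. (\<Sum>m\<in>int_ball N. 1 / sqrt (2 * pi) * (?q m \<eta> * L2_inner cell (?\<phi> m) (?k \<eta>))))"
      by simp
    also have "\<dots> = (\<Sum>m\<in>int_ball N. LINT \<eta>|?M. 1 / sqrt (2 * pi) * (?q m \<eta> * L2_inner cell (?\<phi> m) (?k \<eta>)))"
      by (intro Bochner_Integration.integral_sum integrable_mult_right twisted_inner_integral(1)[OF \<phi> hL qm q1])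
    also have "\<dots> = (\<Sum>m\<in>int_ball N. 1 / sqrt (2 * pi) * (LINT z|lebesgue_on cell. u (z + of_int m) * cnj (h z) * cnj (exp_integral c (z + of_int m))))"
      unfolding integral_mult_right_zero twisted_inner_integral(2)[OF \<phi> hL qm q1] exp_integral_shift_cnj[OF c(2)] ..
    also have "\<dots> = (\<Sum>m\<in>int_ball N. 1 / sqrt (2 * pi) * (LINT z|lebesgue_on cell. u (z + of_int m) * cnj (?g (z + of_int m))))"
    proof -
      have "(LINT z|lebesgue_on cell. u (z + of_int m) * cnj (h z) * cnj (exp_integral c (z + of_int m)))
          = (LINT z|lebesgue_on cell. u (z + of_int m) * cnj (?g (z + of_int m)))" for m
        by (rule Bochner_Integration.integral_cong) (simp_all add: H(2))
      then show ?thesis by simp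
    qed
    finally have "?JN N = 1 / sqrt (2 * pi) * (\<Sum>m\<in>int_ball N. LINT z|lebesgue_on cell. u (z + of_int m) * cnj (?g (z + of_int m)))"
      by (simp only: sum_distrib_left)
    then show ?thesis by simp
  qed
  have lim2: "(\<lambda>N. sqrt (2 * pi) * ?JN N) \<longlonglongrightarrow> L2_inner \<Pi> u ?g"
    unfolding JN using cell_decomposition[OF L2_inner_integrable[OF u g]] by (simp only: L2_inner_def[of \<Pi>])
  have "(\<lambda>N. sqrt (2 * pi) * ?JN N) \<longlonglongrightarrow> sqrt (2 * pi) * ?J" by (intro tendsto_mult_left lim1)
  with lim2 show "sqrt (2 * pi) * ?J = L2_inner \<Pi> u ?g" by (intro LIMSEQ_unique)
qed

end

section \<open>The Bergman projection in the Floquet picture\<close>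

context periodic_cell
begin

text \<open>Multiplication by \<open>exp (\<i> \<eta> z)\<close> maps the periodic Bergman space onto the \<open>\<eta>\<close>-quasi-periodic one, so
  one countable set serves all \<open>\<eta>\<close> at once.\<close>

definition quasi_determining :: "(complex \<Rightarrow> complex) set \<Rightarrow> bool" where
  "quasi_determining D \<longleftrightarrow> countable D \<and> D \<subseteq> A2_ext a b cell 0 \<and>
    (\<forall>\<eta>. \<forall>v\<in>L2 cell. \<forall>l\<in>A2_quasi a b cell 0.
      (\<forall>h\<in>D. L2_inner cell v (\<lambda>z. exp (\<i> * of_real \<eta> * z) * h z) = L2_inner cell l h) \<longrightarrow>
      (\<forall>k\<in>A2_quasi a b cell \<eta>. L2_inner cell v k = L2_inner cell l (\<lambda>z. exp (\<i> * of_real (- \<eta>) * z) * k z)))"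

lemma quasi_determiningD:
  assumes "quasi_determining D"
  shows "countable D" "D \<subseteq> A2_ext a b cell 0"
    "v \<in> L2 cell \<Longrightarrow> l \<in> A2_quasi a b cell 0 \<Longrightarrow>
      (\<And>h. h \<in> D \<Longrightarrow> L2_inner cell v (\<lambda>z. exp (\<i> * of_real \<eta> * z) * h z) = L2_inner cell l h) \<Longrightarrow>
      k \<in> A2_quasi a b cell \<eta> \<Longrightarrow> L2_inner cell v k = L2_inner cell l (\<lambda>z. exp (\<i> * of_real (- \<eta>) * z) * k z)"
  using assms unfolding quasi_determining_def by simp_all

text \<open>Multiplication by exp(i \<eta> z) is not unitary, its modulus being exp(-\<eta> Im z),
  so it is moved to v as its adjoint; the determining set for \<eta> = 0 then applies to the
  difference of \<open>w\<close> and \<open>l\<close>. Allowing l other than 0 serves the kernels,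
  where the pairing is an evaluation.\<close>

lemma quasi_determining_exists: "\<exists>D. quasi_determining D"
proof -
  obtain D where D: "countable D" "D \<subseteq> A2_ext a b cell 0"
    "\<And>v h. v \<in> L2 cell \<Longrightarrow> (\<And>g. g \<in> D \<Longrightarrow> L2_inner cell v g = 0) \<Longrightarrow> h \<in> A2_quasi a b cell 0 \<Longrightarrow> L2_inner cell v h = 0"
    using countable_determining_set[OF open_cell A2_quasi_closed_subspace A2_ext_subset_quasi A2_quasi_approx] by blast
  have "quasi_determining D"
    unfolding quasi_determining_def
  proof (intro conjI D(1,2) allI ballI impI)
    fix \<eta> v l k
    assume v: "v \<in> L2 cell" and l: "l \<in> A2_quasi a b cell 0" and k: "k \<in> A2_quasi a b cell \<eta>"
      and eq: "\<forall>h\<in>D. L2_inner cell v (\<lambda>z. exp (\<i> * of_real \<eta> * z) * h z) = L2_inner cell l h"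
    have lL: "l \<in> L2 cell" using l by (intro A2_L2 A2_quasi_A2)
    define w where "w = (\<lambda>z. cnj (exp (\<i> * of_real \<eta> * z)) * v z)"
    have wL: "w \<in> L2 cell"
      using L2_cnj[OF twist_L2(1)[OF L2_cnj[OF v], of \<eta>]] by (simp add: w_def)
    have wi: "L2_inner cell w g = L2_inner cell v (\<lambda>z. exp (\<i> * of_real \<eta> * z) * g z)" for g
      unfolding L2_inner_def w_def by (simp add: mult_ac)
    let ?k = "\<lambda>z. exp (\<i> * of_real (- \<eta>) * z) * k z"
    have k0: "?k \<in> A2_quasi a b cell 0" using A2_quasi_twist[OF k, of "- \<eta>"] by simp
    then have kL: "?k \<in> L2 cell" by (intro A2_L2 A2_quasi_A2)
    have "L2_inner cell (\<lambda>z. w z - l z) g = 0" if "g \<in> D" for g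
    proof -
      have "g \<in> L2 cell" using that D(2) A2_ext_A2 A2_L2 by blast
      then show ?thesis using bspec[OF eq that] by (simp add: L2_inner_diff_left wL lL wi)
    qed
    then have "L2_inner cell (\<lambda>z. w z - l z) ?k = 0" using D(3)[OF L2_diff[OF wL lL] _ k0] by blast
    then have "L2_inner cell w ?k = L2_inner cell l ?k" unfolding L2_inner_diff_left[OF wL lL kL] by simp
    moreover have "(\<lambda>z. exp (\<i> * of_real \<eta> * z) * ?k z) = k"
      by (simp add: fun_eq_iff mult.assoc[symmetric] exp_add[symmetric])
    ultimately show "L2_inner cell v k = L2_inner cell l ?k" unfolding wi by simp
  qed
  then show ?thesis ..
qed

text \<open>Pairings on \<Pi> give access only to integrals over \<eta> <= c; letting c vary
  recovers the integrand almost everywhere. The null set depends on h, so this is applied to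
  countably many h.\<close>

lemma AE_floquet_eq:
  fixes q :: "real \<Rightarrow> complex"
  assumes u: "u \<in> L2 \<Pi>" and h: "h \<in> A2_ext a b cell 0"
    and q: "integrable (lebesgue_on {-pi..pi}) q"
    and eq: "\<And>H c. H analytic_on \<Pi> \<Longrightarrow> (\<And>z m. z \<in> cell \<Longrightarrow> H (z + of_int m) = h z) \<Longrightarrow> -pi \<le> c \<Longrightarrow> c \<le> pi \<Longrightarrow>
      sqrt (2 * pi) * (LINT \<eta>|lebesgue_on {-pi..pi}. indicator {..c} \<eta> *\<^sub>R q \<eta>) = L2_inner \<Pi> u (\<lambda>z. H z * exp_integral c z)"
  shows "AE \<eta> in lebesgue_on {-pi..pi}. L2_inner cell (floquet cell u \<eta>) (\<lambda>z. exp (\<i> * of_real \<eta> * z) * h z) = q \<eta>"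
proof -
  let ?M = "lebesgue_on {-pi..pi}"
  obtain H where H: "H analytic_on \<Pi>" "\<And>z m. z \<in> cell \<Longrightarrow> H (z + of_int m) = h z"
    using periodic_extension[OF h] by blast
  have hA: "h \<in> A2 cell" using h by (rule A2_ext_A2)
  let ?p = "\<lambda>\<eta>. L2_inner cell (floquet cell u \<eta>) (\<lambda>z. exp (\<i> * of_real \<eta> * z) * h z)"
  have p: "integrable ?M ?p" by (rule floquet_pairing(1)[OF u hA H, of pi]) auto
  have ind: "integrable ?M (\<lambda>\<eta>. indicator {..c} \<eta> *\<^sub>R x \<eta>)" if "integrable ?M x" for x :: "real \<Rightarrow> complex" and c
  proof -
    have "{..c} \<inter> {-pi..pi} \<in> sets ?M" by (auto simp: sets_restrict_space)
    from integrable_mult_indicator[OF this that] show ?thesis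
      by (rule Bochner_Integration.integrable_cong[THEN iffD1, rotated -1]) (auto simp: indicator_def)
  qed
  have "AE \<eta> in ?M. ?p \<eta> - q \<eta> = 0"
  proof (rule integral_zero_initial_imp_AE_zero)
    show "integrable ?M (\<lambda>\<eta>. ?p \<eta> - q \<eta>)" using p q by simp
    fix c assume c: "-pi \<le> c" "c \<le> pi"
    have "sqrt (2 * pi) * (LINT \<eta>|?M. indicator {..c} \<eta> *\<^sub>R (?p \<eta> - q \<eta>))
      = sqrt (2 * pi) * (LINT \<eta>|?M. indicator {..c} \<eta> *\<^sub>R ?p \<eta>) - sqrt (2 * pi) * (LINT \<eta>|?M. indicator {..c} \<eta> *\<^sub>R q \<eta>)"
      unfolding scaleR_diff_right Bochner_Integration.integral_diff[OF ind[OF p] ind[OF q]] by (rule right_diff_distrib)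
    also have "\<dots> = 0" using floquet_pairing(2)[OF u hA H c] eq[OF H c] by simp
    finally show "(LINT \<eta>|?M. indicator {..c} \<eta> *\<^sub>R (?p \<eta> - q \<eta>)) = 0" by simp
  qed
  then show ?thesis by simp
qed

section \<open>Fibres of the Bergman projection and of its kernel\<close>

lemma bergman_proj_A2: "f \<in> L2 \<Pi> \<Longrightarrow> bergman_proj \<Pi> f \<in> A2 \<Pi>"
  unfolding bergman_proj_def by (rule orth_proj_in[OF open_Pdom A2_closed_subspace_A2])

lemma quasi_proj_A2: "f \<in> L2 cell \<Longrightarrow> quasi_proj a b cell \<eta> f \<in> A2 cell"
  unfolding quasi_proj_def using orth_proj_in[OF open_cell A2_quasi_closed_subspace] A2_quasi_A2 by blast

lemma AE_lebesgue_on_pi: "AE \<eta> in lebesgue_on {-pi..pi}. \<eta> \<in> {-pi..pi}"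
  by (rule AE_I2) simp

text \<open>f and its Bergman projection pair equally with all test functions, so the difference of
  their transforms is orthogonal to \<open>A2_quasi\<close> in almost every fibre. Together with
  membership of the projected fibre in \<open>A2_ext\<close> this characterises P_\<eta>. The
  analytic \<open>p\<close> stands in for the fibre, since membership concerns functions and not
  classes.\<close>

lemma floquet_bergman_proj:
  assumes f: "f \<in> L2 \<Pi>"
  shows "AE \<eta> in lebesgue_on {-pi..pi}. AE z in lebesgue_on cell.
    floquet cell (bergman_proj \<Pi> f) \<eta> z = quasi_proj a b cell \<eta> (floquet cell f \<eta>) z"
proof -
  let ?M = "lebesgue_on {-pi..pi}"
  define g where "g = bergman_proj \<Pi> f"
  have gA: "g \<in> A2 \<Pi>" unfolding g_def by (rule bergman_proj_A2[OF f])
  then have gL: "g \<in> L2 \<Pi>" by (rule A2_L2)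
  have orth: "L2_inner \<Pi> f k = L2_inner \<Pi> g k" if "k \<in> A2 \<Pi>" for k
    using L2_inner_orth_proj[OF open_Pdom A2_closed_subspace_A2 f that] by (simp add: g_def bergman_proj_def)
  obtain D where "quasi_determining D" using quasi_determining_exists ..
  note D = quasi_determiningD[OF this]
  have *: "AE \<eta> in ?M. L2_inner cell (floquet cell f \<eta>) (\<lambda>z. exp (\<i> * of_real \<eta> * z) * h z)
      = L2_inner cell (floquet cell g \<eta>) (\<lambda>z. exp (\<i> * of_real \<eta> * z) * h z)" if "h \<in> D" for h
  proof -
    have h: "h \<in> A2_ext a b cell 0" using that D(2) by blast
    then have hA: "h \<in> A2 cell" by (rule A2_ext_A2)
    show ?thesis
    proof (rule AE_floquet_eq[OF f h])
      obtain H where H: "H analytic_on \<Pi>" "\<And>z m. z \<in> cell \<Longrightarrow> H (z + of_int m) = h z"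
        using periodic_extension[OF h] by blast
      show "integrable ?M (\<lambda>\<eta>. L2_inner cell (floquet cell g \<eta>) (\<lambda>z. exp (\<i> * of_real \<eta> * z) * h z))"
        by (rule floquet_pairing(1)[OF gL hA H, of pi]) auto
      fix H c assume H: "H analytic_on \<Pi>" "\<And>z m. z \<in> cell \<Longrightarrow> H (z + of_int m) = h z" and c: "-pi \<le> c" "c \<le> pi"
      show "sqrt (2 * pi) * (LINT \<eta>|?M. indicator {..c} \<eta> *\<^sub>R L2_inner cell (floquet cell g \<eta>) (\<lambda>z. exp (\<i> * of_real \<eta> * z) * h z))
          = L2_inner \<Pi> f (\<lambda>z. H z * exp_integral c z)"
      proof -
        have "sqrt (2 * pi) * (LINT \<eta>|?M. indicator {..c} \<eta> *\<^sub>R L2_inner cell (floquet cell g \<eta>) (\<lambda>z. exp (\<i> * of_real \<eta> * z) * h z))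
          = L2_inner \<Pi> g (\<lambda>z. H z * exp_integral c z)"
          by (rule floquet_pairing(2)[OF gL hA H c])
        also have "\<dots> = L2_inner \<Pi> f (\<lambda>z. H z * exp_integral c z)"
          by (rule orth[OF test_function_A2[OF hA H c], symmetric])
        finally show ?thesis .
      qed
    qed
  qed
  have "AE \<eta> in ?M. \<forall>h\<in>D. L2_inner cell (floquet cell f \<eta>) (\<lambda>z. exp (\<i> * of_real \<eta> * z) * h z)
      = L2_inner cell (floquet cell g \<eta>) (\<lambda>z. exp (\<i> * of_real \<eta> * z) * h z)"
    by (subst AE_ball_countable[OF D(1)], rule ballI, rule *)
  then have "AE \<eta> in ?M. AE z in lebesgue_on cell. floquet cell g \<eta> z = quasi_proj a b cell \<eta> (floquet cell f \<eta>) z"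
    using floquet_A2_ext[OF gA] AE_lebesgue_on_pi
  proof eventually_elim
    case (elim \<eta>)
    have fL: "floquet cell f \<eta> \<in> L2 cell" and gL': "floquet cell g \<eta> \<in> L2 cell"
      by (rule floquet_L2[OF _ elim(3)], rule f gL)+
    obtain p where p: "p \<in> A2_ext a b cell \<eta>" "AE z in lebesgue_on cell. floquet cell g \<eta> z = p z" using elim(2) by blast
    have pL: "p \<in> L2 cell" using p(1) by (intro A2_L2 A2_ext_A2)
    have z0: "(\<lambda>z. 0) \<in> A2_quasi a b cell 0" using A2_ext_subset_quasi A2_ext_zero by blast
    have "L2_inner cell (\<lambda>z. floquet cell f \<eta> z - p z) k = 0" if k: "k \<in> A2_quasi a b cell \<eta>" for k
    proof -
      have kL: "k \<in> L2 cell" using k by (intro A2_L2 A2_quasi_A2)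
      \<comment> \<open>The determining property with l = 0: orthogonality to the twisted countable
        family extends to \<open>A2_quasi\<close>.\<close>
      have "L2_inner cell (\<lambda>z. floquet cell f \<eta> z - floquet cell g \<eta> z) k
          = L2_inner cell (\<lambda>z. 0) (\<lambda>z. exp (\<i> * of_real (- \<eta>) * z) * k z)"
      proof (rule D(3)[OF L2_diff[OF fL gL'] z0 _ k])
        fix h assume hD: "h \<in> D"
        then have "(\<lambda>z. exp (\<i> * of_real \<eta> * z) * h z) \<in> L2 cell" using D(2) by (intro twist_L2(1) A2_L2 A2_ext_A2) blast
        from L2_inner_diff_left[OF fL gL' this]
        show "L2_inner cell (\<lambda>z. floquet cell f \<eta> z - floquet cell g \<eta> z) (\<lambda>z. exp (\<i> * of_real \<eta> * z) * h z)
            = L2_inner cell (\<lambda>z. 0) h"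
          using elim(1) hD by (simp add: L2_inner_def[of cell "\<lambda>z. 0"])
      qed
      also have "\<dots> = 0" by (simp add: L2_inner_def)
      finally have "L2_inner cell (floquet cell f \<eta>) k = L2_inner cell (floquet cell g \<eta>) k"
        unfolding L2_inner_diff_left[OF fL gL' kL] by simp
      also have "\<dots> = L2_inner cell p k" by (rule L2_inner_cong_AE[OF gL' pL kL p(2)])
      finally show ?thesis unfolding L2_inner_diff_left[OF fL pL kL] by simp
    qed
    then have "quasi_proj a b cell \<eta> (floquet cell f \<eta>) z = p z" if "z \<in> cell" for z
      unfolding quasi_proj_def using p(1) A2_ext_subset_quasi
      by (intro orth_proj_eqI[OF open_cell A2_quasi_closed_subspace fL] that) auto
    moreover have "AE z in lebesgue_on cell. z \<in> cell" by (rule AE_I2) simp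
    ultimately show ?case using p(2) by (auto elim: eventually_elim2)
  qed
  then show ?thesis unfolding g_def .
qed

lemma bergman_proj_inversion:
  assumes f: "f \<in> L2 \<Pi>" and w: "w \<in> cell"
  shows "integrable (lebesgue_on {-pi..pi}) (\<lambda>\<eta>. exp (\<i> * of_real \<eta> * of_int m) * quasi_proj a b cell \<eta> (floquet cell f \<eta>) w)"
    "(LINT \<eta>|lebesgue_on {-pi..pi}. exp (\<i> * of_real \<eta> * of_int m) * quasi_proj a b cell \<eta> (floquet cell f \<eta>) w)
      = sqrt (2 * pi) * bergman_proj \<Pi> f (w + of_int m)"
proof -
  have "AE \<eta> in lebesgue_on {-pi..pi}. quasi_proj a b cell \<eta> (floquet cell f \<eta>) analytic_on cell \<and>
    (AE z in lebesgue_on cell. floquet cell (bergman_proj \<Pi> f) \<eta> z = quasi_proj a b cell \<eta> (floquet cell f \<eta>) z)"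
    using floquet_bergman_proj[OF f] AE_lebesgue_on_pi
    by eventually_elim (use A2_analytic quasi_proj_A2 floquet_L2 f in blast)
  note * = floquet_A2_inversion[OF bergman_proj_A2[OF f] w this]
  show "integrable (lebesgue_on {-pi..pi}) (\<lambda>\<eta>. exp (\<i> * of_real \<eta> * of_int m) * quasi_proj a b cell \<eta> (floquet cell f \<eta>) w)"
    "(LINT \<eta>|lebesgue_on {-pi..pi}. exp (\<i> * of_real \<eta> * of_int m) * quasi_proj a b cell \<eta> (floquet cell f \<eta>) w)
      = sqrt (2 * pi) * bergman_proj \<Pi> f (w + of_int m)"
    by (rule *)+
qed

text \<open>The conjugate of the reproducing kernel of \<open>A2_quasi\<close> meets all
  requirements of the choice: the kernel is analytic, and since it lies in the space, projecting f
  does not change the inner product with it.\<close>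

lemma quasi_kernel_spec:
  assumes z: "z \<in> cell"
  shows "quasi_kernel a b cell \<eta> z \<in> L2 cell" "(\<lambda>w. cnj (quasi_kernel a b cell \<eta> z w)) analytic_on cell"
    "f \<in> L2 cell \<Longrightarrow> quasi_proj a b cell \<eta> f z = L2_inner cell f (\<lambda>w. cnj (quasi_kernel a b cell \<eta> z w))"
proof -
  let ?V = "A2_quasi a b cell \<eta>"
  have "\<forall>z\<in>cell. \<exists>k. k \<in> ?V \<and> (\<forall>f\<in>?V. f z = L2_inner cell f k)"
    using reproducing_kernel_exists[OF open_cell A2_quasi_closed_subspace] by metis
  then obtain k where k: "\<And>z. z \<in> cell \<Longrightarrow> k z \<in> ?V" "\<And>z f. z \<in> cell \<Longrightarrow> f \<in> ?V \<Longrightarrow> f z = L2_inner cell f (k z)"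
    by metis
  have "\<forall>z\<in>cell. (\<lambda>w. cnj (k z w)) \<in> L2 cell \<and> (\<lambda>w. cnj (cnj (k z w))) analytic_on cell \<and>
      (\<forall>f\<in>L2 cell. quasi_proj a b cell \<eta> f z = (LINT w|lebesgue_on cell. cnj (k z w) * f w))"
  proof (intro ballI conjI)
    fix z assume z: "z \<in> cell"
    have kA: "k z \<in> A2 cell" using k(1)[OF z] by (rule A2_quasi_A2)
    show "(\<lambda>w. cnj (k z w)) \<in> L2 cell" by (rule L2_cnj[OF A2_L2[OF kA]])
    show "(\<lambda>w. cnj (cnj (k z w))) analytic_on cell" using A2_analytic[OF kA] by simp
    fix f assume f: "f \<in> L2 cell"
    have "quasi_proj a b cell \<eta> f z = L2_inner cell (quasi_proj a b cell \<eta> f) (k z)"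
      unfolding quasi_proj_def by (intro k(2) z orth_proj_in[OF open_cell A2_quasi_closed_subspace f])
    also have "\<dots> = L2_inner cell f (k z)"
      unfolding quasi_proj_def by (rule L2_inner_orth_proj[OF open_cell A2_quasi_closed_subspace f k(1)[OF z]])
    finally show "quasi_proj a b cell \<eta> f z = (LINT w|lebesgue_on cell. cnj (k z w) * f w)"
      by (simp add: L2_inner_def mult.commute)
  qed
  then have "\<exists>K. \<forall>z\<in>cell. K z \<in> L2 cell \<and> (\<lambda>w. cnj (K z w)) analytic_on cell \<and>
      (\<forall>f\<in>L2 cell. quasi_proj a b cell \<eta> f z = (LINT w|lebesgue_on cell. K z w * f w))"
    by (intro exI[of _ "\<lambda>z w. cnj (k z w)"])
  from someI_ex[OF this] z
  have *: "quasi_kernel a b cell \<eta> z \<in> L2 cell" "(\<lambda>w. cnj (quasi_kernel a b cell \<eta> z w)) analytic_on cell"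
    "\<forall>f\<in>L2 cell. quasi_proj a b cell \<eta> f z = (LINT w|lebesgue_on cell. quasi_kernel a b cell \<eta> z w * f w)"
    unfolding quasi_kernel_def[symmetric] by blast+
  show "quasi_kernel a b cell \<eta> z \<in> L2 cell" "(\<lambda>w. cnj (quasi_kernel a b cell \<eta> z w)) analytic_on cell"
    by (rule *)+
  show "quasi_proj a b cell \<eta> f z = L2_inner cell f (\<lambda>w. cnj (quasi_kernel a b cell \<eta> z w))" if "f \<in> L2 cell"
    using *(3) that by (simp add: L2_inner_def mult.commute)
qed

text \<open>Pairing \<kappa> with a test function evaluates it at z + m, giving cnj (h z) times the
  conjugate of \<open>exp_integral c (z + m)\<close>, itself an integral over \<eta> <= c. Comparing
  integrands shows that almost every fibre of \<kappa> represents the functional sending k to exp(i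
  \<eta> m) k(z) / sqrt(2 pi) on \<open>A2_quasi\<close>, which makes it a multiple of the
  conjugated kernel.\<close>

lemma floquet_reproducing_kernel:
  assumes z: "z \<in> cell" and \<kappa>: "\<kappa> \<in> A2 \<Pi>" "\<forall>g\<in>A2 \<Pi>. g (z + of_int m) = L2_inner \<Pi> g \<kappa>"
  shows "AE \<eta> in lebesgue_on {-pi..pi}. AE w in lebesgue_on cell.
    floquet cell \<kappa> \<eta> w = exp (- \<i> * of_real \<eta> * of_int m) / sqrt (2 * pi) * cnj (quasi_kernel a b cell \<eta> z w)"
proof -
  let ?M = "lebesgue_on {-pi..pi}"
  let ?s = "complex_of_real (sqrt (2 * pi))"
  have s0: "?s \<noteq> 0" by simp
  have \<kappa>L: "\<kappa> \<in> L2 \<Pi>" using \<kappa>(1) by (rule A2_L2)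
  obtain D where "quasi_determining D" using quasi_determining_exists ..
  note D = quasi_determiningD[OF this]
  let ?W = "A2_quasi a b cell 0"
  \<comment> \<open>The kernel of the periodic space at z; a multiple of it plays the part of l in
    the determining property.\<close>
  obtain k0 where k0: "k0 \<in> ?W" "\<And>f. f \<in> ?W \<Longrightarrow> f z = L2_inner cell f k0"
    using reproducing_kernel_exists[OF open_cell A2_quasi_closed_subspace z] by metis
  have k0': "L2_inner cell k0 f = cnj (f z)" if "f \<in> ?W" for f
    using k0(2)[OF that] L2_inner_commute[of cell k0 f] by simp
  \<comment> \<open>The twist evaluated at z joins the phase of the translation by m; both are
    conjugated because \<kappa> stands on the left of the inner product.\<close>
  let ?c = "\<lambda>\<eta>. cnj (exp (\<i> * of_real \<eta> * (z + of_int m))) / ?s"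
  have ci: "integrable ?M ?c"
    by (intro continuous_integrable_lebesgue_on continuous_intros) auto
  have *: "AE \<eta> in ?M. L2_inner cell (floquet cell \<kappa> \<eta>) (\<lambda>z. exp (\<i> * of_real \<eta> * z) * h z) = ?c \<eta> * cnj (h z)"
    if "h \<in> D" for h
  proof -
    have h: "h \<in> A2_ext a b cell 0" using that D(2) by blast
    then have hA: "h \<in> A2 cell" by (rule A2_ext_A2)
    show ?thesis
    proof (rule AE_floquet_eq[OF \<kappa>L h])
      show "integrable ?M (\<lambda>\<eta>. ?c \<eta> * cnj (h z))" by (rule integrable_mult_left[OF ci])
      fix H c assume H: "H analytic_on \<Pi>" "\<And>z m. z \<in> cell \<Longrightarrow> H (z + of_int m) = h z" and c: "-pi \<le> c" "c \<le> pi"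
      let ?g = "\<lambda>z. H z * exp_integral c z"
      have g: "?g \<in> A2 \<Pi>" by (rule test_function_A2[OF hA H c])
      have "L2_inner \<Pi> \<kappa> ?g = cnj (?g (z + of_int m))"
        using bspec[OF \<kappa>(2) g] L2_inner_commute[of \<Pi> \<kappa> ?g] by simp
      also have "\<dots> = cnj (h z) * cnj (exp_integral c (z + of_int m))" using H(2)[OF z] by simp
      also have "cnj (exp_integral c (z + of_int m)) = (LINT \<eta>|?M. ?s * (indicator {..c} \<eta> *\<^sub>R ?c \<eta>))"
        unfolding exp_integral_shift_cnj[OF c(2), symmetric]
        by (intro Bochner_Integration.integral_cong refl)
          (auto simp: indicator_def exp_cnj algebra_simps simp flip: exp_add)
      also have "\<dots> = ?s * (LINT \<eta>|?M. indicator {..c} \<eta> *\<^sub>R ?c \<eta>)" by (rule integral_mult_right_zero)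
      also have "cnj (h z) * (?s * (LINT \<eta>|?M. indicator {..c} \<eta> *\<^sub>R ?c \<eta>))
          = ?s * ((LINT \<eta>|?M. indicator {..c} \<eta> *\<^sub>R ?c \<eta>) * cnj (h z))" by (simp only: mult_ac)
      also have "(LINT \<eta>|?M. indicator {..c} \<eta> *\<^sub>R ?c \<eta>) * cnj (h z) = (LINT \<eta>|?M. indicator {..c} \<eta> *\<^sub>R (?c \<eta> * cnj (h z)))"
        unfolding integral_mult_left_zero[symmetric] mult_scaleR_left ..
      finally show "?s * (LINT \<eta>|?M. indicator {..c} \<eta> *\<^sub>R (?c \<eta> * cnj (h z))) = L2_inner \<Pi> \<kappa> ?g" ..
    qed
  qed
  have "AE \<eta> in ?M. \<forall>h\<in>D. L2_inner cell (floquet cell \<kappa> \<eta>) (\<lambda>z. exp (\<i> * of_real \<eta> * z) * h z) = ?c \<eta> * cnj (h z)"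
    by (subst AE_ball_countable[OF D(1)], rule ballI, rule *)
  then show ?thesis using floquet_A2_ext[OF \<kappa>(1)] AE_lebesgue_on_pi
  proof eventually_elim
    case (elim \<eta>)
    let ?V = "A2_quasi a b cell \<eta>"
    have \<kappa>L': "floquet cell \<kappa> \<eta> \<in> L2 cell" by (rule floquet_L2[OF \<kappa>L elim(3)])
    obtain p where p: "p \<in> A2_ext a b cell \<eta>" "AE w in lebesgue_on cell. floquet cell \<kappa> \<eta> w = p w" using elim(2) by blast
    have pV: "p \<in> ?V" using p(1) A2_ext_subset_quasi by blast
    then have pA: "p \<in> A2 cell" by (rule A2_quasi_A2)
    then have pL: "p \<in> L2 cell" by (rule A2_L2)
    let ?e = "exp (\<i> * of_real \<eta> * of_int m)"
    have pk: "?s * L2_inner cell k p = ?e * k z" if k: "k \<in> ?V" for k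
    proof -
      have kL: "k \<in> L2 cell" using k by (intro A2_L2 A2_quasi_A2)
      let ?k = "\<lambda>z. exp (\<i> * of_real (- \<eta>) * z) * k z"
      have kV0: "?k \<in> ?W" using A2_quasi_twist[OF k, of "- \<eta>"] by simp
      have "L2_inner cell (floquet cell \<kappa> \<eta>) k = L2_inner cell (\<lambda>w. ?c \<eta> * k0 w) ?k"
      proof (rule D(3)[OF \<kappa>L' _ _ k])
        show "(\<lambda>w. ?c \<eta> * k0 w) \<in> ?W" by (rule A2_closed_subspaceD(5)[OF A2_quasi_closed_subspace k0(1)])
        fix h assume hD: "h \<in> D"
        then have "h \<in> ?W" using D(2) A2_ext_subset_quasi by blast
        then show "L2_inner cell (floquet cell \<kappa> \<eta>) (\<lambda>z. exp (\<i> * of_real \<eta> * z) * h z) = L2_inner cell (\<lambda>w. ?c \<eta> * k0 w) h"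
          unfolding L2_inner_cmult_left using elim(1) hD k0' by simp
      qed
      also have "\<dots> = ?c \<eta> * cnj (?k z)" unfolding L2_inner_cmult_left k0'[OF kV0] ..
      finally have "L2_inner cell p k = ?c \<eta> * cnj (?k z)"
        using L2_inner_cong_AE[OF \<kappa>L' pL kL p(2)] by simp
      then have "L2_inner cell k p = cnj (?c \<eta>) * ?k z"
        using L2_inner_commute[of cell k p] by simp
      moreover have "exp (\<i> * of_real \<eta> * (z + of_int m)) * exp (\<i> * of_real (- \<eta>) * z) = ?e"
        unfolding exp_add[symmetric] by (simp add: algebra_simps)
      ultimately show ?thesis by simp
    qed
    define K where "K = (\<lambda>w. cnj (quasi_kernel a b cell \<eta> z w))"
    have K: "K analytic_on cell" "K \<in> L2 cell" "\<And>f. f \<in> L2 cell \<Longrightarrow> quasi_proj a b cell \<eta> f z = L2_inner cell f K"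
      unfolding K_def using quasi_kernel_spec[OF z] L2_cnj by auto
    let ?r = "cnj ?e / ?s"
    \<comment> \<open>Stated for all of \<open>L2 cell\<close>: the chosen kernel is known to be
      square-integrable and analytic, but its membership in \<open>A2_quasi\<close> is not at hand,
      and f is to be the difference \<open>?d\<close>.\<close>
    have inner: "L2_inner cell f p = L2_inner cell f (\<lambda>w. ?r * K w)" if f: "f \<in> L2 cell" for f
    proof -
      let ?P = "quasi_proj a b cell \<eta> f"
      have PV: "?P \<in> ?V" unfolding quasi_proj_def by (rule orth_proj_in[OF open_cell A2_quasi_closed_subspace f])
      have "?s * L2_inner cell f p = ?s * L2_inner cell ?P p"
        unfolding quasi_proj_def L2_inner_orth_proj[OF open_cell A2_quasi_closed_subspace f pV] ..
      also have "\<dots> = ?e * L2_inner cell f K" using pk[OF PV] K(3)[OF f] by simp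
      finally have "L2_inner cell f p = ?e / ?s * L2_inner cell f K" using s0 by (simp add: field_simps)
      then show ?thesis unfolding L2_inner_cmult_right by simp
    qed
    have rK: "(\<lambda>w. ?r * K w) \<in> L2 cell" by (rule L2_cmult[OF K(2)])
    let ?d = "\<lambda>w. p w - ?r * K w"
    have d: "?d \<in> L2 cell" by (rule L2_diff[OF pL rK])
    have "L2_inner cell ?d ?d = 0"
      unfolding L2_inner_diff_right[OF pL rK d] inner[OF d] by simp
    then have "L2_norm cell ?d = 0" by (simp add: L2_inner_self)
    then have "AE w in lebesgue_on cell. p w = ?r * K w" using L2_norm_eq_0_iff[OF d] by simp
    moreover have "cnj ?e = exp (- \<i> * of_real \<eta> * of_int m)" by (simp add: exp_cnj)
    ultimately show ?case using p(2) unfolding K_def by (auto elim: eventually_elim2)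
  qed
qed

text \<open>Inversion of the transform of \<kappa> at w + n, conjugated. One factor sqrt(2 pi) comes
  from the fibre formula and one from inversion. Anti-analyticity of the kernel in its second
  variable provides the analytic representatives that make the formula valid at every w in the
  cell.\<close>

lemma quasi_kernel_inversion:
  assumes z: "z \<in> cell" and \<kappa>: "\<kappa> \<in> A2 \<Pi>" "\<forall>g\<in>A2 \<Pi>. g (z + of_int m) = L2_inner \<Pi> g \<kappa>" and w: "w \<in> cell"
  shows "integrable (lebesgue_on {-pi..pi}) (\<lambda>\<eta>. exp (\<i> * of_real \<eta> * (of_int m - of_int n)) * quasi_kernel a b cell \<eta> z w)"
    "(LINT \<eta>|lebesgue_on {-pi..pi}. exp (\<i> * of_real \<eta> * (of_int m - of_int n)) * quasi_kernel a b cell \<eta> z w)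
      = 2 * pi * cnj (\<kappa> (w + of_int n))"
proof -
  let ?M = "lebesgue_on {-pi..pi}"
  let ?s = "complex_of_real (sqrt (2 * pi))"
  let ?p = "\<lambda>\<eta> w. exp (- \<i> * of_real \<eta> * of_int m) / ?s * cnj (quasi_kernel a b cell \<eta> z w)"
  have "AE \<eta> in ?M. ?p \<eta> analytic_on cell \<and> (AE w in lebesgue_on cell. floquet cell \<kappa> \<eta> w = ?p \<eta> w)"
    using floquet_reproducing_kernel[OF z \<kappa>]
  proof eventually_elim
    case (elim \<eta>)
    show ?case
      by (intro conjI elim analytic_on_mult analytic_on_const quasi_kernel_spec(2)[OF z])
  qed
  note * = floquet_A2_inversion[OF \<kappa>(1) w this, of n]
  have eq: "exp (\<i> * of_real \<eta> * (of_int m - of_int n)) * quasi_kernel a b cell \<eta> z w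
      = ?s * cnj (exp (\<i> * of_real \<eta> * of_int n) * ?p \<eta> w)" for \<eta>
  proof -
    have "exp (\<i> * of_real \<eta> * (of_int m - of_int n)) = cnj (exp (\<i> * of_real \<eta> * of_int n)) * cnj (exp (- \<i> * of_real \<eta> * of_int m))"
      by (simp add: exp_cnj algebra_simps flip: exp_add)
    then show ?thesis by simp
  qed
  show "integrable ?M (\<lambda>\<eta>. exp (\<i> * of_real \<eta> * (of_int m - of_int n)) * quasi_kernel a b cell \<eta> z w)"
    unfolding eq by (intro integrable_mult_right integrable_cnj *(1))
  have "(LINT \<eta>|?M. exp (\<i> * of_real \<eta> * (of_int m - of_int n)) * quasi_kernel a b cell \<eta> z w)
      = ?s * cnj (?s * \<kappa> (w + of_int n))"
    unfolding eq integral_mult_right_zero Bochner_Integration.integral_cnj *(2) ..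
  also have "\<dots> = of_real (sqrt (2 * pi) * sqrt (2 * pi)) * cnj (\<kappa> (w + of_int n))"
    unfolding of_real_mult by simp
  also have "sqrt (2 * pi) * sqrt (2 * pi) = 2 * pi" by simp
  finally show "(LINT \<eta>|?M. exp (\<i> * of_real \<eta> * (of_int m - of_int n)) * quasi_kernel a b cell \<eta> z w)
      = 2 * pi * cnj (\<kappa> (w + of_int n))" by simp
qed

text \<open>Parseval for partial sums of f - g: their squared norms integrate to a sum over cells
  that tends to the squared norm on \<Pi>, while they are bounded by the errors of the two
  transforms. These are treated separately since \<open>floquet\<close> is a choice and not
  literally linear.\<close>

lemma floquet_unique:
  assumes f: "f \<in> L2 \<Pi>" and g: "g \<in> L2 \<Pi>"
    and eq: "AE \<eta> in lebesgue_on {-pi..pi}. AE z in lebesgue_on cell. floquet cell f \<eta> z = floquet cell g \<eta> z"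
  shows "AE z in lebesgue_on \<Pi>. f z = g z"
proof -
  let ?M = "lebesgue_on {-pi..pi}"
  let ?u = "\<lambda>z. f z - g z"
  have u: "?u \<in> L2 \<Pi>" by (rule L2_diff[OF f g])
  have uc: "shifts ?u m \<in> L2 cell" for m by (rule shifts_L2_cell[OF u])
  let ?Tf = "\<lambda>N. trig_sum (shifts f) (int_ball N)" and ?Tg = "\<lambda>N. trig_sum (shifts g) (int_ball N)"
    and ?Tu = "\<lambda>N. trig_sum (shifts ?u) (int_ball N)"
  let ?nf = "\<lambda>N \<eta>. (L2_norm cell (\<lambda>z. ?Tf N \<eta> z - floquet cell f \<eta> z))\<^sup>2"
  let ?ng = "\<lambda>N \<eta>. (L2_norm cell (\<lambda>z. ?Tg N \<eta> z - floquet cell g \<eta> z))\<^sup>2"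
  have nfi: "integrable ?M (?nf N)" for N
    by (rule bochner_L2_trig_sum_diff_integrable[where \<phi> = "shifts f", OF shifts_L2_cell[OF f] _ floquet_spec(1)[OF f]]) simp
  have ngi: "integrable ?M (?ng N)" for N
    by (rule bochner_L2_trig_sum_diff_integrable[where \<phi> = "shifts g", OF shifts_L2_cell[OF g] _ floquet_spec(1)[OF g]]) simp
  have Tu: "?Tu N \<eta> z = ?Tf N \<eta> z - ?Tg N \<eta> z" for N \<eta> z
    by (simp add: trig_sum_def right_diff_distrib sum_subtractf)
  have le: "AE \<eta> in ?M. (L2_norm cell (?Tu N \<eta>))\<^sup>2 \<le> 2 * ?nf N \<eta> + 2 * ?ng N \<eta>" for N
    using eq AE_lebesgue_on_pi
  proof eventually_elim
    case (elim \<eta>)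
    have L: "?Tf N \<eta> \<in> L2 cell" "?Tg N \<eta> \<in> L2 cell" "floquet cell f \<eta> \<in> L2 cell" "floquet cell g \<eta> \<in> L2 cell"
      using trig_sum_L2[where \<phi> = "shifts f", OF shifts_L2_cell[OF f]] trig_sum_L2[where \<phi> = "shifts g", OF shifts_L2_cell[OF g]]
        floquet_L2[OF f elim(2)] floquet_L2[OF g elim(2)] by auto
    have "L2_norm cell (?Tu N \<eta>) = L2_norm cell (\<lambda>z. (?Tf N \<eta> z - floquet cell f \<eta> z) - (?Tg N \<eta> z - floquet cell g \<eta> z))"
    proof (rule L2_norm_cong_AE)
      show "?Tu N \<eta> \<in> L2 cell" by (rule trig_sum_L2) (rule uc)
      show "AE z in lebesgue_on cell. ?Tu N \<eta> z = (?Tf N \<eta> z - floquet cell f \<eta> z) - (?Tg N \<eta> z - floquet cell g \<eta> z)"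
        using elim(1) by eventually_elim (simp add: Tu)
    qed (intro L2_diff L)
    then show ?case using L2_norm_diff_power2_le[OF L2_diff[OF L(1,3)] L2_diff[OF L(2,4)]] by simp
  qed
  have bound: "(\<Sum>m\<in>int_ball N. (L2_norm cell (shifts ?u m))\<^sup>2) \<le> 2 * (LINT \<eta>|?M. ?nf N \<eta>) + 2 * (LINT \<eta>|?M. ?ng N \<eta>)" for N
  proof -
    have "(\<Sum>m\<in>int_ball N. (L2_norm cell (shifts ?u m))\<^sup>2) = (LINT \<eta>|?M. (L2_norm cell (?Tu N \<eta>))\<^sup>2)"
      by (rule trig_sum_Parseval[where \<phi> = "shifts ?u", OF uc, symmetric]) simp
    also have "\<dots> \<le> (LINT \<eta>|?M. 2 * ?nf N \<eta> + 2 * ?ng N \<eta>)"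
    proof (rule integral_mono_AE)
      show "integrable ?M (\<lambda>\<eta>. (L2_norm cell (?Tu N \<eta>))\<^sup>2)"
        by (rule trig_sum_norm_integrable[where \<phi> = "shifts ?u", OF uc]) simp
      show "integrable ?M (\<lambda>\<eta>. 2 * ?nf N \<eta> + 2 * ?ng N \<eta>)" using nfi ngi by simp
    qed (rule le)
    also have "\<dots> = 2 * (LINT \<eta>|?M. ?nf N \<eta>) + 2 * (LINT \<eta>|?M. ?ng N \<eta>)" using nfi ngi by simp
    finally show ?thesis .
  qed
  have "(\<lambda>N. 2 * (LINT \<eta>|?M. ?nf N \<eta>) + 2 * (LINT \<eta>|?M. ?ng N \<eta>)) \<longlonglongrightarrow> 2 * 0 + 2 * 0"
    by (intro tendsto_add tendsto_mult_left floquet_integrals(1) f g)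
  then have "(\<lambda>N. 2 * (LINT \<eta>|?M. ?nf N \<eta>) + 2 * (LINT \<eta>|?M. ?ng N \<eta>)) \<longlonglongrightarrow> 0" by simp
  then have lim0: "(\<lambda>N. \<Sum>m\<in>int_ball N. (L2_norm cell (shifts ?u m))\<^sup>2) \<longlonglongrightarrow> 0"
  proof (rule Lim_null_comparison[rotated], intro always_eventually allI)
    fix N
    have "0 \<le> (\<Sum>m\<in>int_ball N. (L2_norm cell (shifts ?u m))\<^sup>2)" by (intro sum_nonneg) simp
    then show "norm (\<Sum>m\<in>int_ball N. (L2_norm cell (shifts ?u m))\<^sup>2) \<le> 2 * (LINT \<eta>|?M. ?nf N \<eta>) + 2 * (LINT \<eta>|?M. ?ng N \<eta>)"
      using bound[of N] by (simp only: real_norm_def abs_of_nonneg)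
  qed
  have "(\<lambda>N. \<Sum>m\<in>int_ball N. (L2_norm cell (shifts ?u m))\<^sup>2) \<longlonglongrightarrow> (L2_norm \<Pi> ?u)\<^sup>2"
    unfolding L2_norm_power2 by (rule cell_decomposition[OF L2_square_integrable[OF u]])
  from LIMSEQ_unique[OF this lim0] have "L2_norm \<Pi> ?u = 0" by simp
  then show ?thesis using L2_norm_eq_0_iff[OF u] by simp
qed

text \<open>The Bergman projection itself is a witness for the choice in \<open>floquet_inv\<close>,
  and injectivity of the transform makes any other choice equal to it almost everywhere.\<close>

lemma floquet_inv_fiber_proj:
  assumes f: "f \<in> L2 \<Pi>"
  shows "AE z in lebesgue_on \<Pi>. bergman_proj \<Pi> f z = floquet_inv cell (fiber_proj a b cell (floquet cell f)) z"
proof -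
  let ?g = "fiber_proj a b cell (floquet cell f)"
  let ?h = "bergman_proj \<Pi> f"
  have h: "?h \<in> L2 \<Pi>" by (rule A2_L2[OF bergman_proj_A2[OF f]])
  have hg: "AE \<eta> in lebesgue_on {-pi..pi}. AE z in lebesgue_on cell. floquet cell ?h \<eta> z = ?g \<eta> z"
    using floquet_bergman_proj[OF f] by (simp add: fiber_proj_def)
  have "\<exists>k. k \<in> L2 \<Pi> \<and> (AE \<eta> in lebesgue_on {-pi..pi}. AE z in lebesgue_on cell. floquet cell k \<eta> z = ?g \<eta> z)"
    using h hg by blast
  from someI_ex[OF this]
  have k: "floquet_inv cell ?g \<in> L2 \<Pi>"
    "AE \<eta> in lebesgue_on {-pi..pi}. AE z in lebesgue_on cell. floquet cell (floquet_inv cell ?g) \<eta> z = ?g \<eta> z"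
    unfolding floquet_inv_def by blast+
  show ?thesis
  proof (rule floquet_unique[OF h k(1)])
    show "AE \<eta> in lebesgue_on {-pi..pi}. AE z in lebesgue_on cell. floquet cell ?h \<eta> z = floquet cell (floquet_inv cell ?g) \<eta> z"
      using hg k(2)
    proof eventually_elim
      case (elim \<eta>)
      then show ?case by eventually_elim simp
    qed
  qed
qed

end

text \<open>Integrability is asserted beside the equations because the integral of a non-integrable
  function is 0 by convention, and the equations alone could hold for the wrong reason.\<close>

theorem theorem4p3:
  fixes M a b :: real and cell :: "complex set"
  assumes "M > 0" and "a < b"
    and "cell \<subseteq> {z. 0 < Re z \<and> Re z < 1 \<and> - M < Im z \<and> Im z < M}"
    and "closure cell \<inter> {z. Re z = 0} = {z. Re z = 0 \<and> a \<le> Im z \<and> Im z \<le> b}"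
    and "closure cell \<inter> {z. Re z = 1} = {z. Re z = 1 \<and> a \<le> Im z \<and> Im z \<le> b}"
    and "lipschitz_domain cell" and "lipschitz_domain (periodic_domain cell)"
    and "piecewise_smooth_boundary cell"
    and "piecewise_smooth_boundary (periodic_domain cell)"
  shows "\<forall>f \<in> L2 (periodic_domain cell). AE z in lebesgue_on (periodic_domain cell).
    (let I1 = (\<lambda>\<eta>. exp (\<i> * of_int \<lfloor>Re z\<rfloor> * of_real \<eta>) *
                    quasi_proj a b cell \<eta> (floquet cell f \<eta>) (z - of_int \<lfloor>Re z\<rfloor>));
         I2 = (\<lambda>w \<eta>. exp (\<i> * of_real \<eta> * (of_int \<lfloor>Re z\<rfloor> - of_int \<lfloor>Re w\<rfloor>)) *
                    quasi_kernel a b cell \<eta> (z - of_int \<lfloor>Re z\<rfloor>) (w - of_int \<lfloor>Re w\<rfloor>) * f w)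
     in bergman_proj (periodic_domain cell) f z =
          floquet_inv cell (fiber_proj a b cell (floquet cell f)) z \<and>
        integrable (lebesgue_on {-pi..pi}) I1 \<and>
        floquet_inv cell (fiber_proj a b cell (floquet cell f)) z =
          1 / sqrt (2 * pi) * (LINT \<eta>|lebesgue_on {-pi..pi}. I1 \<eta>) \<and>
        (AE w in lebesgue_on (periodic_domain cell). integrable (lebesgue_on {-pi..pi}) (I2 w)) \<and>
        integrable (lebesgue_on (periodic_domain cell))
          (\<lambda>w. LINT \<eta>|lebesgue_on {-pi..pi}. I2 w \<eta>) \<and>
        1 / sqrt (2 * pi) * (LINT \<eta>|lebesgue_on {-pi..pi}. I1 \<eta>) =
          1 / (2 * pi) * (LINT w|lebesgue_on (periodic_domain cell).
                            (LINT \<eta>|lebesgue_on {-pi..pi}. I2 w \<eta>)))"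
proof
  interpret periodic_cell M a b cell
    using assms(3-6) by (rule periodic_cell.intro)
  fix f assume f: "f \<in> L2 \<Pi>"
  have in\<Pi>: "AE z in lebesgue_on \<Pi>. z \<in> \<Pi>" by (rule AE_I2) simp
  show "AE z in lebesgue_on \<Pi>.
    (let I1 = (\<lambda>\<eta>. exp (\<i> * of_int \<lfloor>Re z\<rfloor> * of_real \<eta>) *
                    quasi_proj a b cell \<eta> (floquet cell f \<eta>) (z - of_int \<lfloor>Re z\<rfloor>));
         I2 = (\<lambda>w \<eta>. exp (\<i> * of_real \<eta> * (of_int \<lfloor>Re z\<rfloor> - of_int \<lfloor>Re w\<rfloor>)) *
                    quasi_kernel a b cell \<eta> (z - of_int \<lfloor>Re z\<rfloor>) (w - of_int \<lfloor>Re w\<rfloor>) * f w)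
     in bergman_proj \<Pi> f z =
          floquet_inv cell (fiber_proj a b cell (floquet cell f)) z \<and>
        integrable (lebesgue_on {-pi..pi}) I1 \<and>
        floquet_inv cell (fiber_proj a b cell (floquet cell f)) z =
          1 / sqrt (2 * pi) * (LINT \<eta>|lebesgue_on {-pi..pi}. I1 \<eta>) \<and>
        (AE w in lebesgue_on \<Pi>. integrable (lebesgue_on {-pi..pi}) (I2 w)) \<and>
        integrable (lebesgue_on \<Pi>)
          (\<lambda>w. LINT \<eta>|lebesgue_on {-pi..pi}. I2 w \<eta>) \<and>
        1 / sqrt (2 * pi) * (LINT \<eta>|lebesgue_on {-pi..pi}. I1 \<eta>) =
          1 / (2 * pi) * (LINT w|lebesgue_on \<Pi>.
                            (LINT \<eta>|lebesgue_on {-pi..pi}. I2 w \<eta>)))"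
    using floquet_inv_fiber_proj[OF f] AE_Pdom_off_lines in\<Pi>
  proof eventually_elim
    case (elim z)
    let ?M = "lebesgue_on {-pi..pi}"
    let ?m = "\<lfloor>Re z\<rfloor>" and ?z = "z - of_int \<lfloor>Re z\<rfloor>"
    \<comment> \<open>Almost every z has non-integer real part, so that its representative lies in
      the open cell, where P_\<eta> and K_\<eta> have definite values.\<close>
    have z: "?z \<in> cell" by (rule Pdom_off_lines[OF elim(3,2)])
    let ?I1 = "\<lambda>\<eta>. exp (\<i> * of_int ?m * of_real \<eta>) * quasi_proj a b cell \<eta> (floquet cell f \<eta>) ?z"
    let ?I2 = "\<lambda>w \<eta>. exp (\<i> * of_real \<eta> * (of_int ?m - of_int \<lfloor>Re w\<rfloor>)) *
                    quasi_kernel a b cell \<eta> ?z (w - of_int \<lfloor>Re w\<rfloor>) * f w"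
    have I1: "integrable ?M ?I1" "(LINT \<eta>|?M. ?I1 \<eta>) = sqrt (2 * pi) * bergman_proj \<Pi> f z"
      using bergman_proj_inversion[OF f z, of ?m] by (simp_all add: mult.assoc mult.commute[of "of_int ?m"])
    \<comment> \<open>The reproducing kernel of \<open>A2 \<Pi>\<close> at the fixed z; the double
      integral turns out to be 2 pi times the pairing of f with it.\<close>
    obtain \<kappa> where \<kappa>: "\<kappa> \<in> A2 \<Pi>" "\<And>g. g \<in> A2 \<Pi> \<Longrightarrow> g z = L2_inner \<Pi> g \<kappa>"
      using reproducing_kernel_exists[OF open_Pdom A2_closed_subspace_A2 elim(3)] by metis
    have \<kappa>': "\<forall>g\<in>A2 \<Pi>. g (?z + of_int ?m) = L2_inner \<Pi> g \<kappa>" using \<kappa>(2) by simp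
    have \<kappa>L: "\<kappa> \<in> L2 \<Pi>" using \<kappa>(1) by (rule A2_L2)
    have I2: "integrable ?M (?I2 w) \<and> (LINT \<eta>|?M. ?I2 w \<eta>) = 2 * pi * (f w * cnj (\<kappa> w))"
      if w: "w \<in> \<Pi>" "Re w \<notin> \<int>" for w
    proof -
      have wc: "w - of_int \<lfloor>Re w\<rfloor> \<in> cell" by (rule Pdom_off_lines[OF w])
      note * = quasi_kernel_inversion[OF z \<kappa>(1) \<kappa>' wc, of "\<lfloor>Re w\<rfloor>"]
      show ?thesis using *(1) *(2) by (simp add: mult_ac)
    qed
    have I2AE: "AE w in lebesgue_on \<Pi>. integrable ?M (?I2 w) \<and> 2 * pi * (f w * cnj (\<kappa> w)) = (LINT \<eta>|?M. ?I2 w \<eta>)"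
      using AE_Pdom_off_lines in\<Pi> by eventually_elim (simp only: I2 simp_thms)
    have fk: "integrable (lebesgue_on \<Pi>) (\<lambda>w. 2 * pi * (f w * cnj (\<kappa> w)))"
      using L2_inner_integrable[OF f \<kappa>L] by (rule integrable_mult_right)
    have I2eq: "AE w in lebesgue_on \<Pi>. 2 * pi * (f w * cnj (\<kappa> w)) = (LINT \<eta>|?M. ?I2 w \<eta>)"
      using I2AE by eventually_elim blast
    \<comment> \<open>The inner integral inherits measurability in w from an integrable function
      with which it agrees almost everywhere.\<close>
    have I2m: "(\<lambda>w. LINT \<eta>|?M. ?I2 w \<eta>) \<in> borel_measurable (lebesgue_on \<Pi>)"
      by (rule borel_measurable_lebesgue_on_cong_AE[OF Pdom_lebesgue borel_measurable_integrable[OF fk] I2eq])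
    have I2i: "integrable (lebesgue_on \<Pi>) (\<lambda>w. LINT \<eta>|?M. ?I2 w \<eta>)"
      by (rule integrable_cong_AE_imp[OF fk I2m I2eq])
    have "(LINT w|lebesgue_on \<Pi>. (LINT \<eta>|?M. ?I2 w \<eta>)) = (LINT w|lebesgue_on \<Pi>. 2 * pi * (f w * cnj (\<kappa> w)))"
      by (rule integral_cong_AE[OF I2m borel_measurable_integrable[OF fk]]) (use I2eq in \<open>auto elim: eventually_mono\<close>)
    also have "\<dots> = 2 * pi * L2_inner \<Pi> f \<kappa>" unfolding L2_inner_def by (rule integral_mult_right_zero)
    also have "L2_inner \<Pi> f \<kappa> = L2_inner \<Pi> (bergman_proj \<Pi> f) \<kappa>"
      unfolding bergman_proj_def by (rule L2_inner_orth_proj[OF open_Pdom A2_closed_subspace_A2 f \<kappa>(1), symmetric])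
    also have "\<dots> = bergman_proj \<Pi> f z" by (rule \<kappa>(2)[OF bergman_proj_A2[OF f], symmetric])
    finally have J: "(LINT w|lebesgue_on \<Pi>. (LINT \<eta>|?M. ?I2 w \<eta>)) = 2 * pi * bergman_proj \<Pi> f z" .
    have A: "1 / sqrt (2 * pi) * (LINT \<eta>|?M. ?I1 \<eta>) = bergman_proj \<Pi> f z" unfolding I1(2) by simp
    have B: "1 / (2 * pi) * (LINT w|lebesgue_on \<Pi>. (LINT \<eta>|?M. ?I2 w \<eta>)) = bergman_proj \<Pi> f z" unfolding J by simp
    have C: "AE w in lebesgue_on \<Pi>. integrable ?M (?I2 w)" using I2AE by eventually_elim blast
    show ?case
      unfolding Let_def A B using elim(1) I1(1) C I2i by simp
  qed
qed

end
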